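(* Let $\bar\nu\in\mathbb{C}^n/P$ and let $k$ be the number of all $i$ for which $\bar\nu_i=\bar0$ (that is, $\nu_i\in\mathbb{Z}$). Then $\mathcal{F}_n^{\bar\nu}$ is equivalent to the category of (finite-dimensional) representations of the quiver with relations $V_k$.
   Context: The ground field is $\mathbb{C}$. $\mathcal{A}_n$ is the Weyl algebra of polynomial differential operators on $\mathbb{A}^n$ with standard generators $t_1,\dots,t_n,\partial_1,\dots,\partial_n$. An $\mathcal{A}_n$-module $M$ is a weight module if $M=\bigoplus_{\mu\in\mathbb{C}^n}M^{\mu}$, $M^{\mu}=\{m: t_i\partial_i(m)=\mu_i m\ \forall i\}$; $\operatorname{supp}M=\{\mu: M^{\mu}\neq0\}$. $\mathcal{F}_n$ is the category of weight $\mathcal{A}_n$-modules with finite-dimensional weight spaces; $P=\mathbb{Z}^n$, and for $\bar\nu=\nu+P\in\mathbb{C}^n/P$, $\mathcal{F}_n^{\bar\nu}$ is the subcategory of modules in $\mathcal{F}_n$ with support contained in $\bar\nu$. The quiver with relations $V_k$: its vertices are the vertices of the cube in $\mathbb{R}^k$ with coordinates $1$ or $-1$; its arrows are the edges of the cube, each taken with both possible orientations. A path is called admissible if each coordinate function is weakly monotonic along the path. The relations are: each non-admissible path is zero, and every two admissible paths with the same starting point and the same end point are equal. (In particular $V_1$ has two vertices, arrows $\varphi^+,\varphi^-$ in opposite directions, and relations $\varphi^+\varphi^-=\varphi^-\varphi^+=0$.) *)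

theory Defs
  imports
    "HOL-Library.Poly_Mapping"
    "HOL-Library.Equipollence"
    "Jordan_Normal_Form.VS_Connect"
    "Graph_Theory.Arc_Walk"
begin

section \<open>Categories and equivalence\<close>

text \<open>
  Composition carries its three objects, because morphisms below are extensional functions and
  composing them requires the domain: \<open>Comp C a b c g f\<close> is the composite of \<open>f\<close> from \<open>a\<close> to \<open>b\<close>
  followed by \<open>g\<close> from \<open>b\<close> to \<open>c\<close>.
\<close>

record ('o, 'm) cat =
  Obj :: "'o set"
  Hom :: "'o \<Rightarrow> 'o \<Rightarrow> 'm set"
  Idn :: "'o \<Rightarrow> 'm"
  Comp :: "'o \<Rightarrow> 'o \<Rightarrow> 'o \<Rightarrow> 'm \<Rightarrow> 'm \<Rightarrow> 'm"

locale category =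
  fixes C :: "('o, 'm) cat"
  assumes Idn_Hom: "a \<in> Obj C \<Longrightarrow> Idn C a \<in> Hom C a a"
    and Comp_Hom: "\<lbrakk>a \<in> Obj C; b \<in> Obj C; c \<in> Obj C; f \<in> Hom C a b; g \<in> Hom C b c\<rbrakk>
      \<Longrightarrow> Comp C a b c g f \<in> Hom C a c"
    and Comp_Idn_right: "\<lbrakk>a \<in> Obj C; b \<in> Obj C; f \<in> Hom C a b\<rbrakk> \<Longrightarrow> Comp C a a b f (Idn C a) = f"
    and Comp_Idn_left: "\<lbrakk>a \<in> Obj C; b \<in> Obj C; f \<in> Hom C a b\<rbrakk> \<Longrightarrow> Comp C a b b (Idn C b) f = f"
    and Comp_assoc: "\<lbrakk>a \<in> Obj C; b \<in> Obj C; c \<in> Obj C; d \<in> Obj C;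
        f \<in> Hom C a b; g \<in> Hom C b c; h \<in> Hom C c d\<rbrakk>
      \<Longrightarrow> Comp C a b d (Comp C b c d h g) f = Comp C a c d h (Comp C a b c g f)"

definition is_iso :: "('o, 'm) cat \<Rightarrow> 'o \<Rightarrow> 'o \<Rightarrow> 'm \<Rightarrow> bool" where
  "is_iso C a b f \<longleftrightarrow> f \<in> Hom C a b \<and>
     (\<exists>g \<in> Hom C b a. Comp C a b a g f = Idn C a \<and> Comp C b a b f g = Idn C b)"

record ('o1, 'm1, 'o2, 'm2) cfunctor =
  fobj :: "'o1 \<Rightarrow> 'o2"
  fmap :: "'o1 \<Rightarrow> 'o1 \<Rightarrow> 'm1 \<Rightarrow> 'm2"

definition is_functor ::
    "('o1, 'm1) cat \<Rightarrow> ('o2, 'm2) cat \<Rightarrow> ('o1, 'm1, 'o2, 'm2) cfunctor \<Rightarrow> bool" where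
  "is_functor C D F \<longleftrightarrow>
     (\<forall>a \<in> Obj C. fobj F a \<in> Obj D) \<and>
     (\<forall>a \<in> Obj C. \<forall>b \<in> Obj C. \<forall>f \<in> Hom C a b. fmap F a b f \<in> Hom D (fobj F a) (fobj F b)) \<and>
     (\<forall>a \<in> Obj C. fmap F a a (Idn C a) = Idn D (fobj F a)) \<and>
     (\<forall>a \<in> Obj C. \<forall>b \<in> Obj C. \<forall>c \<in> Obj C. \<forall>f \<in> Hom C a b. \<forall>g \<in> Hom C b c.
        fmap F a c (Comp C a b c g f)
          = Comp D (fobj F a) (fobj F b) (fobj F c) (fmap F b c g) (fmap F a b f))"

definition id_functor :: "('o, 'm, 'o, 'm) cfunctor" where
  "id_functor = \<lparr>fobj = (\<lambda>a. a), fmap = (\<lambda>a b f. f)\<rparr>"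

definition comp_functor :: "('o2, 'm2, 'o3, 'm3) cfunctor \<Rightarrow> ('o1, 'm1, 'o2, 'm2) cfunctor
    \<Rightarrow> ('o1, 'm1, 'o3, 'm3) cfunctor" where
  "comp_functor G F = \<lparr>fobj = (\<lambda>a. fobj G (fobj F a)),
     fmap = (\<lambda>a b f. fmap G (fobj F a) (fobj F b) (fmap F a b f))\<rparr>"

definition is_nat_iso :: "('o1, 'm1) cat \<Rightarrow> ('o2, 'm2) cat \<Rightarrow> ('o1, 'm1, 'o2, 'm2) cfunctor
    \<Rightarrow> ('o1, 'm1, 'o2, 'm2) cfunctor \<Rightarrow> ('o1 \<Rightarrow> 'm2) \<Rightarrow> bool" where
  "is_nat_iso C D F G \<eta> \<longleftrightarrow>
     (\<forall>a \<in> Obj C. is_iso D (fobj F a) (fobj G a) (\<eta> a)) \<and>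
     (\<forall>a \<in> Obj C. \<forall>b \<in> Obj C. \<forall>f \<in> Hom C a b.
        Comp D (fobj F a) (fobj F b) (fobj G b) (\<eta> b) (fmap F a b f)
          = Comp D (fobj F a) (fobj G a) (fobj G b) (fmap G a b f) (\<eta> a))"

definition equivalent_categories :: "('o1, 'm1) cat \<Rightarrow> ('o2, 'm2) cat \<Rightarrow> bool" where
  "equivalent_categories C D \<longleftrightarrow> category C \<and> category D \<and>
     (\<exists>F G \<eta> \<epsilon>. is_functor C D F \<and> is_functor D C G \<and>
        is_nat_iso C C id_functor (comp_functor G F) \<eta> \<and>
        is_nat_iso D D (comp_functor F G) id_functor \<epsilon>)"


section \<open>The Weyl algebra\<close>

text \<open>
  The type \<open>'n\<close> indexes the variables, so \<open>n = CARD('n)\<close>.  A polynomial is a finitely supported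
  family of coefficients indexed by exponent vectors.
\<close>

type_synonym 'n cpoly = "('n \<Rightarrow>\<^sub>0 nat) \<Rightarrow>\<^sub>0 complex"

type_synonym 'n poly_op = "'n cpoly \<Rightarrow> 'n cpoly"

definition scalar_op :: "complex \<Rightarrow> 'n::finite poly_op" where
  "scalar_op c p = Poly_Mapping.single 0 c * p"

definition t_op :: "'n \<Rightarrow> 'n::finite poly_op" where
  "t_op i p = Poly_Mapping.single (Poly_Mapping.single i 1) 1 * p"

text \<open>
  If \<open>lookup m i = 0\<close>, the truncated exponent \<open>m - single i 1\<close> occurs with coefficient zero.
\<close>

definition d_op :: "'n \<Rightarrow> 'n::finite poly_op" where
  "d_op i p = (\<Sum>m \<in> Poly_Mapping.keys p. Poly_Mapping.single (m - Poly_Mapping.single i 1)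
     (of_nat (Poly_Mapping.lookup m i) * Poly_Mapping.lookup p m))"

inductive_set weyl_ops :: "'n::finite poly_op set" where
  scalar: "scalar_op c \<in> weyl_ops"
| t: "t_op i \<in> weyl_ops"
| d: "d_op i \<in> weyl_ops"
| add: "\<lbrakk>A \<in> weyl_ops; B \<in> weyl_ops\<rbrakk> \<Longrightarrow> (\<lambda>p. A p + B p) \<in> weyl_ops"
| comp: "\<lbrakk>A \<in> weyl_ops; B \<in> weyl_ops\<rbrakk> \<Longrightarrow> A \<circ> B \<in> weyl_ops"

definition weyl_algebra :: "'n::finite poly_op ring" where
  "weyl_algebra = \<lparr>carrier = weyl_ops, monoid.mult = (\<circ>), one = id,
     zero = (\<lambda>p. 0), add = (\<lambda>A B p. A p + B p)\<rparr>"

lemma lookup_d_op: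
  "Poly_Mapping.lookup (d_op i p) m
     = of_nat (Poly_Mapping.lookup m i + 1) * Poly_Mapping.lookup p (m + Poly_Mapping.single i 1)"
proof -
  let ?e = "Poly_Mapping.single i (1::nat)"
  have "Poly_Mapping.lookup (d_op i p) m = (\<Sum>l \<in> Poly_Mapping.keys p.
      (of_nat (Poly_Mapping.lookup l i) * Poly_Mapping.lookup p l when l - ?e = m))"
    by (simp add: d_op_def lookup_sum lookup_single)
  also have "\<dots> = (\<Sum>l \<in> Poly_Mapping.keys p. if l = m + ?e
      then of_nat (Poly_Mapping.lookup l i) * Poly_Mapping.lookup p l else 0)"
  proof (rule sum.cong)
    fix l :: "'a \<Rightarrow>\<^sub>0 nat"
    show "(of_nat (Poly_Mapping.lookup l i) * Poly_Mapping.lookup p l when l - ?e = m)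
        = (if l = m + ?e then of_nat (Poly_Mapping.lookup l i) * Poly_Mapping.lookup p l else 0)"
    proof (cases "Poly_Mapping.lookup l i = 0")
      case False
      have "l - ?e + ?e = l"
      proof (rule poly_mapping_eqI)
        fix j
        show "Poly_Mapping.lookup (l - ?e + ?e) j = Poly_Mapping.lookup l j"
          using False by (cases "j = i") (simp_all add: lookup_add lookup_minus lookup_single)
      qed
      then have "l - ?e = m \<longleftrightarrow> l = m + ?e"
        by (metis add_diff_cancel_right')
      then show ?thesis
        by (simp only: when_def)
    next
      case True
      then show ?thesis
        by (simp only: when_def of_nat_0 mult_zero_left if_cancel)
    qed
  qed simp
  also have "\<dots> = of_nat (Poly_Mapping.lookup m i + 1) * Poly_Mapping.lookup p (m + ?e)"
    by (simp add: in_keys_iff lookup_add)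
  finally show ?thesis .
qed

lemma weyl_ops_add: "A \<in> weyl_ops \<Longrightarrow> A (p + q) = A p + A q"
proof (induction arbitrary: p q rule: weyl_ops.induct)
  case (d i)
  show ?case
    by (rule poly_mapping_eqI) (simp add: lookup_d_op lookup_add distrib_left del: of_nat_add)
qed (simp_all add: scalar_op_def t_op_def distrib_left add_ac)

lemma ring_weyl_algebra: "ring (weyl_algebra :: 'n::finite poly_op ring)"
proof -
  have "scalar_op (1::complex) = (id :: 'n poly_op)" "scalar_op (0::complex) = (\<lambda>p :: 'n cpoly. 0)"
    by (auto simp: scalar_op_def fun_eq_iff)
  then have closed: "(id :: 'n poly_op) \<in> weyl_ops" "(\<lambda>p :: 'n cpoly. 0) \<in> weyl_ops"
    by (metis weyl_ops.scalar)+
  have neg: "\<exists>B \<in> weyl_ops. (\<lambda>p. A p + B p) = (\<lambda>p. 0)" if "A \<in> weyl_ops" for A :: "'n poly_op"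
  proof
    show "scalar_op (-1) \<circ> A \<in> weyl_ops"
      using that by (intro weyl_ops.comp weyl_ops.scalar)
    show "(\<lambda>p. A p + (scalar_op (-1) \<circ> A) p) = (\<lambda>p. 0)"
      by (simp add: scalar_op_def single_uminus)
  qed
  have "abelian_group (weyl_algebra :: 'n poly_op ring)"
    by (rule abelian_groupI) (simp_all add: weyl_algebra_def closed weyl_ops.add add_ac neg)
  moreover have "monoid (weyl_algebra :: 'n poly_op ring)"
    by (rule monoidI) (simp_all add: weyl_algebra_def closed weyl_ops.comp comp_assoc)
  ultimately show ?thesis
    by (rule ringI) (simp_all add: weyl_algebra_def fun_eq_iff weyl_ops_add)
qed


section \<open>Weight modules\<close>

text \<open>
  The library locale \<^locale>\<open>module\<close> demands a commutative ring.  The record type of modules is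
  reused; its multiplicative fields carry no meaning here or below.
\<close>

locale left_module = R?: ring R + M?: abelian_group M
  for R :: "('r, 'c) ring_scheme" (structure) and M :: "('r, 'a, 'd) module_scheme" (structure) +
  assumes smult_closed: "\<lbrakk>a \<in> carrier R; x \<in> carrier M\<rbrakk> \<Longrightarrow> a \<odot>\<^bsub>M\<^esub> x \<in> carrier M"
    and smult_l_distr: "\<lbrakk>a \<in> carrier R; b \<in> carrier R; x \<in> carrier M\<rbrakk>
      \<Longrightarrow> (a \<oplus>\<^bsub>R\<^esub> b) \<odot>\<^bsub>M\<^esub> x = a \<odot>\<^bsub>M\<^esub> x \<oplus>\<^bsub>M\<^esub> b \<odot>\<^bsub>M\<^esub> x"
    and smult_r_distr: "\<lbrakk>a \<in> carrier R; x \<in> carrier M; y \<in> carrier M\<rbrakk>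
      \<Longrightarrow> a \<odot>\<^bsub>M\<^esub> (x \<oplus>\<^bsub>M\<^esub> y) = a \<odot>\<^bsub>M\<^esub> x \<oplus>\<^bsub>M\<^esub> a \<odot>\<^bsub>M\<^esub> y"
    and smult_assoc: "\<lbrakk>a \<in> carrier R; b \<in> carrier R; x \<in> carrier M\<rbrakk>
      \<Longrightarrow> (a \<otimes>\<^bsub>R\<^esub> b) \<odot>\<^bsub>M\<^esub> x = a \<odot>\<^bsub>M\<^esub> (b \<odot>\<^bsub>M\<^esub> x)"
    and smult_one: "x \<in> carrier M \<Longrightarrow> \<one>\<^bsub>R\<^esub> \<odot>\<^bsub>M\<^esub> x = x"

definition weight_space :: "('n::finite poly_op, 'a) module \<Rightarrow> ('n \<Rightarrow> complex) \<Rightarrow> 'a set" where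
  "weight_space M \<mu> = {m \<in> carrier M. \<forall>i.
     (t_op i \<otimes>\<^bsub>weyl_algebra\<^esub> d_op i) \<odot>\<^bsub>M\<^esub> m = scalar_op (\<mu> i) \<odot>\<^bsub>M\<^esub> m}"

definition weight_vs :: "('n::finite poly_op, 'a) module \<Rightarrow> ('n \<Rightarrow> complex)
    \<Rightarrow> (complex, 'a) module" where
  "weight_vs M \<mu> = \<lparr>carrier = weight_space M \<mu>, monoid.mult = monoid.mult M, one = one M,
     zero = zero M, add = add M, smult = (\<lambda>c m. scalar_op c \<odot>\<^bsub>M\<^esub> m)\<rparr>"

definition weight_module :: "('n::finite poly_op, 'a) module \<Rightarrow> bool" where
  "weight_module M \<longleftrightarrow> left_module weyl_algebra M \<and>
     (\<forall>m \<in> carrier M. \<exists>!f :: ('n \<Rightarrow> complex) \<Rightarrow> 'a.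
        (\<forall>\<mu>. f \<mu> \<in> weight_space M \<mu>) \<and> finite {\<mu>. f \<mu> \<noteq> \<zero>\<^bsub>M\<^esub>} \<and>
        m = (\<Oplus>\<^bsub>M\<^esub>\<mu> \<in> {\<mu>. f \<mu> \<noteq> \<zero>\<^bsub>M\<^esub>}. f \<mu>))"

definition weight_supp :: "('n::finite poly_op, 'a) module \<Rightarrow> ('n \<Rightarrow> complex) set" where
  "weight_supp M = {\<mu>. weight_space M \<mu> \<noteq> {\<zero>\<^bsub>M\<^esub>}}"

definition fin_weight_modules :: "('n::finite poly_op, 'a) module set" where
  "fin_weight_modules =
     {M. weight_module M \<and> (\<forall>\<mu>. vectorspace.fin_dim class_ring (weight_vs M \<mu>))}"

definition weight_coset :: "('n::finite \<Rightarrow> complex) \<Rightarrow> ('n \<Rightarrow> complex) set" where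
  "weight_coset \<nu> = {\<mu>. \<forall>i. \<mu> i - \<nu> i \<in> \<int>}"

text \<open>
  HOL has no category of all modules: carriers are subsets of a type \<open>'a\<close>.  Modules supported on a
  coset with finite-dimensional weight spaces have countable dimension over the complex numbers, so
  as soon as \<open>'a\<close> has at least the cardinality of the continuum, every such module is isomorphic to
  one carried by a subset of \<open>'a\<close>.  The same applies to the type carrying quiver representations.
\<close>

definition weight_cat :: "('n::finite \<Rightarrow> complex) set
    \<Rightarrow> (('n poly_op, 'a) module, 'a \<Rightarrow> 'a) cat" where
  "weight_cat S = \<lparr>
     Obj = {M \<in> fin_weight_modules. weight_supp M \<subseteq> S},
     Hom = (\<lambda>M N. LinearCombinations.module_hom weyl_algebra M N \<inter> extensional (carrier M)),
     Idn = (\<lambda>M. \<lambda>x \<in> carrier M. x),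
     Comp = (\<lambda>L M N g f. compose (carrier L) g f)\<rparr>"


section \<open>Representations of the cube quiver with relations\<close>

definition cube_quiver :: "nat \<Rightarrow> (nat \<Rightarrow> int, (nat \<Rightarrow> int) \<times> (nat \<Rightarrow> int)) pre_digraph" where
  "cube_quiver k = \<lparr>
     verts = {..<k} \<rightarrow>\<^sub>E {-1, 1},
     arcs = {(u, v). u \<in> {..<k} \<rightarrow>\<^sub>E {-1, 1} \<and> v \<in> {..<k} \<rightarrow>\<^sub>E {-1, 1} \<and> (\<exists>!i. i < k \<and> u i \<noteq> v i)},
     tail = fst, head = snd\<rparr>"

abbreviation quiver_path :: "('v, 'e) pre_digraph \<Rightarrow> 'v \<Rightarrow> 'e list \<Rightarrow> 'v \<Rightarrow> bool" where
  "quiver_path \<equiv> pre_digraph.awalk"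

definition admissible :: "nat \<Rightarrow> (nat \<Rightarrow> int) \<Rightarrow> ((nat \<Rightarrow> int) \<times> (nat \<Rightarrow> int)) list \<Rightarrow> bool" where
  "admissible k u p \<longleftrightarrow> (\<forall>i < k.
     let xs = map (\<lambda>w. w i) (pre_digraph.awalk_verts (cube_quiver k) u p)
     in sorted_wrt (\<le>) xs \<or> sorted_wrt (\<ge>) xs)"

record ('v, 'e, 'b) quiver_rep =
  rspace :: "'v \<Rightarrow> (complex, 'b) module"
  rmap :: "'e \<Rightarrow> 'b \<Rightarrow> 'b"

definition fin_quiver_rep :: "('v, 'e) pre_digraph \<Rightarrow> ('v, 'e, 'b) quiver_rep \<Rightarrow> bool" where
  "fin_quiver_rep Q V \<longleftrightarrow>
     (\<forall>v \<in> verts Q. vectorspace class_ring (rspace V v) \<and>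
        vectorspace.fin_dim class_ring (rspace V v)) \<and>
     (\<forall>e \<in> arcs Q. linear_map class_ring (rspace V (tail Q e)) (rspace V (head Q e)) (rmap V e))"

text \<open>The arcs of a path are listed in the order in which they are traversed.\<close>

primrec path_map :: "('v, 'e, 'b) quiver_rep \<Rightarrow> 'e list \<Rightarrow> 'b \<Rightarrow> 'b" where
  "path_map V [] x = x"
| "path_map V (e # p) x = path_map V p (rmap V e x)"

definition cube_relations ::
    "nat \<Rightarrow> (nat \<Rightarrow> int, (nat \<Rightarrow> int) \<times> (nat \<Rightarrow> int), 'b) quiver_rep \<Rightarrow> bool" where
  "cube_relations k V \<longleftrightarrow>
     (\<forall>u p v. quiver_path (cube_quiver k) u p v \<and> \<not> admissible k u p \<longrightarrow>
        (\<forall>x \<in> carrier (rspace V u). path_map V p x = \<zero>\<^bsub>rspace V v\<^esub>)) \<and>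
     (\<forall>u p q v. quiver_path (cube_quiver k) u p v \<and> quiver_path (cube_quiver k) u q v \<and>
        admissible k u p \<and> admissible k u q \<longrightarrow>
        (\<forall>x \<in> carrier (rspace V u). path_map V p x = path_map V q x))"

definition quiver_rep_hom :: "('v, 'e) pre_digraph \<Rightarrow> ('v, 'e, 'b) quiver_rep
    \<Rightarrow> ('v, 'e, 'b) quiver_rep \<Rightarrow> ('v \<Rightarrow> 'b \<Rightarrow> 'b) set" where
  "quiver_rep_hom Q V W =
     {h \<in> (\<Pi>\<^sub>E v \<in> verts Q.
         LinearCombinations.module_hom class_ring (rspace V v) (rspace W v) \<inter> extensional (carrier (rspace V v))).
      \<forall>e \<in> arcs Q. \<forall>x \<in> carrier (rspace V (tail Q e)).
        h (head Q e) (rmap V e x) = rmap W e (h (tail Q e) x)}"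

definition cube_rep_cat :: "nat
    \<Rightarrow> ((nat \<Rightarrow> int, (nat \<Rightarrow> int) \<times> (nat \<Rightarrow> int), 'b) quiver_rep, (nat \<Rightarrow> int) \<Rightarrow> 'b \<Rightarrow> 'b) cat" where
  "cube_rep_cat k = \<lparr>
     Obj = {V. fin_quiver_rep (cube_quiver k) V \<and> cube_relations k V},
     Hom = quiver_rep_hom (cube_quiver k),
     Idn = (\<lambda>V. \<lambda>v \<in> verts (cube_quiver k). \<lambda>x \<in> carrier (rspace V v). x),
     Comp = (\<lambda>U V W g f. \<lambda>v \<in> verts (cube_quiver k). compose (carrier (rspace U v)) (g v) (f v))\<rparr>"

end

theory Submission
  imports Defs
begin

text \<open>
  Let M be a weight module with support in \<nu> + \<int>^n. On the weight space of weight \<mu> the operators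
  t_i \<partial>_i and \<partial>_i t_i are the scalars \<mu>_i and \<mu>_i + 1. Hence t_i maps the weight space of
  \<mu> isomorphically onto that of \<mu> + e_i unless \<mu>_i = -1, and in that exceptional case both
  composites of t_i and \<partial>_i between the two spaces vanish. If \<nu>_i is not an integer, no wall
  \<mu>_i = -1 is ever met in direction i; if \<nu>_i is an integer, the wall cuts the lattice into two
  halves. The k walls cut the coset into 2^k chambers, and within a chamber all weight spaces are
  identified. What remains of M is one space for each chamber, that is, for each vertex of the cube, and
  the maps t_i, \<partial>_i across the walls. They commute in different directions and compose to
  zero in the same direction, and these are the relations of the quiver
  (\<open>cube_relations_iff\<close>): a path in the cube is admissible iff it crosses no direction twice, two
  admissible paths with the same ends differ by a permutation of directions, and in an inadmissible
  path the two crossings of one direction can be moved next to each other.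

  The functor \<open>F\<close> sends M to its weight spaces at one reference weight in each chamber, with
  coordinates 0 or -1 in the integral directions. It is full and faithful because monomials in the
  t_i link every weight space to the one at its reference weight by isomorphisms \<open>theta\<close>; a
  compatible family of maps at the reference weights therefore extends uniquely to all weight spaces
  (\<open>extend_from_references\<close>), and then to the direct sum.

  It is essentially surjective because a representation V can be spread out again: finitely
  supported sections that take at \<mu> a value in the space of the chamber of \<mu>, on which t_i acts by
  the identity off the wall and by the arrow of V at the wall, and \<partial>_i by a scalar or an arrow. These
  operators satisfy the defining relations of the Weyl algebra, but the Weyl algebra is given as an algebra
  of operators on polynomials, so it must be shown that the relations alone determine an action. This is
  \<open>rep_unique\<close>, and it rests on the simplicity of the Weyl algebra (\<open>simplicity\<close>): an expression in
  t_i, \<partial>_i that vanishes on the polynomials vanishes on every representation of the relations.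

  Both categories live on carriers inside fixed types, so finite-dimensional spaces have to be embedded
  into the type \<open>'b\<close> and modules of sections into \<open>'a\<close>; by cardinality there is room in both.
\<close>

section \<open>Fully faithful, essentially surjective functors\<close>

locale ff_es_functor = C: category C + D: category D
  for C :: "('o1, 'm1) cat" and D :: "('o2, 'm2) cat" +
  fixes F :: "('o1, 'm1, 'o2, 'm2) cfunctor"
  assumes is_fun: "is_functor C D F"
    and full: "\<lbrakk>a \<in> Obj C; b \<in> Obj C; g \<in> Hom D (fobj F a) (fobj F b)\<rbrakk>
      \<Longrightarrow> \<exists>f \<in> Hom C a b. fmap F a b f = g"
    and faithful: "\<lbrakk>a \<in> Obj C; b \<in> Obj C; f \<in> Hom C a b; f' \<in> Hom C a b;
      fmap F a b f = fmap F a b f'\<rbrakk> \<Longrightarrow> f = f'"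
    and ess_surj: "d \<in> Obj D \<Longrightarrow> \<exists>c \<in> Obj C. \<exists>f. is_iso D (fobj F c) d f"
begin

lemma obj: "a \<in> Obj C \<Longrightarrow> fobj F a \<in> Obj D"
  and hom: "\<lbrakk>a \<in> Obj C; b \<in> Obj C; f \<in> Hom C a b\<rbrakk> \<Longrightarrow> fmap F a b f \<in> Hom D (fobj F a) (fobj F b)"
  and idn: "a \<in> Obj C \<Longrightarrow> fmap F a a (Idn C a) = Idn D (fobj F a)"
  and comp: "\<lbrakk>a \<in> Obj C; b \<in> Obj C; c \<in> Obj C; f \<in> Hom C a b; g \<in> Hom C b c\<rbrakk>
    \<Longrightarrow> fmap F a c (Comp C a b c g f)
      = Comp D (fobj F a) (fobj F b) (fobj F c) (fmap F b c g) (fmap F a b f)"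
  using is_fun unfolding is_functor_def by blast+

definition pre :: "'o1 \<Rightarrow> 'o1 \<Rightarrow> 'm2 \<Rightarrow> 'm1" where
  "pre a b g = (SOME f. f \<in> Hom C a b \<and> fmap F a b f = g)"

lemma pre:
  assumes "a \<in> Obj C" "b \<in> Obj C" "g \<in> Hom D (fobj F a) (fobj F b)"
  shows "pre a b g \<in> Hom C a b" "fmap F a b (pre a b g) = g"
  using someI_ex[of "\<lambda>f. f \<in> Hom C a b \<and> fmap F a b f = g"] full[OF assms]
  unfolding pre_def by blast+

lemma pre_comp:
  assumes "a \<in> Obj C" "b \<in> Obj C" "c \<in> Obj C"
    "f \<in> Hom D (fobj F a) (fobj F b)" "g \<in> Hom D (fobj F b) (fobj F c)"
  shows "Comp C a b c (pre b c g) (pre a b f)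
    = pre a c (Comp D (fobj F a) (fobj F b) (fobj F c) g f)"
  by (rule faithful[of a c]) (use assms in \<open>simp_all add: pre comp C.Comp_Hom D.Comp_Hom obj\<close>)

lemma pre_Idn: "a \<in> Obj C \<Longrightarrow> pre a a (Idn D (fobj F a)) = Idn C a"
  by (rule faithful[of a a]) (simp_all add: pre idn obj C.Idn_Hom D.Idn_Hom)

lemma pre_fmap: "\<lbrakk>a \<in> Obj C; b \<in> Obj C; f \<in> Hom C a b\<rbrakk> \<Longrightarrow> pre a b (fmap F a b f) = f"
  by (rule faithful[of a b]) (simp_all add: pre hom)

text \<open>
  The quasi-inverse sends \<open>d\<close> to a chosen object with an isomorphism \<open>e d\<close> from its image to \<open>d\<close>, and a
  morphism \<open>f\<close> from \<open>d\<close> to \<open>d'\<close> to the preimage of its conjugate by \<open>e d\<close> and \<open>e d'\<close>. Every equation between morphisms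
  of the source category is checked after applying the faithful functor.
\<close>

theorem equivalence: "equivalent_categories C D"
proof -
  obtain G0 e where G0: "\<And>d. d \<in> Obj D \<Longrightarrow> G0 d \<in> Obj C"
    and e_iso: "\<And>d. d \<in> Obj D \<Longrightarrow> is_iso D (fobj F (G0 d)) d (e d)"
    using ess_surj by metis
  from e_iso obtain e' where e: "\<And>d. d \<in> Obj D \<Longrightarrow> e d \<in> Hom D (fobj F (G0 d)) d"
    and e': "\<And>d. d \<in> Obj D \<Longrightarrow> e' d \<in> Hom D d (fobj F (G0 d))"
    and e'e: "\<And>d. d \<in> Obj D \<Longrightarrow>
      Comp D (fobj F (G0 d)) d (fobj F (G0 d)) (e' d) (e d) = Idn D (fobj F (G0 d))"
    and ee': "\<And>d. d \<in> Obj D \<Longrightarrow> Comp D d (fobj F (G0 d)) d (e d) (e' d) = Idn D d"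
    unfolding is_iso_def by metis
  \<comment> \<open>the conjugate of \<open>f\<close> by the chosen isomorphisms\<close>
  define K where "K = (\<lambda>d d' f. Comp D (fobj F (G0 d)) d' (fobj F (G0 d')) (e' d')
    (Comp D (fobj F (G0 d)) d d' f (e d)))"
  define G where "G = \<lparr>fobj = G0, fmap = (\<lambda>d d' f. pre (G0 d) (G0 d') (K d d' f))\<rparr>"
  define \<eta> where "\<eta> = (\<lambda>a. pre a (G0 (fobj F a)) (e' (fobj F a)))"
  note obs = G0 obj e e' D.Comp_Hom D.Idn_Hom C.Comp_Hom C.Idn_Hom pre hom
  have K: "K d d' f \<in> Hom D (fobj F (G0 d)) (fobj F (G0 d'))"
    if "d \<in> Obj D" "d' \<in> Obj D" "f \<in> Hom D d d'" for d d' f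
    using that unfolding K_def by (simp add: obs)
  have eK: "Comp D (fobj F (G0 d)) (fobj F (G0 d')) d' (e d') (K d d' f)
      = Comp D (fobj F (G0 d)) d d' f (e d)"
    if "d \<in> Obj D" "d' \<in> Obj D" "f \<in> Hom D d d'" for d d' f
    using that unfolding K_def
    by (subst D.Comp_assoc[symmetric]) (simp_all add: obs ee' D.Comp_Idn_left)
  have Ke': "Comp D d (fobj F (G0 d)) (fobj F (G0 d')) (K d d' f) (e' d)
      = Comp D d d' (fobj F (G0 d')) (e' d') f"
    if "d \<in> Obj D" "d' \<in> Obj D" "f \<in> Hom D d d'" for d d' f
  proof -
    have "Comp D d (fobj F (G0 d)) (fobj F (G0 d')) (K d d' f) (e' d)
      = Comp D d d' (fobj F (G0 d')) (e' d')
         (Comp D d (fobj F (G0 d)) d' (Comp D (fobj F (G0 d)) d d' f (e d)) (e' d))"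
      unfolding K_def by (rule D.Comp_assoc) (use that in \<open>simp_all add: obs\<close>)
    also have "Comp D d (fobj F (G0 d)) d' (Comp D (fobj F (G0 d)) d d' f (e d)) (e' d)
      = Comp D d d d' f (Comp D d (fobj F (G0 d)) d (e d) (e' d))"
      by (rule D.Comp_assoc) (use that in \<open>simp_all add: obs\<close>)
    also have "\<dots> = f"
      using that by (simp add: ee' D.Comp_Idn_right)
    finally show ?thesis .
  qed
  have K_comp: "K d1 d3 (Comp D d1 d2 d3 g f)
      = Comp D (fobj F (G0 d1)) (fobj F (G0 d2)) (fobj F (G0 d3)) (K d2 d3 g) (K d1 d2 f)"
    if "d1 \<in> Obj D" "d2 \<in> Obj D" "d3 \<in> Obj D" "f \<in> Hom D d1 d2" "g \<in> Hom D d2 d3"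
    for d1 d2 d3 f g
  proof -
    have "Comp D (fobj F (G0 d1)) (fobj F (G0 d2)) (fobj F (G0 d3)) (K d2 d3 g) (K d1 d2 f)
      = Comp D (fobj F (G0 d1)) d3 (fobj F (G0 d3)) (e' d3)
          (Comp D (fobj F (G0 d1)) (fobj F (G0 d2)) d3
             (Comp D (fobj F (G0 d2)) d2 d3 g (e d2)) (K d1 d2 f))"
      unfolding fun_cong[OF fun_cong[OF fun_cong[OF K_def]], of d2 d3 g] by (rule D.Comp_assoc) (use that in \<open>simp_all add: obs K\<close>)
    also have "Comp D (fobj F (G0 d1)) (fobj F (G0 d2)) d3
             (Comp D (fobj F (G0 d2)) d2 d3 g (e d2)) (K d1 d2 f)
        = Comp D (fobj F (G0 d1)) d2 d3 g
             (Comp D (fobj F (G0 d1)) (fobj F (G0 d2)) d2 (e d2) (K d1 d2 f))"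
      by (rule D.Comp_assoc) (use that in \<open>simp_all add: obs K\<close>)
    also have "\<dots> = Comp D (fobj F (G0 d1)) d2 d3 g (Comp D (fobj F (G0 d1)) d1 d2 f (e d1))"
      using that by (simp add: eK)
    also have "\<dots> = Comp D (fobj F (G0 d1)) d1 d3 (Comp D d1 d2 d3 g f) (e d1)"
      by (rule D.Comp_assoc[symmetric]) (use that in \<open>simp_all add: obs K\<close>)
    finally show ?thesis
      by (simp add: K_def)
  qed
  have K_Idn: "K d d (Idn D d) = Idn D (fobj F (G0 d))" if "d \<in> Obj D" for d
    using that unfolding K_def by (simp add: obs D.Comp_Idn_left e'e)
  have G: "is_functor D C G"
    unfolding is_functor_def G_def
    by (auto simp: obs K K_comp K_Idn pre_comp pre_Idn)
  have nat_\<eta>: "is_nat_iso C C id_functor (comp_functor G F) \<eta>"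
    unfolding is_nat_iso_def
  proof (intro conjI ballI)
    fix a assume a: "a \<in> Obj C"
    let ?b = "G0 (fobj F a)"
    have b: "?b \<in> Obj C" using a by (simp add: obs)
    have "pre ?b a (e (fobj F a)) \<in> Hom C ?b a" "\<eta> a \<in> Hom C a ?b"
      using a b by (simp_all add: \<eta>_def obs)
    moreover have "Comp C a ?b a (pre ?b a (e (fobj F a))) (\<eta> a) = Idn C a"
      using a b by (simp add: \<eta>_def pre_comp pre_Idn obs ee')
    moreover have "Comp C ?b a ?b (\<eta> a) (pre ?b a (e (fobj F a))) = Idn C ?b"
      using a b by (simp add: \<eta>_def pre_comp pre_Idn obs e'e)
    ultimately show "is_iso C (fobj id_functor a) (fobj (comp_functor G F) a) (\<eta> a)"
      by (auto simp: is_iso_def id_functor_def comp_functor_def G_def)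
  next
    fix a b f assume ab: "a \<in> Obj C" "b \<in> Obj C" and f: "f \<in> Hom C a b"
    let ?a = "G0 (fobj F a)" and ?b = "G0 (fobj F b)"
    have o: "?a \<in> Obj C" "?b \<in> Obj C" using ab by (simp_all add: obs)
    have "Comp C a b ?b (\<eta> b) f = Comp C a b ?b (\<eta> b) (pre a b (fmap F a b f))"
      by (simp add: pre_fmap ab f)
    also have "\<dots> = pre a ?b (Comp D (fobj F a) (fobj F b) (fobj F ?b) (e' (fobj F b)) (fmap F a b f))"
      unfolding \<eta>_def by (rule pre_comp) (use ab f o in \<open>simp_all add: obs\<close>)
    also have "\<dots> = pre a ?b (Comp D (fobj F a) (fobj F ?a) (fobj F ?b)
        (K (fobj F a) (fobj F b) (fmap F a b f)) (e' (fobj F a)))"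
      using ab f by (subst Ke') (simp_all add: obs)
    also have "\<dots> = Comp C a ?a ?b (pre ?a ?b (K (fobj F a) (fobj F b) (fmap F a b f))) (\<eta> a)"
      unfolding \<eta>_def by (rule pre_comp[symmetric]) (use ab f o in \<open>simp_all add: obs K\<close>)
    finally show "Comp C (fobj id_functor a) (fobj id_functor b) (fobj (comp_functor G F) b) (\<eta> b)
        (fmap id_functor a b f) = Comp C (fobj id_functor a) (fobj (comp_functor G F) a)
          (fobj (comp_functor G F) b) (fmap (comp_functor G F) a b f) (\<eta> a)"
      by (simp add: id_functor_def comp_functor_def G_def)
  qed
  have nat_\<epsilon>: "is_nat_iso D D (comp_functor F G) id_functor e"
    unfolding is_nat_iso_def
  proof (intro conjI ballI)
    fix d assume "d \<in> Obj D"
    then show "is_iso D (fobj (comp_functor F G) d) (fobj id_functor d) (e d)"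
      by (simp add: id_functor_def comp_functor_def G_def e_iso)
  next
    fix a b f assume ab: "a \<in> Obj D" "b \<in> Obj D" and f: "f \<in> Hom D a b"
    then show "Comp D (fobj (comp_functor F G) a) (fobj (comp_functor F G) b) (fobj id_functor b)
        (e b) (fmap (comp_functor F G) a b f) = Comp D (fobj (comp_functor F G) a)
          (fobj id_functor a) (fobj id_functor b) (fmap id_functor a b f) (e a)"
      by (simp add: id_functor_def comp_functor_def G_def pre K G0 eK)
  qed
  show ?thesis
    unfolding equivalent_categories_def
    using C.category_axioms D.category_axioms is_fun G nat_\<eta> nat_\<epsilon> by blast
qed

end

section \<open>Cardinalities\<close>

lemma square_lepoll: assumes "infinite A" shows "A \<times> A \<lesssim> A"
proof (rule eqpoll_imp_lepoll)
  show "A \<times> A \<approx> A"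
    unfolding eqpoll_iff_card_of_ordIso
    using card_of_Times_infinite[of A A] card_of_mono1[of A A] assms by auto
qed

text \<open>
  Folding a pairing function over a list codes all lists of one length injectively. Codes of lists of
  different lengths may collide, so the length is paired with the code.
\<close>

lemma lists_lepoll:
  fixes A :: "'c set"
  assumes "infinite A" shows "lists A \<lesssim> A"
proof -
  obtain p where p: "inj_on p (A \<times> A)" "p ` (A \<times> A) \<subseteq> A"
    using square_lepoll[OF assms] by (auto simp: lepoll_def)
  obtain \<iota> :: "nat \<Rightarrow> 'c" where \<iota>: "inj \<iota>" "range \<iota> \<subseteq> A"
    using iffD1[OF infinite_le_lepoll assms] unfolding lepoll_def by blast
  have pA: "p (x, y) \<in> A" if "x \<in> A" "y \<in> A" for x y using that p(2) by blast
  have \<iota>A: "\<iota> n \<in> A" for n using \<iota>(2) by blast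
  define enc where "enc = (\<lambda>xs. foldr (\<lambda>x y. p (x, y)) xs (\<iota> 0))"
  have encA: "enc xs \<in> A" if "xs \<in> lists A" for xs
    using that by (induction xs) (simp_all add: enc_def pA \<iota>A)
  have enc_inj: "xs = ys" if "xs \<in> lists A" "ys \<in> lists A" "length xs = length ys" "enc xs = enc ys" for xs ys
    using that(3,1,2,4)
  proof (induction xs ys rule: list_induct2)
    case (Cons x xs y ys)
    then have "p (x, enc xs) = p (y, enc ys)" by (simp add: enc_def)
    then have "(x, enc xs) = (y, enc ys)"
      using Cons.prems by (intro inj_onD[OF p(1)]) (simp_all add: encA)
    then show ?case using Cons.IH Cons.prems by simp
  qed simp
  have "inj_on (\<lambda>xs. p (\<iota> (length xs), enc xs)) (lists A)"
  proof (rule inj_onI)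
    fix xs ys assume l: "xs \<in> lists A" "ys \<in> lists A"
      and "p (\<iota> (length xs), enc xs) = p (\<iota> (length ys), enc ys)"
    then have "(\<iota> (length xs), enc xs) = (\<iota> (length ys), enc ys)"
      by (intro inj_onD[OF p(1)]) (simp_all add: encA \<iota>A)
    then show "xs = ys" using enc_inj[OF l] injD[OF \<iota>(1)] by simp
  qed
  moreover have "(\<lambda>xs. p (\<iota> (length xs), enc xs)) ` lists A \<subseteq> A"
    using encA by (auto intro: pA \<iota>A)
  ultimately show ?thesis unfolding lepoll_def by blast
qed

text \<open>
  A function that differs from a default value at finitely many places is determined by the list of
  its exceptional values. This bounds a finite-dimensional space (through coordinates), the set of
  weights, and the set of finitely supported sections of a family of spaces.
\<close>

lemma finite_support_lepoll:
  fixes z :: "'x \<Rightarrow> 'b" and C :: "'c set"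
  assumes C: "infinite C" and "X \<lesssim> C" "B \<lesssim> C"
  shows "{f. finite {x. f x \<noteq> z x} \<and> (\<forall>x. f x \<noteq> z x \<longrightarrow> x \<in> X \<and> f x \<in> B)} \<lesssim> C"
proof -
  obtain g h where g: "inj_on g X" "g ` X \<subseteq> C" and h: "inj_on h B" "h ` B \<subseteq> C"
    using assms(2,3) unfolding lepoll_def by blast
  define F where "F = {f. finite {x. f x \<noteq> z x} \<and> (\<forall>x. f x \<noteq> z x \<longrightarrow> x \<in> X \<and> f x \<in> B)}"
  define l where "l f = (SOME xs. set xs = {(x, y). y = f x \<and> y \<noteq> z x})" for f
  have l: "set (l f) = {(x, y). y = f x \<and> y \<noteq> z x}" if "f \<in> F" for f
    unfolding l_def
  proof (rule someI_ex, rule finite_list)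
    have "{(x, y). y = f x \<and> y \<noteq> z x} = (\<lambda>x. (x, f x)) ` {x. f x \<noteq> z x}" by auto
    then show "finite {(x, y). y = f x \<and> y \<noteq> z x}" using that by (simp add: F_def)
  qed
  have "F \<lesssim> lists (X \<times> B)"
    unfolding lepoll_def
  proof (intro exI[of _ l] conjI inj_onI)
    fix f f' assume "f \<in> F" "f' \<in> F" and eq: "l f = l f'"
    then have "{(x, y). y = f x \<and> y \<noteq> z x} = {(x, y). y = f' x \<and> y \<noteq> z x}"
      using l[OF \<open>f \<in> F\<close>] l[OF \<open>f' \<in> F\<close>] unfolding eq by simp
    then have "y = f x \<and> y \<noteq> z x \<longleftrightarrow> y = f' x \<and> y \<noteq> z x" for x y
      unfolding set_eq_iff by (auto dest: spec[of _ "(x, y)"])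
    then show "f = f'" by (intro ext) metis
  next
    show "l ` F \<subseteq> lists (X \<times> B)"
    proof (intro image_subsetI)
      fix f assume "f \<in> F"
      then have "set (l f) \<subseteq> X \<times> B" unfolding l[OF \<open>f \<in> F\<close>] by (auto simp: F_def)
      then show "l f \<in> lists (X \<times> B)" by (simp add: lists_eq_set)
    qed
  qed
  also have "lists (X \<times> B) \<lesssim> lists C"
  proof -
    obtain q where q: "inj_on q (C \<times> C)" "q ` (C \<times> C) \<subseteq> C"
      using square_lepoll[OF C] unfolding lepoll_def by blast
    have "inj_on (\<lambda>(x, b). q (g x, h b)) (X \<times> B)"
    proof (rule inj_onI, clarify)
      fix x b x' b' assume a: "x \<in> X" "b \<in> B" "x' \<in> X" "b' \<in> B" and "q (g x, h b) = q (g x', h b')"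
      then have "(g x, h b) = (g x', h b')"
        using g(2) h(2) by (intro inj_onD[OF q(1)]) (simp_all add: image_subset_iff)
      then show "x = x' \<and> b = b'" using inj_onD[OF g(1), of x x'] inj_onD[OF h(1), of b b'] a by simp
    qed
    then have "inj_on (map (\<lambda>(x, b). q (g x, h b))) (lists (X \<times> B))"
      by (rule inj_on_map_lists)
    moreover have "(case u of (x, b) \<Rightarrow> q (g x, h b)) \<in> C" if "u \<in> X \<times> B" for u
    proof -
      have "(g (fst u), h (snd u)) \<in> C \<times> C" using that g(2) h(2) by (auto simp: image_subset_iff)
      then have "q (g (fst u), h (snd u)) \<in> C" using q(2) by (simp only: image_subset_iff)
      then show ?thesis by (simp add: case_prod_beta)
    qed
    then have "map (\<lambda>(x, b). q (g x, h b)) ` lists (X \<times> B) \<subseteq> lists C"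
      by (simp add: image_subset_iff in_lists_conv_set)
    ultimately show ?thesis unfolding lepoll_def by blast
  qed
  also have "lists C \<lesssim> C" using C by (rule lists_lepoll)
  finally show ?thesis unfolding F_def .
qed

lemma infinite_complex: "infinite (UNIV :: complex set)"
  using infinite_UNIV_char_0 .

lemma finite_functions_lepoll: "(UNIV :: ('n::finite \<Rightarrow> complex) set) \<lesssim> (UNIV :: complex set)"
proof -
  have "{f :: 'n \<Rightarrow> complex. finite {x. f x \<noteq> 0} \<and> (\<forall>x. f x \<noteq> 0 \<longrightarrow> x \<in> UNIV \<and> f x \<in> UNIV)} \<lesssim> (UNIV :: complex set)"
    by (rule finite_support_lepoll[OF infinite_complex finite_lepoll_infinite[OF infinite_complex] lepoll_refl]) simp
  then show ?thesis by simp
qed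

lemma fin_dim_lepoll:
  fixes V :: "(complex, 'b) module"
  assumes "vectorspace class_ring V" "vectorspace.fin_dim class_ring V"
  shows "carrier V \<lesssim> (UNIV :: complex set)"
proof -
  interpret V: vectorspace "class_ring :: complex ring" V by fact
  obtain A where A: "finite A" "A \<subseteq> carrier V" "V.span A = carrier V"
    using assms(2) unfolding V.fin_dim_def by blast
  let ?F = "{f. finite {x. f x \<noteq> (0 :: complex)} \<and> (\<forall>x. f x \<noteq> 0 \<longrightarrow> x \<in> A \<and> f x \<in> UNIV)}"
  have "carrier V \<subseteq> (\<lambda>a. V.lincomb a A) ` ?F"
  proof
    fix v assume v: "v \<in> carrier V"
    then obtain a where a: "v = V.lincomb a A"
      using V.finite_span[OF A(1,2)] A(3) by auto
    let ?a = "\<lambda>x. if x \<in> A then a x else 0"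
    have "V.lincomb ?a A = V.lincomb a A"
      using A(2) by (intro V.lincomb_cong) auto
    moreover have "?a \<in> ?F"
      using A(1) by (auto intro: finite_subset[of _ A])
    ultimately show "v \<in> (\<lambda>a. V.lincomb a A) ` ?F" using a by (auto intro!: image_eqI[of _ _ ?a])
  qed
  then have "carrier V \<lesssim> ?F" by (rule subset_image_lepoll)
  also have "?F \<lesssim> (UNIV :: complex set)"
    using A(1)
    by (intro finite_support_lepoll[OF infinite_complex finite_lepoll_infinite[OF infinite_complex] lepoll_refl])
  finally show ?thesis .
qed

section \<open>Transport of structure\<close>

text \<open>
  Transport of structure along an injective map. Its inverse on the carrier is a second argument, so
  that the operations are plain terms and no choice of an inverse is hidden in them.
\<close>

definition transport :: "('a \<Rightarrow> 'b) \<Rightarrow> ('b \<Rightarrow> 'a) \<Rightarrow> ('r, 'a) module \<Rightarrow> ('r, 'b) module" where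
  "transport e d V = \<lparr>carrier = e ` carrier V, monoid.mult = undefined, one = undefined,
     zero = e \<zero>\<^bsub>V\<^esub>, add = (\<lambda>x y. e (d x \<oplus>\<^bsub>V\<^esub> d y)), smult = (\<lambda>r x. e (r \<odot>\<^bsub>V\<^esub> d x))\<rparr>"

locale transporting =
  fixes e :: "'a \<Rightarrow> 'b" and d :: "'b \<Rightarrow> 'a" and V :: "('r, 'a) module"
  assumes d_e: "x \<in> carrier V \<Longrightarrow> d (e x) = x"
begin

lemma transport_abelian_group: assumes "abelian_group V" shows "abelian_group (transport e d V)"
proof -
  interpret V: abelian_group V by fact
  show ?thesis
  proof (rule abelian_groupI)
    fix x assume "x \<in> carrier (transport e d V)"
    then show "\<exists>y \<in> carrier (transport e d V). y \<oplus>\<^bsub>transport e d V\<^esub> x = \<zero>\<^bsub>transport e d V\<^esub>"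
      by (intro bexI[of _ "e (\<ominus>\<^bsub>V\<^esub> d x)"]) (auto simp: transport_def d_e V.l_neg)
  qed (auto simp: transport_def d_e V.a_ac)
qed

lemma transport_vectorspace: assumes "vectorspace K V" shows "vectorspace K (transport e d V)"
proof -
  interpret V: vectorspace K V by fact
  interpret T: abelian_group "transport e d V"
    by (rule transport_abelian_group[OF V.abelian_group_axioms])
  show ?thesis
    by unfold_locales
      (auto simp: transport_def d_e V.smult_l_distr V.smult_r_distr V.smult_assoc1)
qed

lemma transport_hom: "e \<in> LinearCombinations.module_hom K V (transport e d V)"
  by (auto simp: LinearCombinations.module_hom_def transport_def d_e)

lemma transport_fin_dim:
  assumes "vectorspace K V" "vectorspace.fin_dim K V"
  shows "vectorspace.fin_dim K (transport e d V)"
proof -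
  have surj: "e ` carrier V = carrier (transport e d V)" by (simp add: transport_def)
  interpret V: vectorspace K V by fact
  interpret T: vectorspace K "transport e d V" by (rule transport_vectorspace[OF assms(1)])
  interpret linear_map K V "transport e d V" e
    by unfold_locales (rule transport_hom)
  show ?thesis by (rule image_fin_dim[OF assms(2) surj])
qed

end

section \<open>Representations of the Weyl relations\<close>

definition inc :: "'i \<Rightarrow> ('i \<Rightarrow> nat) \<Rightarrow> 'i \<Rightarrow> nat" where "inc i s = s(i := Suc (s i))"

definition dec :: "'i \<Rightarrow> ('i \<Rightarrow> nat) \<Rightarrow> 'i \<Rightarrow> nat" where "dec i s = s(i := s i - 1)"

lemma inc_dec: "dec i (inc i s) = s" "0 < s i \<Longrightarrow> inc i (dec i s) = s"
    "i \<noteq> j \<Longrightarrow> dec j (inc i s) = inc i (dec j s)"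
  and inc_apply: "inc i s j = (if i = j then Suc (s i) else s j)"
  and inc_le: "inc i s \<le> s' \<Longrightarrow> s \<le> dec i s' \<and> 0 < s' i"
  and dec_le: "dec i s \<le> s" "s \<le> s' \<Longrightarrow> dec i s \<le> dec i s'"
  by (auto simp: inc_def dec_def fun_eq_iff le_fun_def diff_le_mono split: if_splits dest: spec[of _ i])

text \<open>
  The defining relations of the Weyl algebra, for operators on an abelian group. The operators are
  functions on the whole type and the relations hold on the carrier only; this is why equality on the
  carrier appears below in place of equality of functions.
\<close>

locale weyl_action = abelian_group M
  for M :: "('c, 'd) ring_scheme" (structure) +
  fixes S :: "complex \<Rightarrow> 'c \<Rightarrow> 'c" and T D :: "'n::finite \<Rightarrow> 'c \<Rightarrow> 'c"
  assumes S_closed: "x \<in> carrier M \<Longrightarrow> S c x \<in> carrier M"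
    and T_closed: "x \<in> carrier M \<Longrightarrow> T i x \<in> carrier M"
    and D_closed: "x \<in> carrier M \<Longrightarrow> D i x \<in> carrier M"
    and S_add: "\<lbrakk>x \<in> carrier M; y \<in> carrier M\<rbrakk> \<Longrightarrow> S c (x \<oplus> y) = S c x \<oplus> S c y"
    and T_add: "\<lbrakk>x \<in> carrier M; y \<in> carrier M\<rbrakk> \<Longrightarrow> T i (x \<oplus> y) = T i x \<oplus> T i y"
    and D_add: "\<lbrakk>x \<in> carrier M; y \<in> carrier M\<rbrakk> \<Longrightarrow> D i (x \<oplus> y) = D i x \<oplus> D i y"
    and S_plus: "x \<in> carrier M \<Longrightarrow> S (a + b) x = S a x \<oplus> S b x"
    and S_S: "x \<in> carrier M \<Longrightarrow> S a (S b x) = S (a * b) x"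
    and S_one: "x \<in> carrier M \<Longrightarrow> S 1 x = x"
    and T_S: "x \<in> carrier M \<Longrightarrow> T i (S c x) = S c (T i x)"
    and D_S: "x \<in> carrier M \<Longrightarrow> D i (S c x) = S c (D i x)"
    and T_T: "x \<in> carrier M \<Longrightarrow> T i (T j x) = T j (T i x)"
    and D_D: "x \<in> carrier M \<Longrightarrow> D i (D j x) = D j (D i x)"
    and D_T: "\<lbrakk>x \<in> carrier M; i \<noteq> j\<rbrakk> \<Longrightarrow> D i (T j x) = T j (D i x)"
    and D_T_same: "x \<in> carrier M \<Longrightarrow> D i (T i x) = T i (D i x) \<oplus> x"
begin

lemma S_0: assumes "x \<in> carrier M" shows "S 0 x = \<zero>"
proof -
  have "S 0 x \<oplus> S 0 x = S 0 x \<oplus> \<zero>"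
    using assms S_plus[of x 0 0] by (simp add: S_closed)
  then show ?thesis
    using assms by (simp add: S_closed del: r_zero)
qed

lemma additive_zero:
  assumes "\<And>x y. x \<in> carrier M \<Longrightarrow> y \<in> carrier M \<Longrightarrow> f (x \<oplus> y) = f x \<oplus> f y"
    and "f \<zero> \<in> carrier M"
  shows "f \<zero> = \<zero>"
proof -
  have "f \<zero> \<oplus> f \<zero> = f \<zero> \<oplus> \<zero>"
    using assms(1)[of \<zero> \<zero>] assms(2) by simp
  then show ?thesis
    using assms(2) by (simp del: r_zero)
qed

lemma S_zero: "S c \<zero> = \<zero>" and T_zero: "T i \<zero> = \<zero>" and D_zero: "D i \<zero> = \<zero>"
  by (rule additive_zero; simp add: S_add S_closed T_add T_closed D_add D_closed)+

lemma S_cancel: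
  assumes "x \<in> carrier M" "S c x = \<zero>" "c \<noteq> 0" shows "x = \<zero>"
  using S_S[of x "inverse c" c] assms by (simp add: S_zero S_one)

lemma S_neg: assumes "x \<in> carrier M" shows "S (-1) x = \<ominus> x"
proof -
  have "S (-1) x \<oplus> x = \<zero>"
    using S_plus[of x "-1" 1] assms by (simp add: S_0 S_one)
  then show ?thesis
    using assms by (simp add: S_closed minus_equality)
qed

lemma S_uminus: "x \<in> carrier M \<Longrightarrow> \<ominus> S c x = S (- c) x"
  using S_S[of x "-1" c] S_neg[of "S c x"] by (simp add: S_closed)

lemmas closeds = S_closed T_closed D_closed

text \<open>
  The normally ordered operators, filtered by degree: \<open>bideg s r X\<close> says that \<open>X\<close> is a sum of words in which all
  \<open>T\<close> stand to the left of all \<open>D\<close>, with at most \<open>s i\<close> factors \<open>T i\<close> and at most \<open>r i\<close> factors \<open>D i\<close>.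
  The rules extend a word only at its left and right end, so no reordering is built in.
\<close>

inductive bideg :: "('n \<Rightarrow> nat) \<Rightarrow> ('n \<Rightarrow> nat) \<Rightarrow> ('c \<Rightarrow> 'c) \<Rightarrow> bool" where
  bideg_S: "bideg s r (S c)"
| bideg_add: "bideg s r X \<Longrightarrow> bideg s r Y \<Longrightarrow> bideg s r (\<lambda>x. X x \<oplus> Y x)"
| bideg_T: "bideg s r X \<Longrightarrow> bideg (inc i s) r (\<lambda>x. T i (X x))"
| bideg_D: "bideg s r X \<Longrightarrow> bideg s (inc i r) (\<lambda>x. X (D i x))"
| bideg_cong: "bideg s r X \<Longrightarrow> (\<And>x. x \<in> carrier M \<Longrightarrow> Y x = X x) \<Longrightarrow> bideg s r Y"

lemma bideg_linear:
  assumes "bideg s r X"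
  shows bideg_closed: "x \<in> carrier M \<Longrightarrow> X x \<in> carrier M"
    and bideg_additive: "\<lbrakk>x \<in> carrier M; y \<in> carrier M\<rbrakk> \<Longrightarrow> X (x \<oplus> y) = X x \<oplus> X y"
  using assms
  by (induction arbitrary: x y rule: bideg.induct)
    (simp_all add: closeds S_add T_add D_add S_S T_S D_S mult.commute a_ac)

lemma bideg_mono: "bideg s r X \<Longrightarrow> s \<le> s' \<Longrightarrow> r \<le> r' \<Longrightarrow> bideg s' r' X"
proof (induction arbitrary: s' r' rule: bideg.induct)
  case (bideg_T s r X i)
  then show ?case
    using bideg.bideg_T[of "dec i s'" r' X i] inc_le[OF bideg_T.prems(1)] by (simp add: inc_dec)
next
  case (bideg_D s r X i)
  then show ?case
    using bideg.bideg_D[of s' "dec i r'" X i] inc_le[OF bideg_D.prems(2)] by (simp add: inc_dec)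
qed (auto intro: bideg.intros)

lemma bideg_zero: "(\<And>x. x \<in> carrier M \<Longrightarrow> X x = \<zero>) \<Longrightarrow> bideg s r X"
  by (rule bideg_cong[OF bideg_S[of s r 0]]) (simp add: S_0)

lemma bideg_scale: "bideg s r X \<Longrightarrow> bideg s r (\<lambda>x. S c (X x))"
proof (induction rule: bideg.induct)
  case (bideg_S s r d)
  show ?case by (rule bideg_cong[OF bideg.bideg_S[of s r "c * d"]]) (simp add: S_S)
next
  case (bideg_add s r X Y)
  show ?case by (rule bideg_cong[OF bideg.bideg_add[OF bideg_add.IH]]) (simp add: S_add bideg_closed[OF bideg_add(1)] bideg_closed[OF bideg_add(2)])
next
  case (bideg_T s r X i)
  show ?case by (rule bideg_cong[OF bideg.bideg_T[OF bideg_T.IH]]) (simp add: T_S bideg_closed[OF bideg_T(1)])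
next
  case (bideg_D s r X i)
  show ?case by (rule bideg_cong[OF bideg.bideg_D[OF bideg_D.IH]]) (simp)
next
  case (bideg_cong s r X Y)
  show ?case by (rule bideg.bideg_cong[OF bideg_cong.IH]) (simp add: bideg_cong)
qed

text \<open>
  The commutators of an operator with \<open>T j\<close> and \<open>D j\<close>, signed so that \<open>comT j (D j)\<close> and \<open>comD j (T j)\<close> are the
  identity. They are the formal derivatives with respect to \<open>D j\<close> and \<open>T j\<close>.
\<close>

definition comT :: "'n \<Rightarrow> ('c \<Rightarrow> 'c) \<Rightarrow> 'c \<Rightarrow> 'c" where
  "comT j X x = X (T j x) \<ominus> T j (X x)"

definition comD :: "'n \<Rightarrow> ('c \<Rightarrow> 'c) \<Rightarrow> 'c \<Rightarrow> 'c" where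
  "comD j X x = D j (X x) \<ominus> X (D j x)"

lemma add_minus: "\<lbrakk>x \<in> carrier M; y \<in> carrier M; z \<in> carrier M; w \<in> carrier M\<rbrakk>
    \<Longrightarrow> (x \<oplus> y) \<ominus> (z \<oplus> w) = (x \<ominus> z) \<oplus> (y \<ominus> w)"
  and add_minus': "\<lbrakk>x \<in> carrier M; y \<in> carrier M; z \<in> carrier M\<rbrakk>
    \<Longrightarrow> (x \<oplus> y) \<ominus> z = (x \<ominus> z) \<oplus> y"
  by (simp_all add: minus_eq minus_add a_ac)

lemma minus_self: "x \<in> carrier M \<Longrightarrow> x \<ominus> x = \<zero>"
  by (simp add: minus_eq r_neg)

lemma T_neg: "x \<in> carrier M \<Longrightarrow> T i (\<ominus> x) = \<ominus> T i x"
  using T_S[of x i "-1"] by (simp add: S_neg closeds)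

lemma neg_zero: "\<ominus> \<zero> = \<zero>"
  using S_neg[of \<zero>] by (simp add: S_zero)

lemma S_minus: "\<lbrakk>x \<in> carrier M; y \<in> carrier M\<rbrakk> \<Longrightarrow> S c (x \<ominus> y) = S c x \<ominus> S c y"
  and T_minus: "\<lbrakk>x \<in> carrier M; y \<in> carrier M\<rbrakk> \<Longrightarrow> T i (x \<ominus> y) = T i x \<ominus> T i y"
  and D_minus: "\<lbrakk>x \<in> carrier M; y \<in> carrier M\<rbrakk> \<Longrightarrow> D i (x \<ominus> y) = D i x \<ominus> D i y"
  using S_S[of y c "-1"] S_S[of y "-1" c] T_S[of y i "-1"] D_S[of y i "-1"]
  by (simp_all add: minus_eq S_add T_add D_add S_neg closeds)

lemma com_rules:
  assumes "x \<in> carrier M" "bideg s r X" "bideg s' r' Y"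
  shows "comT j (S c) x = \<zero>" "comD j (S c) x = \<zero>"
    "comT j (\<lambda>x. X x \<oplus> Y x) x = comT j X x \<oplus> comT j Y x"
    "comD j (\<lambda>x. X x \<oplus> Y x) x = comD j X x \<oplus> comD j Y x"
    "comT j (\<lambda>x. T i (X x)) x = T i (comT j X x)"
    "comD j (\<lambda>x. X (D i x)) x = comD j X (D i x)"
    "i \<noteq> j \<Longrightarrow> comT j (\<lambda>x. X (D i x)) x = comT j X (D i x)"
    "comT j (\<lambda>x. X (D j x)) x = comT j X (D j x) \<oplus> X x"
    "i \<noteq> j \<Longrightarrow> comD j (\<lambda>x. T i (X x)) x = T i (comD j X x)"
    "comD j (\<lambda>x. T j (X x)) x = T j (comD j X x) \<oplus> X x"
  using assms(1) unfolding comT_def comD_def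
  using add_minus'[of "X (T j (D j x))" "X x"] add_minus'[of "T j (D j (X x))" "X x"]
  by (simp_all add: T_S D_S closeds bideg_closed[OF assms(2)] bideg_closed[OF assms(3)]
      bideg_additive[OF assms(2)] T_add D_add add_minus T_minus D_minus D_T D_T_same
      minus_self T_T[of "X x" i j] D_D[of x i j])

text \<open>
  By the product rule the derivative of a word is the sum of the words obtained by deleting one factor \<open>D j\<close>.
\<close>

lemma comT_lower:
  "bideg s r X \<Longrightarrow> bideg s (dec j r) (comT j X) \<and> (r j = 0 \<longrightarrow> (\<forall>x \<in> carrier M. comT j X x = \<zero>))"
proof (induction rule: bideg.induct)
  case (bideg_S s r c)
  show ?case by (auto intro!: bideg_zero simp: com_rules(1,2)[OF _ bideg.bideg_S bideg.bideg_S])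
next
  case (bideg_add s r X Y)
  note c = com_rules(3)[OF _ bideg_add(1,2)]
  from bideg_add.IH have "bideg s (dec j r) (\<lambda>x. comT j X x \<oplus> comT j Y x)"
    by (intro bideg.bideg_add) simp_all
  then have "bideg s (dec j r) (comT j (\<lambda>x. X x \<oplus> Y x))"
    by (rule bideg_cong) (rule c)
  then show ?case using bideg_add.IH by (simp add: c)
next
  case (bideg_T s r X i)
  note c = com_rules(5)[OF _ bideg_T(1) bideg_T(1)]
  show ?case using bideg_cong[OF bideg.bideg_T[OF conjunct1[OF bideg_T.IH]] c] bideg_T.IH by (simp add: c T_zero)
next
  case (bideg_D s r X i)
  note c = com_rules(7,8)[OF _ bideg_D(1) bideg_D(1)]
  show ?case
  proof (cases "i = j")
    case False
    have e: "dec j (inc i r) = inc i (dec j r)" "inc i r j = r j"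
      using False by (simp_all add: inc_dec inc_apply)
    show ?thesis unfolding e
      using False bideg_D.IH bideg_cong[OF bideg.bideg_D[OF conjunct1[OF bideg_D.IH]] c(1)]
      by (simp add: c closeds)
  next
    case True
    have "bideg s r (\<lambda>x. comT j X (D j x))"
    proof (cases "r j = 0")
      case True then show ?thesis using bideg_D.IH by (auto intro!: bideg_zero simp: closeds)
    next
      case False
      then show ?thesis using bideg.bideg_D[of s "dec j r" "comT j X" j] bideg_D.IH by (simp add: inc_dec)
    qed
    moreover have e: "dec j (inc i r) = r" "inc i r j = Suc (r j)"
      using True by (simp_all add: inc_dec inc_apply)
    ultimately show ?thesis
      unfolding e using True bideg_cong[OF bideg.bideg_add[OF _ bideg_D(1)] c(2)] by simp
  qed
next
  case (bideg_cong s r X Y)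
  have "comT j Y x = comT j X x" if "x \<in> carrier M" for x
    using that bideg_cong(2) by (simp add: comT_def closeds)
  then show ?case using bideg_cong.IH by (auto intro: bideg.bideg_cong)
qed

lemma comD_lower:
  "bideg s r X \<Longrightarrow> bideg (dec j s) r (comD j X) \<and> (s j = 0 \<longrightarrow> (\<forall>x \<in> carrier M. comD j X x = \<zero>))"
proof (induction rule: bideg.induct)
  case (bideg_S s r c)
  show ?case by (auto intro!: bideg_zero simp: com_rules(1,2)[OF _ bideg.bideg_S bideg.bideg_S])
next
  case (bideg_add s r X Y)
  note c = com_rules(4)[OF _ bideg_add(1,2)]
  from bideg_add.IH have "bideg (dec j s) r (\<lambda>x. comD j X x \<oplus> comD j Y x)"
    by (intro bideg.bideg_add) simp_all
  then have "bideg (dec j s) r (comD j (\<lambda>x. X x \<oplus> Y x))"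
    by (rule bideg_cong) (rule c)
  then show ?case using bideg_add.IH by (simp add: c)
next
  case (bideg_D s r X i)
  note c = com_rules(6)[OF _ bideg_D(1) bideg_D(1)]
  show ?case using bideg_cong[OF bideg.bideg_D[OF conjunct1[OF bideg_D.IH]] c] bideg_D.IH by (simp add: c closeds)
next
  case (bideg_T s r X i)
  note c = com_rules(9,10)[OF _ bideg_T(1) bideg_T(1)]
  show ?case
  proof (cases "i = j")
    case False
    have e: "dec j (inc i s) = inc i (dec j s)" "inc i s j = s j"
      using False by (simp_all add: inc_dec inc_apply)
    show ?thesis unfolding e
      using False bideg_T.IH bideg_cong[OF bideg.bideg_T[OF conjunct1[OF bideg_T.IH]] c(1)]
      by (simp add: c T_zero)
  next
    case True
    have "bideg s r (\<lambda>x. T j (comD j X x))"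
    proof (cases "s j = 0")
      case True then show ?thesis using bideg_T.IH by (auto intro!: bideg_zero simp: T_zero)
    next
      case False
      then show ?thesis using bideg.bideg_T[of "dec j s" r "comD j X" j] bideg_T.IH by (simp add: inc_dec)
    qed
    moreover have e: "dec j (inc i s) = s" "inc i s j = Suc (s j)"
      using True by (simp_all add: inc_dec inc_apply)
    ultimately show ?thesis
      unfolding e using True bideg_cong[OF bideg.bideg_add[OF _ bideg_T(1)] c(2)] by simp
  qed
next
  case (bideg_cong s r X Y)
  have "comD j Y x = comD j X x" if "x \<in> carrier M" for x
    using that bideg_cong(2) by (simp add: comD_def closeds)
  then show ?case using bideg_cong.IH by (auto intro: bideg.bideg_cong)
qed

lemma S_Suc: "x \<in> carrier M \<Longrightarrow> S (of_nat (Suc n)) x = S (of_nat n) x \<oplus> x"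
  using S_plus[of x "of_nat n" 1] by (simp add: S_one add.commute[of _ 1])

lemma comT_closed: "bideg s r X \<Longrightarrow> x \<in> carrier M \<Longrightarrow> comT j X x \<in> carrier M"
  and comD_closed: "bideg s r X \<Longrightarrow> x \<in> carrier M \<Longrightarrow> comD j X x \<in> carrier M"
  by (simp_all add: comT_def comD_def bideg_closed closeds)

text \<open>
  Euler's identity. Differentiating a word with respect to \<open>D j\<close> and multiplying by \<open>D j\<close> again counts
  its factors \<open>D j\<close>, so after subtracting \<open>r j\<close> times the word only the words with fewer than \<open>r j\<close>
  of them survive.
\<close>

lemma euler_D:
  "bideg s r X \<Longrightarrow> 0 < r j \<Longrightarrow> bideg s (dec j r) (\<lambda>x. comT j X (D j x) \<ominus> S (of_nat (r j)) (X x))"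
proof (induction rule: bideg.induct)
  case (bideg_S s r c)
  show ?case
    by (rule bideg_cong[OF bideg.bideg_S[of s "dec j r" "- (of_nat (r j) * c)"]])
      (simp add: com_rules(1)[OF _ bideg.bideg_S bideg.bideg_S] closeds S_S minus_eq S_uminus)
next
  case (bideg_add s r X Y)
  note c = com_rules(3)[OF _ bideg_add(1,2)] bideg_closed[OF bideg_add(1)] bideg_closed[OF bideg_add(2)]
    comT_closed[OF bideg_add(1)] comT_closed[OF bideg_add(2)]
  show ?case
    by (rule bideg_cong[OF bideg.bideg_add[OF bideg_add.IH]])
     (use bideg_add.prems in \<open>simp_all add: c closeds add_minus S_add\<close>)
next
  case (bideg_T s r X i)
  note c = com_rules(5)[OF _ bideg_T(1) bideg_T(1)] bideg_closed[OF bideg_T(1)] comT_closed[OF bideg_T(1)]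
  show ?case
    by (rule bideg_cong[OF bideg.bideg_T[OF bideg_T.IH[OF bideg_T.prems]]]) (simp add: c closeds T_minus T_S)
next
  case (bideg_D s r X i)
  note c = com_rules(7,8)[OF _ bideg_D(1) bideg_D(1)] bideg_closed[OF bideg_D(1)] comT_closed[OF bideg_D(1)]
  show ?case
  proof (cases "i = j")
    case False
    have e: "dec j (inc i r) = inc i (dec j r)" "inc i r j = r j"
      using False by (simp_all add: inc_dec inc_apply)
    show ?thesis unfolding e
      by (rule bideg_cong[OF bideg.bideg_D[OF bideg_D.IH]]) (use e bideg_D.prems False in \<open>simp_all add: c closeds D_D\<close>)
  next
    case True
    have "bideg s r (\<lambda>x. comT j X (D j (D j x)) \<ominus> S (of_nat (r j)) (X (D j x)))"
    proof (cases "r j = 0")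
      case True then show ?thesis using comT_lower[OF bideg_D(1), of j]
        by (auto intro!: bideg_zero simp: closeds c S_0 minus_eq)
    next
      case False
      then show ?thesis using bideg.bideg_D[OF bideg_D.IH, of j]  by (simp add: inc_dec)
    qed
    moreover have e: "dec j (inc i r) = r" "inc i r j = Suc (r j)"
      using True by (simp_all add: inc_dec inc_apply)
    ultimately show ?thesis
      unfolding e using True
      by - (erule bideg_cong, simp add: c closeds S_Suc minus_eq minus_add a_ac r_neg1 r_neg2 del: of_nat_Suc)
  qed
next
  case (bideg_cong s r X Y)
  have "comT j Y x = comT j X x" if "x \<in> carrier M" for x
    using that bideg_cong(2) by (simp add: comT_def closeds)
  then show ?case
    by (intro bideg.bideg_cong[OF bideg_cong.IH[OF bideg_cong.prems]]) (simp add: closeds bideg_cong(2))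
qed

lemma euler_T:
  "bideg s r X \<Longrightarrow> 0 < s j \<Longrightarrow> bideg (dec j s) r (\<lambda>x. T j (comD j X x) \<ominus> S (of_nat (s j)) (X x))"
proof (induction rule: bideg.induct)
  case (bideg_S s r c)
  show ?case
    by (rule bideg_cong[OF bideg.bideg_S[of "dec j s" r "- (of_nat (s j) * c)"]])
      (simp add: com_rules(2)[OF _ bideg.bideg_S bideg.bideg_S] closeds S_S minus_eq S_uminus T_zero)
next
  case (bideg_add s r X Y)
  note c = com_rules(4)[OF _ bideg_add(1,2)] bideg_closed[OF bideg_add(1)] bideg_closed[OF bideg_add(2)]
    comD_closed[OF bideg_add(1)] comD_closed[OF bideg_add(2)]
  show ?case
    by (rule bideg_cong[OF bideg.bideg_add[OF bideg_add.IH]])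
     (use bideg_add.prems in \<open>simp_all add: c closeds add_minus S_add T_add\<close>)
next
  case (bideg_D s r X i)
  note c = com_rules(6)[OF _ bideg_D(1) bideg_D(1)] bideg_closed[OF bideg_D(1)] comD_closed[OF bideg_D(1)]
  show ?case
    by (rule bideg_cong[OF bideg.bideg_D[OF bideg_D.IH[OF bideg_D.prems]]]) (simp add: c closeds)
next
  case (bideg_T s r X i)
  note c = com_rules(9,10)[OF _ bideg_T(1) bideg_T(1)] bideg_closed[OF bideg_T(1)] comD_closed[OF bideg_T(1)]
  show ?case
  proof (cases "i = j")
    case False
    have e: "dec j (inc i s) = inc i (dec j s)" "inc i s j = s j"
      using False by (simp_all add: inc_dec inc_apply)
    show ?thesis unfolding e
      by (rule bideg_cong[OF bideg.bideg_T[OF bideg_T.IH]])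
        (use e bideg_T.prems False in \<open>simp_all add: c closeds T_minus T_S T_T[of _ i j]\<close>)
  next
    case True
    have "bideg s r (\<lambda>x. T j (T j (comD j X x) \<ominus> S (of_nat (s j)) (X x)))"
    proof (cases "s j = 0")
      case True
      show ?thesis using comD_lower[OF bideg_T(1), of j] True
        by (intro bideg_zero) (simp add: closeds c S_0 minus_eq T_zero neg_zero)
    next
      case False
      then show ?thesis using bideg.bideg_T[OF bideg_T.IH, of j] by (simp add: inc_dec)
    qed
    moreover have e: "dec j (inc i s) = s" "inc i s j = Suc (s j)"
      using True by (simp_all add: inc_dec inc_apply)
    ultimately show ?thesis
      unfolding e using True
      by - (erule bideg_cong, simp add: c closeds S_Suc minus_eq minus_add T_add T_neg T_S a_ac r_neg1 r_neg2 del: of_nat_Suc)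
  qed
next
  case (bideg_cong s r X Y)
  have "comD j Y x = comD j X x" if "x \<in> carrier M" for x
    using that bideg_cong(2) by (simp add: comD_def closeds)
  then show ?case
    by (intro bideg.bideg_cong[OF bideg_cong.IH[OF bideg_cong.prems]]) (simp add: closeds bideg_cong(2))
qed

lemma bideg_00:
  assumes "bideg s r X" "\<And>i. s i = 0" "\<And>i. r i = 0"
  shows "\<exists>c. \<forall>x \<in> carrier M. X x = S c x"
  using assms
proof (induction rule: bideg.induct)
  case (bideg_add s r X Y)
  then obtain a b where "\<forall>x \<in> carrier M. X x = S a x" "\<forall>x \<in> carrier M. Y x = S b x" by blast
  then have "\<forall>x \<in> carrier M. X x \<oplus> Y x = S (a + b) x" by (simp add: S_plus)
  then show ?case by blast
next
  case (bideg_T s r X i)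
  then show ?case using inc_apply[of i s i] by simp
next
  case (bideg_D s r X i)
  then show ?case using inc_apply[of i r i] by simp
qed auto

text \<open>
  The Weyl algebra is simple in characteristic zero: an operator that vanishes on a nonzero
  subset stable under all \<open>T i\<close> and \<open>D i\<close> vanishes everywhere. If the degree of \<open>X\<close> in \<open>D j\<close> is positive,
  then the derivative of \<open>X\<close> and its Euler expression vanish on \<open>N\<close> as well and have smaller degree, so both are zero
  by induction; their combination is a nonzero multiple of \<open>X\<close>. The same argument
  lowers the degree in \<open>T j\<close>, and an operator of degree zero is a scalar, which \<open>n\<close> detects.
\<close>

theorem simplicity:
  assumes "bideg s r X" and N: "N \<subseteq> carrier M" and "\<And>i x. x \<in> N \<Longrightarrow> T i x \<in> N" "\<And>i x. x \<in> N \<Longrightarrow> D i x \<in> N"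
    and n: "n \<in> N" "n \<noteq> \<zero>"
    and "\<And>x. x \<in> N \<Longrightarrow> X x = \<zero>" and "x \<in> carrier M"
  shows "X x = \<zero>"
  using assms(1,7,8)
proof (induction "\<Sum>i\<in>UNIV. s i + r i" arbitrary: s r X x rule: less_induct)
  case less
  have N_zero: "\<zero> \<in> carrier M" by simp
  have dec_sum: "(\<Sum>i\<in>UNIV. dec j f i) < (\<Sum>i\<in>UNIV. f i)" if "0 < f j" for f :: "'n \<Rightarrow> nat" and j
    by (rule sum_strict_mono_ex1) (use that in \<open>auto simp: dec_def\<close>)
  show ?case
  proof (cases "\<exists>j. 0 < r j \<or> 0 < s j")
    case False
    then obtain c where c: "\<forall>x \<in> carrier M. X x = S c x"
      using bideg_00[OF less.prems(1)] by auto
    then have "S c n = \<zero>" using n N less.prems(2) by (metis subsetD)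
    then have "c = 0" using S_cancel n N by blast
    then show ?thesis using c less.prems(3) by (simp add: S_0)
  next
    case True
    then obtain j where "0 < r j \<or> 0 < s j" by blast
    then show ?thesis
    proof
      assume j: "0 < r j"
      let ?Y = "\<lambda>x. comT j X (D j x) \<ominus> S (of_nat (r j)) (X x)"
      have lt: "(\<Sum>i\<in>UNIV. s i + dec j r i) < (\<Sum>i\<in>UNIV. s i + r i)"
        using dec_sum[of r j] j by (simp add: sum.distrib)
      have c0: "comT j X y = \<zero>" if "y \<in> N" for y
        using that less.prems(2) assms(3) by (simp add: comT_def T_zero minus_self)
      have c: "comT j X y = \<zero>" if "y \<in> carrier M" for y
        by (rule less.hyps[OF lt]) (use comT_lower[OF less.prems(1)] that c0 in auto)
      have "?Y x = \<zero>"
        by (rule less.hyps[OF lt euler_D[OF less.prems(1) j]])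
          (use less.prems assms(4) N in \<open>auto simp: c closeds S_zero minus_self subset_iff\<close>)
      then have "S (of_nat (r j)) (X x) = \<zero>"
        using less.prems(3) bideg_closed[OF less.prems(1)] by (simp add: c closeds minus_eq)
      then show ?thesis
        using S_cancel[of "X x" "of_nat (r j)"] j less.prems(3) bideg_closed[OF less.prems(1)] by simp
    next
      assume j: "0 < s j"
      let ?Y = "\<lambda>x. T j (comD j X x) \<ominus> S (of_nat (s j)) (X x)"
      have lt: "(\<Sum>i\<in>UNIV. dec j s i + r i) < (\<Sum>i\<in>UNIV. s i + r i)"
        using dec_sum[of s j] j by (simp add: sum.distrib)
      have c0: "comD j X y = \<zero>" if "y \<in> N" for y
        using that less.prems(2) assms(4) by (simp add: comD_def D_zero minus_self)
      have c: "comD j X y = \<zero>" if "y \<in> carrier M" for y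
        by (rule less.hyps[OF lt]) (use comD_lower[OF less.prems(1)] that c0 in auto)
      have "?Y x = \<zero>"
        by (rule less.hyps[OF lt euler_T[OF less.prems(1) j]])
          (use less.prems N in \<open>auto simp: c closeds T_zero S_zero minus_self subset_iff\<close>)
      then have "S (of_nat (s j)) (X x) = \<zero>"
        using less.prems(3) bideg_closed[OF less.prems(1)] by (simp add: c closeds minus_eq T_zero)
      then show ?thesis
        using S_cancel[of "X x" "of_nat (s j)"] j less.prems(3) bideg_closed[OF less.prems(1)] by simp
    qed
  qed
qed

inductive gen :: "('c \<Rightarrow> 'c) \<Rightarrow> bool" where
  gen_S: "gen (S c)"
| gen_T: "gen (T i)"
| gen_D: "gen (D i)"
| gen_add: "gen X \<Longrightarrow> gen Y \<Longrightarrow> gen (\<lambda>x. X x \<oplus> Y x)"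
| gen_comp: "gen X \<Longrightarrow> gen Y \<Longrightarrow> gen (\<lambda>x. X (Y x))"

lemma bideg_D_left:
  assumes "bideg s r X" shows "bideg s (inc i r) (\<lambda>x. D i (X x))"
proof -
  have "bideg s (inc i r) (comD i X)"
    using comD_lower[OF assms, of i] dec_le(1)[of i s]
    by (auto intro: bideg_mono simp: inc_def le_fun_def)
  from bideg_add[OF bideg_D[OF assms] this] show ?thesis
    by (rule bideg_cong) (simp add: comD_def bideg_closed[OF assms] closeds minus_eq a_ac r_neg r_neg1 r_neg2)
qed

text \<open>
  Normal ordering: every operator in the generated algebra has a bidegree. It is proved for the
  product with an operator already in normal order, since then only generators have to be multiplied from the left.
\<close>

lemma gen_comp_bideg: "gen X \<Longrightarrow> bideg s r Y \<Longrightarrow> \<exists>s r. bideg s r (\<lambda>x. X (Y x))"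
proof (induction arbitrary: s r Y rule: gen.induct)
  case (gen_add X X')
  from gen_add.IH(1)[OF gen_add.prems] gen_add.IH(2)[OF gen_add.prems]
  obtain a b a' b' where "bideg a b (\<lambda>x. X (Y x))" "bideg a' b' (\<lambda>x. X' (Y x))"
    by blast
  then have "bideg (\<lambda>i. a i + a' i) (\<lambda>i. b i + b' i) (\<lambda>x. X (Y x) \<oplus> X' (Y x))"
    by (intro bideg_add; elim bideg_mono) (simp_all add: le_fun_def)
  then show ?case by blast
next
  case (gen_comp X X')
  from gen_comp.IH(2)[OF gen_comp.prems] gen_comp.IH(1) show ?case by blast
qed (blast intro: bideg_scale bideg_T bideg_D_left)+

corollary gen_eq_zero:
  assumes "gen X" and "N \<subseteq> carrier M" "\<And>i x. x \<in> N \<Longrightarrow> T i x \<in> N" "\<And>i x. x \<in> N \<Longrightarrow> D i x \<in> N"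
    and "n \<in> N" "n \<noteq> \<zero>"
    and "\<And>x. x \<in> N \<Longrightarrow> X x = \<zero>" and "x \<in> carrier M"
  shows "X x = \<zero>"
proof -
  \<comment> \<open>the identity in normal order is \<open>S 1\<close>\<close>
  obtain s r where "bideg s r (\<lambda>x. X (S 1 x))"
    using gen_comp_bideg[OF assms(1) bideg_S[of "\<lambda>_. 0" "\<lambda>_. 0" 1]] by blast
  from simplicity[OF this assms(2-6) _ assms(8)] show ?thesis
    using assms(2,7,8) by (auto simp: S_one subset_iff)
qed

end

section \<open>The defining relations of the Weyl algebra\<close>

text \<open>
  Additive operators on polynomials are compared on monomials; the relations that involve \<open>d_op\<close> are proved
  in this way.
\<close>

lemma poly_additive_eqI:
  fixes A B :: "('a \<Rightarrow>\<^sub>0 complex) \<Rightarrow> 'b :: cancel_semigroup_add"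
  assumes "\<And>p q. A (p + q) = A p + A q" "\<And>p q. B (p + q) = B p + B q"
    "\<And>m c. A (Poly_Mapping.single m c) = B (Poly_Mapping.single m c)"
  shows "A p = B p"
proof (induction p rule: update_induct)
  case const
  \<comment> \<open>the monomial with coefficient zero is the zero polynomial\<close>
  show ?case using assms(3)[of undefined 0] by simp
next
  case (update f a b)
  have "Poly_Mapping.update a b f = f + Poly_Mapping.single a b"
    using update(1) by (intro poly_mapping_eqI)
      (auto simp: lookup_update lookup_add lookup_single in_keys_iff when_def)
  then show ?case using update by (simp add: assms)
qed

lemma d_op_single: "d_op i (Poly_Mapping.single m c)
    = Poly_Mapping.single (m - Poly_Mapping.single i 1) (of_nat (Poly_Mapping.lookup m i) * c)"
  by (cases "c = 0") (simp_all add: d_op_def)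

lemma t_op_single: "t_op i (Poly_Mapping.single m c) = Poly_Mapping.single (m + Poly_Mapping.single i 1) c"
  by (simp add: t_op_def mult_single add.commute)

lemma scalar_op_single: "scalar_op b (Poly_Mapping.single m c) = Poly_Mapping.single m (b * c)"
  by (simp add: scalar_op_def mult_single)

lemmas op_single = d_op_single t_op_single scalar_op_single

lemma d_t_op_same: "d_op i (t_op i p) = t_op i (d_op i p) + (p :: 'n::finite cpoly)"
proof (rule poly_additive_eqI[of "\<lambda>p. d_op i (t_op i p)"])
  fix m :: "'n \<Rightarrow>\<^sub>0 nat" and c :: complex
  have "m - Poly_Mapping.single i 1 + Poly_Mapping.single i 1 = m" if "Poly_Mapping.lookup m i \<noteq> 0"
    using that by (intro poly_mapping_eqI) (auto simp: lookup_add lookup_minus lookup_single when_def)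
  then show "d_op i (t_op i (Poly_Mapping.single m c))
      = t_op i (d_op i (Poly_Mapping.single m c)) + Poly_Mapping.single m c"
    by (cases "Poly_Mapping.lookup m i = 0")
      (simp_all add: op_single lookup_add distrib_right single_add, simp add: t_op_def)
qed (simp_all add: weyl_ops_add[OF weyl_ops.t] weyl_ops_add[OF weyl_ops.d])

lemma d_t_op: "i \<noteq> j \<Longrightarrow> d_op i (t_op j p) = t_op j (d_op i (p :: 'n::finite cpoly))"
proof (rule poly_additive_eqI[of "\<lambda>p. d_op i (t_op j p)"])
  fix m :: "'n \<Rightarrow>\<^sub>0 nat" and c :: complex
  assume "i \<noteq> j"
  then have "m + Poly_Mapping.single j 1 - Poly_Mapping.single i 1
      = m - Poly_Mapping.single i 1 + Poly_Mapping.single j 1"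
    by (intro poly_mapping_eqI) (auto simp: lookup_add lookup_minus lookup_single when_def)
  with \<open>i \<noteq> j\<close> show "d_op i (t_op j (Poly_Mapping.single m c)) = t_op j (d_op i (Poly_Mapping.single m c))"
    by (simp add: op_single lookup_add lookup_single)
qed (simp_all add: weyl_ops_add[OF weyl_ops.t] weyl_ops_add[OF weyl_ops.d])

lemma d_d_op: "d_op i (d_op j p) = d_op j (d_op i (p :: 'n::finite cpoly))"
proof (rule poly_additive_eqI[of "\<lambda>p. d_op i (d_op j p)"])
  fix m :: "'n \<Rightarrow>\<^sub>0 nat" and c :: complex
  have "m - Poly_Mapping.single j 1 - Poly_Mapping.single i 1
      = m - Poly_Mapping.single i 1 - Poly_Mapping.single j 1"
    by (intro poly_mapping_eqI) (simp add: lookup_minus diff_right_commute)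
  then show "d_op i (d_op j (Poly_Mapping.single m c)) = d_op j (d_op i (Poly_Mapping.single m c))"
    by (cases "i = j") (simp_all add: op_single lookup_minus lookup_single mult.left_commute)
qed (simp_all add: weyl_ops_add[OF weyl_ops.d])

lemma t_t_op: "t_op i (t_op j p) = t_op j (t_op i (p :: 'n::finite cpoly))"
  by (simp add: t_op_def mult.left_commute)

lemma op_scalar: "A \<in> weyl_ops \<Longrightarrow> A (scalar_op c p) = scalar_op c (A (p :: 'n::finite cpoly))"
proof (induction arbitrary: p rule: weyl_ops.induct)
  case (d i)
  show ?case
    by (rule poly_additive_eqI[of "\<lambda>p. d_op i (scalar_op c p)"])
      (simp_all add: weyl_ops_add[OF weyl_ops.d] weyl_ops_add[OF weyl_ops.scalar] op_single mult.left_commute)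
qed (simp_all add: scalar_op_def t_op_def mult.left_commute distrib_left)

lemma scalar_op_plus: "scalar_op (a + b) p = scalar_op a p + scalar_op b p"
  and scalar_op_mult: "scalar_op a (scalar_op b p) = scalar_op (a * b) p"
  and scalar_op_1: "scalar_op 1 p = (p :: 'n::finite cpoly)"
  by (simp_all add: scalar_op_def single_add distrib_right mult_single flip: mult.assoc)

section \<open>The Weyl algebra acts on every representation of its relations\<close>

context weyl_action
begin

text \<open>
  The product of the polynomial representation with the given one. An operator of the generated algebra
  acts on both factors at once, and \<open>gen_eq_zero\<close> passes its vanishing from the first factor to the second.
\<close>

definition P :: "('n cpoly \<times> 'c) ring" where
  "P = \<lparr>carrier = UNIV \<times> carrier M, monoid.mult = undefined, one = undefined, zero = (0, \<zero>),
    add = (\<lambda>(p, x) (q, y). (p + q, x \<oplus> y))\<rparr>"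

lemma weyl_action_P:
  "weyl_action P (\<lambda>c. map_prod (scalar_op c) (S c)) (\<lambda>i. map_prod (t_op i) (T i)) (\<lambda>i. map_prod (d_op i) (D i))"
proof -
  have "abelian_group P"
  proof (rule abelian_groupI)
    fix u assume "u \<in> carrier P"
    then show "\<exists>v \<in> carrier P. v \<oplus>\<^bsub>P\<^esub> u = \<zero>\<^bsub>P\<^esub>"
      by (intro bexI[of _ "(- fst u, \<ominus> snd u)"]) (auto simp: P_def l_neg)
  qed (auto simp: P_def a_ac)
  then interpret P: abelian_group P .
  show ?thesis
    by unfold_locales
     (clarsimp simp: P_def closeds S_add T_add D_add S_plus S_S S_one T_S D_S T_T D_D D_T D_T_same
       weyl_ops_add[OF weyl_ops.t] weyl_ops_add[OF weyl_ops.d] weyl_ops_add[OF weyl_ops.scalar]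
       op_scalar weyl_ops.t weyl_ops.d scalar_op_plus scalar_op_mult scalar_op_1
       t_t_op d_d_op d_t_op d_t_op_same)+
qed

text \<open>
  \<open>rep A X\<close> says that some expression in the generators yields \<open>A\<close> on polynomials and \<open>X\<close> on the
  given representation.
\<close>

inductive rep :: "'n poly_op \<Rightarrow> ('c \<Rightarrow> 'c) \<Rightarrow> bool" where
  rep_scalar: "rep (scalar_op c) (S c)"
| rep_t: "rep (t_op i) (T i)"
| rep_d: "rep (d_op i) (D i)"
| rep_add: "rep A X \<Longrightarrow> rep B Y \<Longrightarrow> rep (\<lambda>p. A p + B p) (\<lambda>x. X x \<oplus> Y x)"
| rep_comp: "rep A X \<Longrightarrow> rep B Y \<Longrightarrow> rep (A \<circ> B) (X \<circ> Y)"

lemma rep_total: "A \<in> weyl_ops \<Longrightarrow> \<exists>X. rep A X"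
  by (induction rule: weyl_ops.induct) (blast intro: rep.intros)+

lemma rep_hom: assumes "rep A X"
  shows rep_closed: "x \<in> carrier M \<Longrightarrow> X x \<in> carrier M"
    and rep_additive: "x \<in> carrier M \<Longrightarrow> y \<in> carrier M \<Longrightarrow> X (x \<oplus> y) = X x \<oplus> X y"
  using assms by (induction arbitrary: x y) (simp_all add: closeds S_add T_add D_add a_ac)

lemma rep_zero: "rep A X \<Longrightarrow> X \<zero> = \<zero>"
  using additive_zero[of X] rep_hom[of A X] by simp

text \<open>
  The relation \<open>rep\<close> is a function on the carrier. The difference of \<open>(A, X)\<close> and \<open>(A, Y)\<close> is an operator on the product
  that is zero on the polynomials, so \<open>X\<close> and \<open>Y\<close> agree.
\<close>

lemma rep_unique:
  assumes "rep A X" "rep A Y" "x \<in> carrier M" shows "X x = Y x"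
proof -
  interpret P: weyl_action P "\<lambda>c. map_prod (scalar_op c) (S c)" "\<lambda>i. map_prod (t_op i) (T i)"
    "\<lambda>i. map_prod (d_op i) (D i)"
    by (rule weyl_action_P)
  have gen: "P.gen (map_prod A X)" if "rep A X" for A X
    using that
  proof induction
    case (rep_add A X B Y)
    from P.gen_add[OF rep_add.IH] show ?case
      by (rule back_subst[of P.gen]) (auto simp: P_def fun_eq_iff)
  next
    case (rep_comp A X B Y)
    from P.gen_comp[OF rep_comp.IH] show ?case
      by (rule back_subst[of P.gen]) (auto simp: fun_eq_iff)
  qed (rule P.gen_S P.gen_T P.gen_D)+
  \<comment> \<open>the first component of \<open>?Z\<close> is \<open>A - A\<close>, the second one \<open>X - Y\<close>\<close>
  let ?Z = "\<lambda>u. map_prod A X u \<oplus>\<^bsub>P\<^esub> map_prod (scalar_op (-1)) (S (-1)) (map_prod A Y u)"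
  have Z: "P.gen ?Z"
    by (rule P.gen_add[OF gen[OF assms(1)] P.gen_comp[OF P.gen_S gen[OF assms(2)]]])
  have "?Z (0, x) = \<zero>\<^bsub>P\<^esub>"
  proof (rule P.gen_eq_zero[OF Z, of "UNIV \<times> {\<zero>}" "(1, \<zero>)"])
    fix u :: "'n cpoly \<times> 'c" assume "u \<in> UNIV \<times> {\<zero>}"
    then show "?Z u = \<zero>\<^bsub>P\<^esub>"
      by (auto simp: P_def rep_zero[OF assms(1)] rep_zero[OF assms(2)] S_zero scalar_op_def single_uminus)
  qed (use assms(3) in \<open>auto simp: P_def T_zero D_zero\<close>)
  then have "X x \<oplus> \<ominus> Y x = \<zero>"
    using assms(3) by (simp add: P_def S_neg rep_closed[OF assms(2)])
  then have "(X x \<oplus> \<ominus> Y x) \<oplus> Y x = Y x"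
    using assms(3) rep_closed[OF assms(2)] by simp
  then show ?thesis
    using assms(3) rep_closed[OF assms(1)] rep_closed[OF assms(2)] by (simp add: a_assoc l_neg)
qed

definition act :: "'n poly_op \<Rightarrow> 'c \<Rightarrow> 'c" where
  "act A x = (SOME X. rep A X) x"

lemma act: "rep A X \<Longrightarrow> x \<in> carrier M \<Longrightarrow> act A x = X x"
  unfolding act_def using rep_unique[OF someI[of "rep A" X]] by blast

definition wmod :: "('n poly_op, 'c) module" where
  "wmod = \<lparr>carrier = carrier M, monoid.mult = monoid.mult M, one = one M, zero = zero M,
    add = add M, smult = act\<rparr>"

lemma left_module_wmod: "left_module weyl_algebra wmod"
proof -
  have "abelian_group wmod"
  proof (rule abelian_groupI)
    fix x assume "x \<in> carrier wmod"
    then show "\<exists>y \<in> carrier wmod. y \<oplus>\<^bsub>wmod\<^esub> x = \<zero>\<^bsub>wmod\<^esub>"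
      by (intro bexI[of _ "\<ominus> x"]) (simp_all add: wmod_def l_neg)
  qed (simp_all add: wmod_def a_ac)
  then interpret A: abelian_group wmod .
  interpret R: ring "weyl_algebra :: 'n poly_op ring" by (rule ring_weyl_algebra)
  have S1: "rep id (S 1)"
    using rep_scalar[of 1] by (simp add: scalar_op_1[abs_def] id_def)
  have *: "A \<odot>\<^bsub>wmod\<^esub> x \<in> carrier wmod"
      "(A \<oplus>\<^bsub>weyl_algebra\<^esub> B) \<odot>\<^bsub>wmod\<^esub> x = A \<odot>\<^bsub>wmod\<^esub> x \<oplus>\<^bsub>wmod\<^esub> B \<odot>\<^bsub>wmod\<^esub> x"
      "A \<odot>\<^bsub>wmod\<^esub> (x \<oplus>\<^bsub>wmod\<^esub> y) = A \<odot>\<^bsub>wmod\<^esub> x \<oplus>\<^bsub>wmod\<^esub> A \<odot>\<^bsub>wmod\<^esub> y"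
      "(A \<otimes>\<^bsub>weyl_algebra\<^esub> B) \<odot>\<^bsub>wmod\<^esub> x = A \<odot>\<^bsub>wmod\<^esub> (B \<odot>\<^bsub>wmod\<^esub> x)"
    if AB: "A \<in> carrier weyl_algebra" "B \<in> carrier weyl_algebra" "x \<in> carrier wmod" "y \<in> carrier wmod" for A B x y
  proof -
    obtain X Y where X: "rep A X" "rep B Y"
      using AB rep_total[of A] rep_total[of B] by (auto simp: weyl_algebra_def)
    note r = rep_hom[OF X(1)] rep_hom[OF X(2)]
    from AB show "A \<odot>\<^bsub>wmod\<^esub> x \<in> carrier wmod"
      "(A \<oplus>\<^bsub>weyl_algebra\<^esub> B) \<odot>\<^bsub>wmod\<^esub> x = A \<odot>\<^bsub>wmod\<^esub> x \<oplus>\<^bsub>wmod\<^esub> B \<odot>\<^bsub>wmod\<^esub> x"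
      "A \<odot>\<^bsub>wmod\<^esub> (x \<oplus>\<^bsub>wmod\<^esub> y) = A \<odot>\<^bsub>wmod\<^esub> x \<oplus>\<^bsub>wmod\<^esub> A \<odot>\<^bsub>wmod\<^esub> y"
      "(A \<otimes>\<^bsub>weyl_algebra\<^esub> B) \<odot>\<^bsub>wmod\<^esub> x = A \<odot>\<^bsub>wmod\<^esub> (B \<odot>\<^bsub>wmod\<^esub> x)"
      by (simp_all add: wmod_def weyl_algebra_def act[OF X(1)] act[OF X(2)] r
          act[OF rep_add[OF X]] act[OF rep_comp[OF X]])
  qed
  show ?thesis
  proof
    show "\<one>\<^bsub>weyl_algebra\<^esub> \<odot>\<^bsub>wmod\<^esub> x = x" if "x \<in> carrier wmod" for x
      using that by (simp add: wmod_def weyl_algebra_def act[OF S1] S_one)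
  qed (simp_all only: *(1) *(2) *(3) *(4))
qed

end

section \<open>Representations of the cube quiver\<close>

definition flip :: "(nat \<Rightarrow> int) \<Rightarrow> nat \<Rightarrow> nat \<Rightarrow> int" where
  "flip u i = u(i := - u i)"

text \<open>
  An edge of the cube is a vertex together with a direction, so a path is a starting point together with a list
  of directions.
\<close>

primrec walk :: "(nat \<Rightarrow> int) \<Rightarrow> nat list \<Rightarrow> ((nat \<Rightarrow> int) \<times> (nat \<Rightarrow> int)) list" where
  "walk u [] = []"
| "walk u (i # is) = (u, flip u i) # walk (flip u i) is"

abbreviation "cverts k \<equiv> {..<k} \<rightarrow>\<^sub>E {-1, 1 :: int}"

lemma cube_simps [simp]: "verts (cube_quiver k) = cverts k"
  "tail (cube_quiver k) = fst" "head (cube_quiver k) = snd"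
  by (simp_all add: cube_quiver_def)

lemma flip_cverts: "u \<in> cverts k \<Longrightarrow> i < k \<Longrightarrow> flip u i \<in> cverts k"
  by (auto simp: flip_def PiE_iff extensional_def)

lemma flip_simps [simp]: "flip u i i = - u i" "i \<noteq> j \<Longrightarrow> flip u i j = u j" "flip (flip u i) i = u"
  by (auto simp: flip_def)

lemma flip_commute: "flip (flip u i) j = flip (flip u j) i"
  by (auto simp: flip_def)

lemma cvert_nz: "u \<in> cverts k \<Longrightarrow> i < k \<Longrightarrow> u i = 1 \<or> u i = -1"
  by (auto simp: PiE_iff)

lemma cube_arc_iff: "e \<in> arcs (cube_quiver k) \<longleftrightarrow> (\<exists>u \<in> cverts k. \<exists>i < k. e = (u, flip u i))"
proof
  assume "e \<in> arcs (cube_quiver k)"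
  then obtain u v where uv: "e = (u, v)" "u \<in> cverts k" "v \<in> cverts k"
    and ex: "\<exists>!i. i < k \<and> u i \<noteq> v i"
    by (cases e) (simp add: cube_quiver_def)
  from ex obtain i where i: "i < k" "u i \<noteq> v i" and uniq: "\<And>j. j < k \<Longrightarrow> u j \<noteq> v j \<Longrightarrow> j = i"
    unfolding Ex1_def by blast
  note e = uv i
  have "v = flip u i"
  proof
    fix j
    show "v j = flip u i j"
    proof (cases "j = i")
      case True
      then show ?thesis using i cvert_nz[OF uv(2) i(1)] cvert_nz[OF uv(3) i(1)] by auto
    next
      case False
      moreover have "u j = v j" if "\<not> j < k"
        using that PiE_arb[OF uv(2), of j] PiE_arb[OF uv(3), of j] by simp
      ultimately show ?thesis using uniq[of j] by (metis flip_simps(2))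
    qed
  qed
  then show "\<exists>u \<in> cverts k. \<exists>i < k. e = (u, flip u i)" using e by blast
next
  assume "\<exists>u \<in> cverts k. \<exists>i < k. e = (u, flip u i)"
  then obtain u i where e: "u \<in> cverts k" "i < k" "e = (u, flip u i)" by blast
  then have "\<exists>!j. j < k \<and> u j \<noteq> flip u i j"
    using cvert_nz[of u k i] flip_simps(2)[of i _ u] by (intro ex1I[of _ i]) (simp, linarith, metis)
  then show "e \<in> arcs (cube_quiver k)"
    using e flip_cverts[of u k i] by (simp add: cube_quiver_def)
qed

primrec flips :: "(nat \<Rightarrow> int) \<Rightarrow> nat list \<Rightarrow> nat \<Rightarrow> int" where
  "flips u [] = u"
| "flips u (i # is) = flips (flip u i) is"

lemma cube_walk_iff: "quiver_path (cube_quiver k) u p v \<longleftrightarrow>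
  u \<in> cverts k \<and> (\<exists>is. set is \<subseteq> {..<k} \<and> p = walk u is \<and> v = flips u is)"
proof (induction p arbitrary: u)
  case Nil
  have "[] = walk u is \<longleftrightarrow> is = []" for "is" by (cases "is") auto
  then show ?case by (auto simp: pre_digraph.awalk_def pre_digraph.cas.simps)
next
  case (Cons e p)
  have step: "quiver_path (cube_quiver k) u (e # p) v \<longleftrightarrow>
    u \<in> cverts k \<and> (\<exists>i < k. e = (u, flip u i) \<and> quiver_path (cube_quiver k) (flip u i) p v)"
    using flip_cverts[of u k] unfolding pre_digraph.awalk_def pre_digraph.cas.simps
    by (cases e) (auto simp: cube_arc_iff)
  show ?case
    unfolding step
  proof (intro conj_cong refl iffI)
    assume "\<exists>i < k. e = (u, flip u i) \<and> quiver_path (cube_quiver k) (flip u i) p v"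
    then obtain i js where "i < k" "e = (u, flip u i)" "set js \<subseteq> {..<k}" "p = walk (flip u i) js"
      "v = flips (flip u i) js"
      using Cons.IH by blast
    then show "\<exists>is. set is \<subseteq> {..<k} \<and> e # p = walk u is \<and> v = flips u is"
      by (intro exI[of _ "i # js"]) simp
  next
    assume u: "u \<in> cverts k" and "\<exists>is. set is \<subseteq> {..<k} \<and> e # p = walk u is \<and> v = flips u is"
    then obtain "is" where i: "set is \<subseteq> {..<k}" "e # p = walk u is" "v = flips u is" by blast
    then obtain i js where "is = i # js" by (cases "is") auto
    with i u show "\<exists>i < k. e = (u, flip u i) \<and> quiver_path (cube_quiver k) (flip u i) p v"
      unfolding Cons.IH using flip_cverts[of u k] by (intro exI[of _ i]) auto
  qed
qed

lemma flips_apply: "flips u is i = (if even (count_list is i) then u i else - u i)"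
  by (induction "is" arbitrary: u) (auto simp: flip_def)

primrec visited :: "(nat \<Rightarrow> int) \<Rightarrow> nat list \<Rightarrow> (nat \<Rightarrow> int) list" where
  "visited u [] = [u]"
| "visited u (i # is) = u # visited (flip u i) is"

lemma awalk_verts_walk: "pre_digraph.awalk_verts (cube_quiver k) u (walk u is) = visited u is"
  by (induction "is" arbitrary: u) (simp_all add: pre_digraph.awalk_verts.simps)

lemma visited_hd: "u \<in> set (visited u is)" "\<exists>ws. visited u is = u # ws"
  by (cases "is"; simp)+

lemma visited_const: "i \<notin> set is \<Longrightarrow> w \<in> set (visited u is) \<Longrightarrow> w i = u i"
  by (induction "is" arbitrary: u) (auto simp: flip_def)

lemma visited_change: "i \<in> set is \<Longrightarrow> \<exists>w \<in> set (visited u is). w i = - u i"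
proof (induction "is" arbitrary: u)
  case (Cons j "is")
  show ?case
  proof (cases "j = i")
    case True then show ?thesis
      using visited_hd(1)[of "flip u i" "is"] by (auto intro!: bexI[of _ "flip u i"])
  next
    case False
    with Cons.IH[of "flip u j"] Cons.prems show ?thesis by auto
  qed
qed simp

lemma sorted_wrt_const: "(\<And>x. x \<in> set xs \<Longrightarrow> x = c) \<Longrightarrow> R c c \<Longrightarrow> sorted_wrt R xs"
  by (induction xs) auto

text \<open>
  If each direction is used at most once, then a coordinate changes at most once, from \<open>u i\<close> to
  \<open>- u i\<close>; the starting value tells in which order the two values come.
\<close>

lemma distinct_visited_sorted:
  assumes "distinct is" "u i = 1 \<or> u i = (-1 :: int)"
  shows "sorted_wrt (if u i = -1 then (\<le>) else (\<ge>)) (map (\<lambda>w. w i) (visited u is))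
    \<and> (\<forall>w \<in> set (visited u is). w i = u i \<or> w i = - u i)"
  using assms
proof (induction "is" arbitrary: u)
  case (Cons j "is")
  show ?case
  proof (cases "j = i")
    case False
    then have "flip u j i = u i" by simp
    with Cons.IH[of "flip u j"] Cons.prems show ?thesis by auto
  next
    case True
    then have c: "w i = - u i" if "w \<in> set (visited (flip u i) is)" for w
      using visited_const[of i "is" w "flip u i"] Cons.prems that by simp
    have "sorted_wrt (if u i = -1 then (\<le>) else (\<ge>)) (map (\<lambda>w. w i) (visited (flip u i) is))"
      by (rule sorted_wrt_const[of _ "- u i"]) (auto simp: c)
    then show ?thesis using True Cons.prems by (auto dest!: c)
  qed
qed simp

text \<open>
  A direction that is used twice makes its coordinate return to the starting value after having left it.
\<close>

lemma sorted_visited_distinct: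
  assumes "\<And>i. i \<in> set is \<Longrightarrow> u i \<noteq> (0 :: int)"
    and "\<And>i. i \<in> set is \<Longrightarrow> sorted_wrt (\<le>) (map (\<lambda>w. w i) (visited u is)) \<or> sorted_wrt (\<ge>) (map (\<lambda>w. w i) (visited u is))"
  shows "distinct is"
  using assms
proof (induction "is" arbitrary: u)
  case (Cons j "is")
  have "distinct is"
  proof (rule Cons.IH[of "flip u j"])
    fix i assume "i \<in> set is"
    then show "flip u j i \<noteq> 0" using Cons.prems(1)[of i] by (auto simp: flip_def)
    show "sorted_wrt (\<le>) (map (\<lambda>w. w i) (visited (flip u j) is)) \<or> sorted_wrt (\<ge>) (map (\<lambda>w. w i) (visited (flip u j) is))"
      using Cons.prems(2)[of i] \<open>i \<in> set is\<close> by auto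
  qed
  moreover have "j \<notin> set is"
  proof
    assume "j \<in> set is"
    then obtain w where w: "w \<in> set (visited (flip u j) is)" "w j = u j"
      using visited_change[of j "is" "flip u j"] by auto
    obtain ws where ws: "visited (flip u j) is = flip u j # ws" using visited_hd(2) by blast
    with w have "w = flip u j \<or> w \<in> set ws" by auto
    with w(2) ws Cons.prems(2)[of j] Cons.prems(1)[of j] show False by auto
  qed
  ultimately show ?case by simp
qed simp

lemma admissible_walk_iff:
  assumes "u \<in> cverts k" "set is \<subseteq> {..<k}"
  shows "admissible k u (walk u is) \<longleftrightarrow> distinct is"
proof
  assume "distinct is"
  then show "admissible k u (walk u is)"
    unfolding admissible_def awalk_verts_walk Let_def
  proof (intro allI impI)
    fix i assume "i < k"
    with distinct_visited_sorted[of "is" u i] \<open>distinct is\<close> cvert_nz[OF assms(1), of i]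
    show "sorted_wrt (\<le>) (map (\<lambda>w. w i) (visited u is)) \<or> sorted_wrt (\<ge>) (map (\<lambda>w. w i) (visited u is))"
      by (cases "u i = -1") simp_all
  qed
next
  assume "admissible k u (walk u is)"
  then show "distinct is"
    unfolding admissible_def awalk_verts_walk Let_def
    using assms(2) cvert_nz[OF assms(1)] by (intro sorted_visited_distinct[of "is" u]) fastforce+
qed

lemma cube_walk: "u \<in> cverts k \<Longrightarrow> set is \<subseteq> {..<k} \<Longrightarrow> quiver_path (cube_quiver k) u (walk u is) (flips u is)"
  unfolding cube_walk_iff by blast

lemma count_list_distinct: "distinct is \<Longrightarrow> count_list is i = of_bool (i \<in> set is)"
  by (induction "is") auto

locale cube_rep =
  fixes k :: nat and V :: "(nat \<Rightarrow> int, (nat \<Rightarrow> int) \<times> (nat \<Rightarrow> int), 'b) quiver_rep"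
  assumes fin_rep: "fin_quiver_rep (cube_quiver k) V"
begin

abbreviation sp :: "(nat \<Rightarrow> int) \<Rightarrow> (complex, 'b) module" where "sp u \<equiv> rspace V u"
abbreviation mp :: "(nat \<Rightarrow> int) \<Rightarrow> nat \<Rightarrow> 'b \<Rightarrow> 'b" where "mp u i \<equiv> rmap V (u, flip u i)"

lemma vs: "u \<in> cverts k \<Longrightarrow> vectorspace class_ring (sp u)"
  and fd: "u \<in> cverts k \<Longrightarrow> vectorspace.fin_dim class_ring (sp u)"
  using fin_rep by (auto simp: fin_quiver_rep_def)

lemma lin: "u \<in> cverts k \<Longrightarrow> i < k \<Longrightarrow> linear_map class_ring (sp u) (sp (flip u i)) (mp u i)"
proof -
  assume "u \<in> cverts k" "i < k"
  then have "(u, flip u i) \<in> arcs (cube_quiver k)" by (auto simp: cube_arc_iff)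
  then show ?thesis using fin_rep by (auto simp: fin_quiver_rep_def)
qed

lemma mp: assumes "u \<in> cverts k" "i < k"
  shows mp_closed: "x \<in> carrier (sp u) \<Longrightarrow> mp u i x \<in> carrier (sp (flip u i))"
    and mp_add: "\<lbrakk>x \<in> carrier (sp u); y \<in> carrier (sp u)\<rbrakk>
      \<Longrightarrow> mp u i (x \<oplus>\<^bsub>sp u\<^esub> y) = mp u i x \<oplus>\<^bsub>sp (flip u i)\<^esub> mp u i y"
    and mp_smult: "x \<in> carrier (sp u) \<Longrightarrow> mp u i (c \<odot>\<^bsub>sp u\<^esub> x) = c \<odot>\<^bsub>sp (flip u i)\<^esub> mp u i x"
    and mp_zero: "mp u i \<zero>\<^bsub>sp u\<^esub> = \<zero>\<^bsub>sp (flip u i)\<^esub>"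
proof -
  interpret linear_map "class_ring :: complex ring" "sp u" "sp (flip u i)" "mp u i"
    by (rule lin[OF assms])
  show "x \<in> carrier (sp u) \<Longrightarrow> mp u i x \<in> carrier (sp (flip u i))"
    "\<lbrakk>x \<in> carrier (sp u); y \<in> carrier (sp u)\<rbrakk>
      \<Longrightarrow> mp u i (x \<oplus>\<^bsub>sp u\<^esub> y) = mp u i x \<oplus>\<^bsub>sp (flip u i)\<^esub> mp u i y"
    "x \<in> carrier (sp u) \<Longrightarrow> mp u i (c \<odot>\<^bsub>sp u\<^esub> x) = c \<odot>\<^bsub>sp (flip u i)\<^esub> mp u i x"
    using f_hom by (auto simp: LinearCombinations.module_hom_def)
  show "mp u i \<zero>\<^bsub>sp u\<^esub> = \<zero>\<^bsub>sp (flip u i)\<^esub>" by (rule f0_is_0)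
qed

text \<open>
  The relations of the cube quiver on paths of length two.
\<close>

definition square_relations :: bool where
  "square_relations \<longleftrightarrow> (\<forall>u \<in> cverts k. \<forall>x \<in> carrier (sp u). \<forall>i < k.
     mp (flip u i) i (mp u i x) = \<zero>\<^bsub>sp u\<^esub> \<and>
     (\<forall>j < k. i \<noteq> j \<longrightarrow> mp (flip u i) j (mp u i x) = mp (flip u j) i (mp u j x)))"

lemma path_zero:
  "u \<in> cverts k \<Longrightarrow> set is \<subseteq> {..<k} \<Longrightarrow> path_map V (walk u is) \<zero>\<^bsub>sp u\<^esub> = \<zero>\<^bsub>sp (flips u is)\<^esub>"
  by (induction "is" arbitrary: u) (simp_all add: mp_zero flip_cverts)

text \<open>
  By the commuting squares, any step of a path can be moved to its beginning.
\<close>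

lemma path_to_front:
  assumes "square_relations" "u \<in> cverts k" "set is \<subseteq> {..<k}" "i \<in> set is" "x \<in> carrier (sp u)"
  shows "path_map V (walk u is) x = path_map V (walk u (i # remove1 i is)) x"
  using assms(2-)
proof (induction "is" arbitrary: u x)
  case (Cons j "is")
  show ?case
  proof (cases "j = i")
    case False
    then have "path_map V (walk u (j # is)) x = path_map V (walk (flip u j) (i # remove1 i is)) (mp u j x)"
      using Cons.IH[of "flip u j" "mp u j x"] Cons.prems by (simp add: flip_cverts mp_closed)
    also have "\<dots> = path_map V (walk (flip (flip u j) i) (remove1 i is)) (mp (flip u j) i (mp u j x))"
      by simp
    also have "mp (flip u j) i (mp u j x) = mp (flip u i) j (mp u i x)"
      using assms(1) Cons.prems False unfolding square_relations_def by auto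
    finally show ?thesis using False by (simp add: flip_commute)
  qed simp
qed simp

lemma path_perm:
  assumes "square_relations" "u \<in> cverts k" "set is \<subseteq> {..<k}" "distinct is" "distinct js" "set js = set is"
    "x \<in> carrier (sp u)"
  shows "path_map V (walk u is) x = path_map V (walk u js) x"
  using assms(2-)
proof (induction js arbitrary: u x "is")
  case (Cons j js)
  have j: "j < k" "j \<in> set is" "set (remove1 j is) = set js" using Cons.prems by auto
  have "path_map V (walk u is) x = path_map V (walk u (j # remove1 j is)) x"
    by (rule path_to_front[OF assms(1) Cons.prems(1,2) j(2) Cons.prems(6)])
  also have "\<dots> = path_map V (walk (flip u j) (remove1 j is)) (mp u j x)"
    by simp
  also have "\<dots> = path_map V (walk (flip u j) js) (mp u j x)"
    by (rule Cons.IH)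
      (use Cons.prems j set_remove1_subset[of j "is"] flip_cverts[OF Cons.prems(1) j(1)] mp_closed[OF Cons.prems(1) j(1)]
       in \<open>simp_all add: subset_iff\<close>)
  finally show ?case by simp
qed simp

lemma path_nondistinct:
  assumes "square_relations" "u \<in> cverts k" "set is \<subseteq> {..<k}" "\<not> distinct is" "x \<in> carrier (sp u)"
  shows "path_map V (walk u is) x = \<zero>\<^bsub>sp (flips u is)\<^esub>"
  using assms(2-)
proof (induction "is" arbitrary: u x)
  case (Cons j "is")
  show ?case
  proof (cases "distinct is")
    case False
    then show ?thesis
      using Cons.IH[of "flip u j" "mp u j x"] Cons.prems by (simp add: flip_cverts mp_closed)
  next
    case True
    with Cons.prems have j: "j \<in> set is" by simp
    have e: "flips (flip u j) is = flips (flip u j) (j # remove1 j is)"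
      using j by (simp add: fun_eq_iff flips_apply flip: count_mset del: flips.simps)
    have "path_map V (walk u (j # is)) x = path_map V (walk (flip u j) (j # remove1 j is)) (mp u j x)"
      using path_to_front[OF assms(1), of "flip u j" "is" j "mp u j x"] Cons.prems j
      by (simp add: flip_cverts mp_closed)
    also have "\<dots> = path_map V (walk u (remove1 j is)) \<zero>\<^bsub>sp u\<^esub>"
      using assms(1) Cons.prems unfolding square_relations_def by simp
    also have "\<dots> = \<zero>\<^bsub>sp (flips u (remove1 j is))\<^esub>"
      by (rule path_zero) (use Cons.prems set_remove1_subset[of j "is"] in auto)
    finally show ?thesis using e by simp
  qed
qed simp

text \<open>
  All relations follow from those of length two. Two admissible paths with the same ends use the same
  directions, each once, in some order (\<open>path_perm\<close>); in an inadmissible path a repeated direction can be moved so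
  that the step is directly followed by its reversal (\<open>path_nondistinct\<close>).
\<close>

theorem cube_relations_iff: "cube_relations k V \<longleftrightarrow> square_relations"
proof
  assume sq: square_relations
  show "cube_relations k V"
    unfolding cube_relations_def
  proof (intro conjI allI impI ballI)
    fix u p v x
    assume "quiver_path (cube_quiver k) u p v \<and> \<not> admissible k u p" "x \<in> carrier (sp u)"
    then show "path_map V p x = \<zero>\<^bsub>sp v\<^esub>"
      using path_nondistinct[OF sq] admissible_walk_iff[of u k] by (auto simp: cube_walk_iff)
  next
    fix u p q v x
    assume a: "quiver_path (cube_quiver k) u p v \<and> quiver_path (cube_quiver k) u q v \<and> admissible k u p \<and> admissible k u q"
      and x: "x \<in> carrier (sp u)"
    then obtain "is" js where s: "set is \<subseteq> {..<k}" "p = walk u is" "v = flips u is" "u \<in> cverts k"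
      "set js \<subseteq> {..<k}" "q = walk u js" "v = flips u js"
      by (auto simp: cube_walk_iff)
    then have d: "distinct is" "distinct js" using a admissible_walk_iff[of u k] by auto
    have m: "i \<in> set is \<longleftrightarrow> v i \<noteq> u i" if "distinct is" "v = flips u is" "i < k" for "is" i
      using that(1,2) cvert_nz[OF s(4) that(3)] by (auto simp: flips_apply count_list_distinct)
    have "set js = set is" using m[OF d(1) s(3)] m[OF d(2) s(7)] s(1,5) by blast
    then show "path_map V p x = path_map V q x" using path_perm[OF sq s(4,1) d _ x] s by simp
  qed
next
  assume rel: "cube_relations k V"
  show square_relations
    unfolding square_relations_def
  proof (intro ballI allI impI conjI)
    fix u x i assume u: "u \<in> cverts k" and x: "x \<in> carrier (sp u)" and i: "i < k"
    have "quiver_path (cube_quiver k) u (walk u [i, i]) u \<and> \<not> admissible k u (walk u [i, i])"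
      using cube_walk[of u k "[i, i]"] admissible_walk_iff[of u k "[i, i]"] u i by simp
    then have "path_map V (walk u [i, i]) x = \<zero>\<^bsub>sp u\<^esub>"
      using rel x unfolding cube_relations_def by blast
    then show "mp (flip u i) i (mp u i x) = \<zero>\<^bsub>sp u\<^esub>" by simp
    fix j assume j: "j < k" "i \<noteq> j"
    have "quiver_path (cube_quiver k) u (walk u [i, j]) (flips u [i, j]) \<and> admissible k u (walk u [i, j])"
      "quiver_path (cube_quiver k) u (walk u [j, i]) (flips u [j, i]) \<and> admissible k u (walk u [j, i])"
      using cube_walk[of u k "[i, j]"] cube_walk[of u k "[j, i]"] u i j
        admissible_walk_iff[of u k "[i, j]"] admissible_walk_iff[of u k "[j, i]"]
      by (simp_all del: walk.simps flips.simps)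
    moreover have "flips u [j, i] = flips u [i, j]" by (simp add: flip_commute)
    ultimately have "path_map V (walk u [i, j]) x = path_map V (walk u [j, i]) x"
      using rel x unfolding cube_relations_def by metis
    then show "mp (flip u i) j (mp u i x) = mp (flip u j) i (mp u j x)" by simp
  qed
qed

end

section \<open>Weight spaces\<close>

lemma exponent_induct [case_names zero inc]:
  fixes a :: "'n::finite \<Rightarrow> nat"
  assumes "P (\<lambda>_. 0)" and inc: "\<And>a i. P a \<Longrightarrow> P (inc i a)"
  shows "P a"
proof (induction "\<Sum>i\<in>UNIV. a i" arbitrary: a)
  case 0
  then have "a = (\<lambda>_. 0)" by auto
  then show ?case using assms(1) by simp
next
  case (Suc m)
  then obtain i where i: "0 < a i" by (metis gr0I nat.distinct(1) sum.neutral)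
  have "(\<Sum>j\<in>UNIV. a j) = (\<Sum>j\<in>UNIV. inc i (dec i a) j)" using i by (simp add: inc_dec)
  also have "\<dots> = (\<Sum>j\<in>UNIV. dec i a j + of_bool (j = i))"
    by (intro sum.cong) (auto simp: inc_def)
  also have "\<dots> = Suc (\<Sum>j\<in>UNIV. dec i a j)"
    by (simp add: sum.distrib)
  finally have "P (dec i a)" using Suc by simp
  then show ?case using inc[of "dec i a" i] i by (simp add: inc_dec)
qed

text \<open>
  A monomial in the \<open>t_op i\<close> is multiplication by one monomial, which needs no order of the
  variables. Exponents are plain functions because the index type is finite.
\<close>

definition mono_op :: "('n \<Rightarrow> nat) \<Rightarrow> 'n::finite poly_op" where
  "mono_op a p = Poly_Mapping.single (Abs_poly_mapping a) 1 * p"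

lemma lookup_Abs: "Poly_Mapping.lookup (Abs_poly_mapping a) = (a :: 'n::finite \<Rightarrow> nat)"
  by (rule Abs_poly_mapping_inverse) simp

lemma mono_op_zero: "mono_op (\<lambda>_. 0) = (id :: 'n::finite poly_op)"
proof
  fix p :: "'n cpoly"
  have "Abs_poly_mapping (\<lambda>_ :: 'n. 0 :: nat) = 0"
    by (intro poly_mapping_eqI) (simp add: lookup_Abs)
  then show "mono_op (\<lambda>_. 0) p = id p" by (simp add: mono_op_def)
qed

lemma mono_op_inc: "mono_op (inc i a) = t_op i \<circ> mono_op (a :: 'n::finite \<Rightarrow> nat)"
proof
  fix p :: "'n cpoly"
  have "Abs_poly_mapping (inc i a) = Poly_Mapping.single i 1 + Abs_poly_mapping a"
    by (intro poly_mapping_eqI) (simp add: lookup_Abs lookup_add lookup_single inc_def when_def)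
  then show "mono_op (inc i a) p = (t_op i \<circ> mono_op a) p"
    by (simp add: mono_op_def t_op_def mult_single flip: mult.assoc)
qed

lemma mono_op_t_op: "mono_op a (t_op i p) = t_op i (mono_op a p)"
  by (simp add: mono_op_def t_op_def mult.left_commute)

lemma id_weyl: "id \<in> (weyl_ops :: 'n::finite poly_op set)"
proof -
  have "scalar_op 1 = (id :: 'n poly_op)" by (simp add: fun_eq_iff scalar_op_1)
  moreover have "scalar_op 1 \<in> (weyl_ops :: 'n poly_op set)" by (rule weyl_ops.scalar)
  ultimately show ?thesis by simp
qed

lemma mono_op_weyl: "mono_op a \<in> (weyl_ops :: 'n::finite poly_op set)"
proof (induction a rule: exponent_induct)
  case zero
  show ?case unfolding mono_op_zero by (rule id_weyl)
next
  case (inc a i)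
  then show ?case unfolding mono_op_inc by (intro weyl_ops.comp weyl_ops.t)
qed

lemma mono_op_d_op: "a i = 0 \<Longrightarrow> mono_op a (d_op i p) = d_op i (mono_op a (p :: 'n::finite cpoly))"
proof (induction a arbitrary: p rule: exponent_induct)
  case (inc a j)
  then have "i \<noteq> j" "a i = 0" by (auto simp: inc_def split: if_splits)
  then show ?case using inc.IH by (simp add: mono_op_inc d_t_op)
qed (simp add: mono_op_zero)

definition shift :: "'n \<Rightarrow> complex \<Rightarrow> ('n \<Rightarrow> complex) \<Rightarrow> 'n \<Rightarrow> complex" where
  "shift i c \<mu> = \<mu>(i := \<mu> i + c)"

lemma shift_simps [simp]: "shift i c (shift i d \<mu>) = shift i (c + d) \<mu>" "shift i 0 \<mu> = \<mu>"
    "shift i c \<mu> i = \<mu> i + c" "i \<noteq> j \<Longrightarrow> shift i c \<mu> j = \<mu> j"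
  by (auto simp: shift_def fun_eq_iff)

locale weyl_module = left_module weyl_algebra M
  for M :: "('n::finite poly_op, 'a) module" (structure)
begin

abbreviation S where "S c x \<equiv> scalar_op c \<odot> x"
abbreviation T where "T i x \<equiv> t_op i \<odot> x"
abbreviation D where "D i x \<equiv> d_op i \<odot> x"
abbreviation K where "K a x \<equiv> mono_op a \<odot> x"
abbreviation W where "W \<mu> \<equiv> weight_space M \<mu>"

lemma op_closed: "A \<in> weyl_ops \<Longrightarrow> x \<in> carrier M \<Longrightarrow> A \<odot> x \<in> carrier M"
  and op_add: "A \<in> weyl_ops \<Longrightarrow> x \<in> carrier M \<Longrightarrow> y \<in> carrier M \<Longrightarrow> A \<odot> (x \<oplus> y) = A \<odot> x \<oplus> A \<odot> y"
  and op_plus: "A \<in> weyl_ops \<Longrightarrow> B \<in> weyl_ops \<Longrightarrow> x \<in> carrier M \<Longrightarrow> (\<lambda>p. A p + B p) \<odot> x = A \<odot> x \<oplus> B \<odot> x"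
  and op_comp: "A \<in> weyl_ops \<Longrightarrow> B \<in> weyl_ops \<Longrightarrow> x \<in> carrier M \<Longrightarrow> (A \<circ> B) \<odot> x = A \<odot> (B \<odot> x)"
  and op_id: "x \<in> carrier M \<Longrightarrow> id \<odot> x = x"
  using smult_closed[of A x] smult_r_distr[of A x y] smult_l_distr[of A B x] smult_assoc[of A B x] smult_one[of x]
  by (simp_all add: weyl_algebra_def)

lemma op_eq:
  assumes "A \<in> weyl_ops" "B \<in> weyl_ops" "A' \<in> weyl_ops" "B' \<in> weyl_ops" "x \<in> carrier M"
    "\<And>p. A (B p) = A' (B' p)"
  shows "A \<odot> (B \<odot> x) = A' \<odot> (B' \<odot> x)"
proof -
  have "A \<circ> B = A' \<circ> B'" using assms(6) by (simp add: fun_eq_iff)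
  then show ?thesis using op_comp[OF assms(1,2,5)] op_comp[OF assms(3,4,5)] by simp
qed

lemmas ops = weyl_ops.scalar weyl_ops.t weyl_ops.d mono_op_weyl

sublocale weyl_action M "\<lambda>c x. S c x" "\<lambda>i x. T i x" "\<lambda>i x. D i x"
proof
  fix x y and a b c :: complex and i j :: 'n assume x: "x \<in> carrier M"
  show "S c x \<in> carrier M" "T i x \<in> carrier M" "D i x \<in> carrier M"
    using x by (simp_all add: op_closed ops)
  show "S c (x \<oplus> y) = S c x \<oplus> S c y" "T i (x \<oplus> y) = T i x \<oplus> T i y" "D i (x \<oplus> y) = D i x \<oplus> D i y"
    if "y \<in> carrier M"
    using x that by (simp_all add: op_add ops)
  show "S (a + b) x = S a x \<oplus> S b x"
    using op_plus[OF weyl_ops.scalar weyl_ops.scalar x, of a b] by (simp flip: scalar_op_plus)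
  have "scalar_op a \<circ> scalar_op b = (scalar_op (a * b) :: 'n poly_op)"
    by (simp add: fun_eq_iff scalar_op_mult)
  from this[symmetric] show "S a (S b x) = S (a * b) x"
    by (simp only: op_comp[OF weyl_ops.scalar weyl_ops.scalar x])
  have "scalar_op 1 = (id :: 'n poly_op)" by (simp add: fun_eq_iff scalar_op_1)
  then show "S 1 x = x" using op_id[OF x] by simp
  show "T i (S c x) = S c (T i x)" "D i (S c x) = S c (D i x)" "T i (T j x) = T j (T i x)"
    "D i (D j x) = D j (D i x)"
    by (rule op_eq; simp add: ops x op_scalar t_t_op d_d_op)+
  show "D i (T j x) = T j (D i x)" if "i \<noteq> j"
    by (rule op_eq; simp add: ops x d_t_op that)
  have "d_op i \<circ> t_op i = (\<lambda>p. (t_op i \<circ> d_op i) p + (id p :: 'n cpoly))"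
    by (simp add: fun_eq_iff d_t_op_same)
  then have "(d_op i \<circ> t_op i) \<odot> x = (t_op i \<circ> d_op i) \<odot> x \<oplus> id \<odot> x"
    using op_plus[OF weyl_ops.comp[OF weyl_ops.t weyl_ops.d] id_weyl x] by (simp only:)
  then show "D i (T i x) = T i (D i x) \<oplus> x"
    by (simp only: op_comp[OF weyl_ops.t weyl_ops.d x] op_comp[OF weyl_ops.d weyl_ops.t x] op_id[OF x])
qed

lemma K_comm: assumes "x \<in> carrier M"
  shows K_S: "K a (S c x) = S c (K a x)" and K_T: "K a (T i x) = T i (K a x)"
    and K_D: "a i = 0 \<Longrightarrow> K a (D i x) = D i (K a x)"
  by (rule op_eq; simp add: ops assms op_scalar mono_op_t_op mono_op_d_op)+

lemma K_closed: "x \<in> carrier M \<Longrightarrow> K a x \<in> carrier M"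
  and K_add: "x \<in> carrier M \<Longrightarrow> y \<in> carrier M \<Longrightarrow> K a (x \<oplus> y) = K a x \<oplus> K a y"
  and K_zero: "x \<in> carrier M \<Longrightarrow> K (\<lambda>_. 0) x = x"
  and K_inc: "x \<in> carrier M \<Longrightarrow> K (inc i a) x = T i (K a x)"
  by (simp_all add: op_closed op_add ops mono_op_zero op_id mono_op_inc op_comp)

lemma W_iff: "x \<in> W \<mu> \<longleftrightarrow> x \<in> carrier M \<and> (\<forall>i. T i (D i x) = S (\<mu> i) x)"
proof -
  have "t_op i \<otimes>\<^bsub>weyl_algebra\<^esub> d_op i \<odot> x = T i (D i x)" if "x \<in> carrier M" for i
    using op_comp[OF weyl_ops.t weyl_ops.d that] by (simp add: weyl_algebra_def)
  then show ?thesis by (auto simp: weight_space_def)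
qed

lemma W_carrier: "x \<in> W \<mu> \<Longrightarrow> x \<in> carrier M"
  by (simp add: W_iff)

lemma TD: "x \<in> W \<mu> \<Longrightarrow> T i (D i x) = S (\<mu> i) x"
  by (simp add: W_iff)

lemma DT: "x \<in> W \<mu> \<Longrightarrow> D i (T i x) = S (\<mu> i + 1) x"
  by (simp add: D_T_same TD W_carrier S_plus S_one)

lemma W_zero: "\<zero> \<in> W \<mu>"
  by (simp add: W_iff S_zero T_zero D_zero)

lemma W_add: "x \<in> W \<mu> \<Longrightarrow> y \<in> W \<mu> \<Longrightarrow> x \<oplus> y \<in> W \<mu>"
  by (simp add: W_iff D_add T_add S_add closeds)

lemma W_S: "x \<in> W \<mu> \<Longrightarrow> S c x \<in> W \<mu>"
  by (simp add: W_iff D_S T_S S_S closeds mult.commute)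

lemma W_T: assumes "x \<in> W \<mu>" shows "T i x \<in> W (shift i 1 \<mu>)"
proof -
  have x: "x \<in> carrier M" using assms by (rule W_carrier)
  have "T j (D j (T i x)) = S (shift i 1 \<mu> j) (T i x)" for j
    using x assms by (cases "i = j") (simp_all add: DT T_S D_T T_T[of _ j i] TD closeds)
  then show ?thesis using x by (simp add: W_iff closeds)
qed

lemma W_D: assumes "x \<in> W \<mu>" shows "D i x \<in> W (shift i (-1) \<mu>)"
proof -
  have x: "x \<in> carrier M" using assms by (rule W_carrier)
  have "T j (D j (D i x)) = S (shift i (-1) \<mu> j) (D i x)" for j
  proof (cases "i = j")
    case True
    have "T i (D i (D i x)) \<oplus> D i x = S (\<mu> i - 1) (D i x) \<oplus> D i x"
      using D_T_same[of "D i x" i] S_plus[of "D i x" "\<mu> i - 1" 1] TD[OF assms, of i] x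
      by (simp add: closeds D_S S_one)
    then show ?thesis using True x by (simp add: closeds)
  next
    case False
    then show ?thesis
      using D_T[of "D j x" i j] TD[OF assms, of j] D_D[of x j i] x by (simp add: closeds D_S)
  qed
  then show ?thesis using x by (simp add: W_iff closeds)
qed

text \<open>
  On the two weight spaces the composites of \<open>T i\<close> and \<open>D i\<close> are the same nonzero scalar \<open>\<mu> i + 1\<close>.
\<close>

lemma T_bij: assumes "\<mu> i \<noteq> -1" shows "bij_betw (\<lambda>x. T i x) (W \<mu>) (W (shift i 1 \<mu>))"
proof (rule bij_betw_byWitness[where f' = "\<lambda>y. S (1 / (\<mu> i + 1)) (D i y)"])
  have nz: "\<mu> i + 1 \<noteq> 0" using assms by (simp add: eq_neg_iff_add_eq_0)
  show "\<forall>x \<in> W \<mu>. S (1 / (\<mu> i + 1)) (D i (T i x)) = x"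
    using nz by (simp add: DT S_S W_carrier S_one)
  show "\<forall>y \<in> W (shift i 1 \<mu>). T i (S (1 / (\<mu> i + 1)) (D i y)) = y"
    using nz by (simp add: T_S TD S_S W_carrier S_one closeds)
  show "(\<lambda>x. T i x) ` W \<mu> \<subseteq> W (shift i 1 \<mu>)"
    using W_T by blast
  show "(\<lambda>y. S (1 / (\<mu> i + 1)) (D i y)) ` W (shift i 1 \<mu>) \<subseteq> W \<mu>"
    using W_S W_D[of _ "shift i 1 \<mu>" i] by auto
qed

definition plus_exp :: "('n \<Rightarrow> complex) \<Rightarrow> ('n \<Rightarrow> nat) \<Rightarrow> 'n \<Rightarrow> complex" where
  "plus_exp \<mu> a i = \<mu> i + of_nat (a i)"

text \<open>
  The condition says that no step from \<open>-1\<close> to \<open>0\<close> occurs in any coordinate on the way.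
\<close>

lemma K_bij:
  assumes "\<And>i l. l < a i \<Longrightarrow> \<mu> i + of_nat l \<noteq> -1"
  shows "bij_betw (\<lambda>x. K a x) (W \<mu>) (W (plus_exp \<mu> a))"
  using assms
proof (induction a rule: exponent_induct)
  case zero
  have "plus_exp \<mu> (\<lambda>_. 0) = \<mu>" by (simp add: plus_exp_def fun_eq_iff)
  moreover have "bij_betw (\<lambda>x. K (\<lambda>_. 0) x) (W \<mu>) (W \<mu>) = bij_betw (\<lambda>x. x) (W \<mu>) (W \<mu>)"
    by (rule bij_betw_cong) (simp add: K_zero W_carrier)
  ultimately show ?case by (simp add: bij_betw_def)
next
  case (inc a i)
  have "plus_exp \<mu> a i \<noteq> -1"
    using inc.prems[of "a i" i] by (simp add: plus_exp_def inc_def)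
  from T_bij[of "plus_exp \<mu> a" i, OF this]
  have "bij_betw (\<lambda>x. T i x) (W (plus_exp \<mu> a)) (W (shift i 1 (plus_exp \<mu> a)))" .
  moreover have "bij_betw (\<lambda>x. K a x) (W \<mu>) (W (plus_exp \<mu> a))"
  proof (rule inc.IH)
    fix j l assume "l < a j" then show "\<mu> j + of_nat l \<noteq> -1"
      using inc.prems[of l j] by (cases "j = i") (simp_all add: inc_def)
  qed
  moreover have "shift i 1 (plus_exp \<mu> a) = plus_exp \<mu> (inc i a)"
    by (auto simp: shift_def plus_exp_def inc_def fun_eq_iff)
  ultimately have "bij_betw ((\<lambda>x. T i x) \<circ> (\<lambda>x. K a x)) (W \<mu>) (W (plus_exp \<mu> (inc i a)))"
    by (metis bij_betw_trans)
  moreover have "bij_betw (\<lambda>x. K (inc i a) x) (W \<mu>) (W (plus_exp \<mu> (inc i a))) =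
      bij_betw ((\<lambda>x. T i x) \<circ> (\<lambda>x. K a x)) (W \<mu>) (W (plus_exp \<mu> (inc i a)))"
    by (rule bij_betw_cong) (simp add: K_inc W_carrier)
  ultimately show ?case by simp
qed

lemma weight_vs_vectorspace: "vectorspace class_ring (weight_vs M \<mu>)"
proof -
  have "abelian_group (weight_vs M \<mu>)"
  proof (rule abelian_groupI)
    fix x assume "x \<in> carrier (weight_vs M \<mu>)"
    then show "\<exists>y \<in> carrier (weight_vs M \<mu>). y \<oplus>\<^bsub>weight_vs M \<mu>\<^esub> x = \<zero>\<^bsub>weight_vs M \<mu>\<^esub>"
      using W_carrier[of x \<mu>] W_S[of x \<mu> "-1"]
      by (intro bexI[of _ "S (-1) x"]) (simp_all add: weight_vs_def S_neg M.l_neg)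
  qed (simp_all add: weight_vs_def W_zero W_add W_carrier M.a_ac)
  then interpret A: abelian_group "weight_vs M \<mu>" .
  interpret K: field "class_ring :: complex ring" by (rule class_field)
  show ?thesis
    by unfold_locales
      (simp_all add: weight_vs_def W_S W_carrier S_add S_plus S_S S_one)
qed

end

section \<open>The weight decomposition\<close>

locale wt_module = weyl_module M for M :: "('n::finite poly_op, 'a) module" (structure) +
  assumes wm: "weight_module M"
begin

definition decomposes :: "'a \<Rightarrow> (('n \<Rightarrow> complex) \<Rightarrow> 'a) \<Rightarrow> bool" where
  "decomposes x f \<longleftrightarrow> (\<forall>\<mu>. f \<mu> \<in> W \<mu>) \<and> finite {\<mu>. f \<mu> \<noteq> \<zero>} \<and> x = (\<Oplus>\<mu> \<in> {\<mu>. f \<mu> \<noteq> \<zero>}. f \<mu>)"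

definition component :: "'a \<Rightarrow> ('n \<Rightarrow> complex) \<Rightarrow> 'a" where
  "component x = (THE f. decomposes x f)"

lemma decomposes_unique: "x \<in> carrier M \<Longrightarrow> \<exists>!f. decomposes x f"
  using wm unfolding weight_module_def decomposes_def by blast

lemma component: "x \<in> carrier M \<Longrightarrow> decomposes x (component x)"
  unfolding component_def by (rule theI'[OF decomposes_unique])

lemma component_eq: assumes "decomposes x f" "x \<in> carrier M" shows "component x = f"
  using decomposes_unique[OF assms(2)] component[OF assms(2)] assms(1) by blast

lemma component_W: "x \<in> carrier M \<Longrightarrow> component x \<mu> \<in> W \<mu>"
  and component_finite: "x \<in> carrier M \<Longrightarrow> finite {\<mu>. component x \<mu> \<noteq> \<zero>}"
  and component_sum: "x \<in> carrier M \<Longrightarrow> x = (\<Oplus>\<mu> \<in> {\<mu>. component x \<mu> \<noteq> \<zero>}. component x \<mu>)"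
  using component[of x] unfolding decomposes_def by blast+

lemma component_carrier: "x \<in> carrier M \<Longrightarrow> component x \<mu> \<in> carrier M"
  using component_W W_carrier by blast

lemma sum_support:
  assumes "\<And>\<mu>. f \<mu> \<in> carrier M" "finite B" "{\<mu>. f \<mu> \<noteq> \<zero>} \<subseteq> B"
  shows "(\<Oplus>\<mu> \<in> {\<mu>. f \<mu> \<noteq> \<zero>}. f \<mu>) = (\<Oplus>\<mu> \<in> B. f \<mu>)"
  by (rule M.add.finprod_mono_neutral_cong_left) (use assms in auto)

lemma sum_W_closed: "(\<And>\<mu>. f \<mu> \<in> W \<mu>) \<Longrightarrow> (\<Oplus>\<mu> \<in> B. f \<mu>) \<in> carrier M"
  using W_carrier by (intro M.finsum_closed) blast

lemma component_finsum:
  assumes f: "\<And>\<mu>. f \<mu> \<in> W \<mu>" and B: "finite B" "{\<mu>. f \<mu> \<noteq> \<zero>} \<subseteq> B"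
  shows "component (\<Oplus>\<mu> \<in> B. f \<mu>) = f"
proof (rule component_eq)
  show "decomposes (\<Oplus>\<mu> \<in> B. f \<mu>) f"
    unfolding decomposes_def
    using f finite_subset[OF B(2,1)] sum_support[OF W_carrier[OF f] B] by simp
qed (rule sum_W_closed[OF f])

lemma component_single: assumes "x \<in> W \<mu>" shows "component x = (\<lambda>\<kappa>. if \<kappa> = \<mu> then x else \<zero>)"
proof -
  let ?f = "\<lambda>\<kappa>. if \<kappa> = \<mu> then x else \<zero>"
  have "component (\<Oplus>\<kappa> \<in> {\<mu>}. ?f \<kappa>) = ?f"
    by (rule component_finsum) (simp_all add: assms W_zero subset_iff)
  moreover have "(\<Oplus>\<kappa> \<in> {\<mu>}. ?f \<kappa>) = x"
    using W_carrier[OF assms] by (subst M.finsum_insert) simp_all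
  ultimately show ?thesis by simp
qed

lemma component_inject:
  assumes "x \<in> carrier M" "y \<in> carrier M" "component x = component y" shows "x = y"
  using component_sum[OF assms(1)] component_sum[OF assms(2)] assms(3) by simp

lemma W_zero_outside: "\<mu> \<notin> weight_supp M \<Longrightarrow> x \<in> W \<mu> \<Longrightarrow> x = \<zero>"
  by (simp add: weight_supp_def)

end

lemma finsum_additive:
  assumes "abelian_group M" "abelian_group N" "finite B" "f \<in> B \<rightarrow> carrier M"
    "\<And>x. x \<in> carrier M \<Longrightarrow> h x \<in> carrier N"
    "\<And>x y. x \<in> carrier M \<Longrightarrow> y \<in> carrier M \<Longrightarrow> h (x \<oplus>\<^bsub>M\<^esub> y) = h x \<oplus>\<^bsub>N\<^esub> h y"
  shows "h (finsum M f B) = finsum N (\<lambda>b. h (f b)) B"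
proof -
  interpret M: abelian_group M by fact
  interpret N: abelian_group N by fact
  have h0: "h \<zero>\<^bsub>M\<^esub> = \<zero>\<^bsub>N\<^esub>"
  proof -
    have "h \<zero>\<^bsub>M\<^esub> \<oplus>\<^bsub>N\<^esub> h \<zero>\<^bsub>M\<^esub> = h \<zero>\<^bsub>M\<^esub> \<oplus>\<^bsub>N\<^esub> \<zero>\<^bsub>N\<^esub>"
      using assms(6)[of "\<zero>\<^bsub>M\<^esub>" "\<zero>\<^bsub>M\<^esub>"] assms(5)[of "\<zero>\<^bsub>M\<^esub>"] by simp
    then show ?thesis using assms(5)[of "\<zero>\<^bsub>M\<^esub>"] by (simp del: N.r_zero)
  qed
  show ?thesis
    using assms(3,4)
  proof (induction B)
    case (insert b B)
    then have "f \<in> B \<rightarrow> carrier M" "f b \<in> carrier M" by auto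
    moreover from this have "(\<lambda>b. h (f b)) \<in> B \<rightarrow> carrier N" using assms(5) by auto
    ultimately show ?case
      using insert assms(5,6) by (simp add: M.finsum_insert N.finsum_insert)
  qed (simp add: h0)
qed

text \<open>
  Taking components commutes with additive maps that permute the weights by \<open>\<phi>\<close>. It is applied to
  module homomorphisms, where \<open>\<phi>\<close> is the identity, and to the action of \<open>t_op i\<close> and \<open>d_op i\<close>, where \<open>\<phi>\<close> is a shift.
\<close>

lemma component_map:
  assumes "wt_module M" "wt_module N"
    and h: "\<And>x. x \<in> carrier M \<Longrightarrow> h x \<in> carrier N"
      "\<And>x y. x \<in> carrier M \<Longrightarrow> y \<in> carrier M \<Longrightarrow> h (x \<oplus>\<^bsub>M\<^esub> y) = h x \<oplus>\<^bsub>N\<^esub> h y"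
      "\<And>x \<mu>. x \<in> weight_space M \<mu> \<Longrightarrow> h x \<in> weight_space N (\<phi> \<mu>)"
    and \<phi>: "bij \<phi>" and x: "x \<in> carrier M"
  shows "wt_module.component N (h x) (\<phi> \<mu>) = h (wt_module.component M x \<mu>)"
proof -
  interpret M: wt_module M by fact
  interpret N: wt_module N by fact
  let ?B = "{\<mu>. M.component x \<mu> \<noteq> \<zero>\<^bsub>M\<^esub>}"
  define g where "g \<kappa> = h (M.component x (inv_into UNIV \<phi> \<kappa>))" for \<kappa>
  have gW: "g \<kappa> \<in> N.W \<kappa>" for \<kappa>
    using h(3)[OF M.component_W[OF x], of "inv_into UNIV \<phi> \<kappa>"] \<phi> by (simp add: g_def bij_is_surj surj_f_inv_f)
  have g\<phi>: "g (\<phi> \<mu>) = h (M.component x \<mu>)" for \<mu>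
    using \<phi> by (simp add: g_def bij_is_inj)
  have h0: "h \<zero>\<^bsub>M\<^esub> = \<zero>\<^bsub>N\<^esub>"
    using finsum_additive[OF M.M.abelian_group_axioms N.M.abelian_group_axioms, of "{}" "\<lambda>_. \<zero>\<^bsub>M\<^esub>" h] h(1,2) by simp
  have "{\<kappa>. g \<kappa> \<noteq> \<zero>\<^bsub>N\<^esub>} \<subseteq> \<phi> ` ?B"
  proof
    fix \<kappa> assume "\<kappa> \<in> {\<kappa>. g \<kappa> \<noteq> \<zero>\<^bsub>N\<^esub>}"
    then have "inv_into UNIV \<phi> \<kappa> \<in> ?B" using h0 by (auto simp: g_def)
    moreover have "\<kappa> = \<phi> (inv_into UNIV \<phi> \<kappa>)" using \<phi> by (simp add: bij_is_surj surj_f_inv_f)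
    ultimately show "\<kappa> \<in> \<phi> ` ?B" by (metis imageI)
  qed
  then have "N.component (\<Oplus>\<^bsub>N\<^esub>\<kappa> \<in> \<phi> ` ?B. g \<kappa>) = g"
    using M.component_finite[OF x] by (intro N.component_finsum gW) simp_all
  also have "(\<Oplus>\<^bsub>N\<^esub>\<kappa> \<in> \<phi> ` ?B. g \<kappa>) = (\<Oplus>\<^bsub>N\<^esub>\<mu> \<in> ?B. g (\<phi> \<mu>))"
    using \<phi> N.W_carrier[OF gW] by (intro N.M.finsum_reindex) (auto simp: bij_def inj_on_def)
  also have "\<dots> = (\<Oplus>\<^bsub>N\<^esub>\<mu> \<in> ?B. h (M.component x \<mu>))"
    by (simp add: g\<phi>)
  also have "\<dots> = h (\<Oplus>\<^bsub>M\<^esub>\<mu> \<in> ?B. M.component x \<mu>)"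
    by (rule finsum_additive[symmetric, OF M.M.abelian_group_axioms N.M.abelian_group_axioms])
      (use M.component_finite[OF x] M.component_carrier[OF x] h in auto)
  also have "(\<Oplus>\<^bsub>M\<^esub>\<mu> \<in> ?B. M.component x \<mu>) = x"
    by (rule M.component_sum[OF x, symmetric])
  finally show ?thesis using g\<phi> by simp
qed

lemma bij_shift: "bij (shift i c)"
  by (rule bij_betw_byWitness[where f' = "shift i (- c)"]) auto

context wt_module
begin

lemma wt: "wt_module M" by unfold_locales

lemma component_T: "x \<in> carrier M \<Longrightarrow> component (T i x) (shift i 1 \<mu>) = T i (component x \<mu>)"
  and component_D: "x \<in> carrier M \<Longrightarrow> component (D i x) (shift i (-1) \<mu>) = D i (component x \<mu>)"
  and component_S: "x \<in> carrier M \<Longrightarrow> component (S c x) \<mu> = S c (component x \<mu>)"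
  by (rule component_map[OF wt wt _ _ _ bij_shift]; simp add: closeds T_add D_add W_T W_D)+
    (rule component_map[OF wt wt _ _ _ bij_id, simplified]; simp add: closeds S_add W_S)

lemma component_add:
  assumes x: "x \<in> carrier M" and y: "y \<in> carrier M"
  shows "component (x \<oplus> y) \<mu> = component x \<mu> \<oplus> component y \<mu>"
proof -
  let ?B = "{\<mu>. component x \<mu> \<noteq> \<zero>} \<union> {\<mu>. component y \<mu> \<noteq> \<zero>}"
  have fin: "finite ?B" using x y by (simp add: component_finite)
  have "component (\<Oplus>\<mu> \<in> ?B. component x \<mu> \<oplus> component y \<mu>) = (\<lambda>\<mu>. component x \<mu> \<oplus> component y \<mu>)"
    by (rule component_finsum[OF _ fin]) (use x y in \<open>auto simp: W_add component_W\<close>)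
  moreover have "(\<Oplus>\<mu> \<in> ?B. component x \<mu> \<oplus> component y \<mu>) = (\<Oplus>\<mu> \<in> ?B. component x \<mu>) \<oplus> (\<Oplus>\<mu> \<in> ?B. component y \<mu>)"
    using x y by (intro M.finsum_addf) (auto simp: component_carrier)
  moreover have "(\<Oplus>\<mu> \<in> ?B. component x \<mu>) = x" "(\<Oplus>\<mu> \<in> ?B. component y \<mu>) = y"
    using sum_support[OF component_carrier[OF x] fin] sum_support[OF component_carrier[OF y] fin]
      component_sum[OF x] component_sum[OF y] by auto
  ultimately show ?thesis by simp
qed

end

section \<open>Homomorphisms of weight modules\<close>

locale wt_pair = M: wt_module M + N: wt_module N
  for M :: "('n::finite poly_op, 'a) module" and N :: "('n poly_op, 'b) module"
begin

abbreviation homs :: "('a \<Rightarrow> 'b) set" where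
  "homs \<equiv> LinearCombinations.module_hom weyl_algebra M N"

lemma hom_iff: "H \<in> homs \<longleftrightarrow>
    (\<forall>x \<in> carrier M. H x \<in> carrier N) \<and>
    (\<forall>x \<in> carrier M. \<forall>y \<in> carrier M. H (x \<oplus>\<^bsub>M\<^esub> y) = H x \<oplus>\<^bsub>N\<^esub> H y) \<and>
    (\<forall>A \<in> weyl_ops. \<forall>x \<in> carrier M. H (A \<odot>\<^bsub>M\<^esub> x) = A \<odot>\<^bsub>N\<^esub> H x)"
  unfolding LinearCombinations.module_hom_def by (auto simp: weyl_algebra_def)

lemma hom_rules: assumes "H \<in> homs"
  shows hom_closed: "x \<in> carrier M \<Longrightarrow> H x \<in> carrier N"
    and hom_add: "x \<in> carrier M \<Longrightarrow> y \<in> carrier M \<Longrightarrow> H (x \<oplus>\<^bsub>M\<^esub> y) = H x \<oplus>\<^bsub>N\<^esub> H y"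
    and hom_op: "A \<in> weyl_ops \<Longrightarrow> x \<in> carrier M \<Longrightarrow> H (A \<odot>\<^bsub>M\<^esub> x) = A \<odot>\<^bsub>N\<^esub> H x"
  using assms unfolding hom_iff by blast+

lemma hom_W:
  assumes "H \<in> homs" "x \<in> M.W \<mu>" shows "H x \<in> N.W \<mu>"
  unfolding N.W_iff
proof (intro conjI allI)
  note x = M.W_carrier[OF assms(2)]
  show "H x \<in> carrier N" by (rule hom_closed[OF assms(1) x])
  show "N.T i (N.D i (H x)) = N.S (\<mu> i) (H x)" for i
    using arg_cong[OF M.TD[OF assms(2), of i], of H] x
    by (simp add: hom_op[OF assms(1)] M.ops M.op_closed)
qed

lemma hom_component:
  assumes "H \<in> homs" "x \<in> carrier M"
  shows "N.component (H x) \<mu> = H (M.component x \<mu>)"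
  using component_map[OF M.wt N.wt hom_closed[OF assms(1)] hom_add[OF assms(1)] _ bij_id assms(2), of \<mu>]
    hom_W[OF assms(1)] by simp

lemma hom_eqI:
  assumes "H \<in> homs" "H' \<in> homs"
    "\<And>\<mu> x. x \<in> M.W \<mu> \<Longrightarrow> H x = H' x" "x \<in> carrier M"
  shows "H x = H' x"
proof (rule N.component_inject)
  show "N.component (H x) = N.component (H' x)"
  proof
    fix \<mu>
    show "N.component (H x) \<mu> = N.component (H' x) \<mu>"
      using assms(3)[OF M.component_W[OF assms(4), of \<mu>]]
      by (simp add: hom_component[OF assms(1,4)] hom_component[OF assms(2,4)])
  qed
qed (simp_all add: hom_closed[OF assms(1,4)] hom_closed[OF assms(2,4)])

text \<open>
  A family of maps between weight spaces that commutes with the generators assembles to a homomorphism. Its value is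
  characterised by its components, so every property is checked one weight at a time.
\<close>

lemma extend_graded:
  fixes h :: "('n \<Rightarrow> complex) \<Rightarrow> 'a \<Rightarrow> 'b"
  assumes hW: "\<And>\<mu> x. x \<in> M.W \<mu> \<Longrightarrow> h \<mu> x \<in> N.W \<mu>"
    and h_add: "\<And>\<mu> x y. x \<in> M.W \<mu> \<Longrightarrow> y \<in> M.W \<mu> \<Longrightarrow> h \<mu> (x \<oplus>\<^bsub>M\<^esub> y) = h \<mu> x \<oplus>\<^bsub>N\<^esub> h \<mu> y"
    and h_S: "\<And>\<mu> x c. x \<in> M.W \<mu> \<Longrightarrow> h \<mu> (M.S c x) = N.S c (h \<mu> x)"
    and h_T: "\<And>\<mu> x i. x \<in> M.W \<mu> \<Longrightarrow> h (shift i 1 \<mu>) (M.T i x) = N.T i (h \<mu> x)"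
    and h_D: "\<And>\<mu> x i. x \<in> M.W \<mu> \<Longrightarrow> h (shift i (-1) \<mu>) (M.D i x) = N.D i (h \<mu> x)"
  obtains H where "H \<in> homs"
    and "\<And>\<mu> x. x \<in> M.W \<mu> \<Longrightarrow> H x = h \<mu> x"
proof -
  have h0: "h \<mu> \<zero>\<^bsub>M\<^esub> = \<zero>\<^bsub>N\<^esub>" for \<mu>
    using h_S[OF M.W_zero, of \<mu> 0] by (simp add: M.S_zero N.S_0 N.W_carrier[OF hW[OF M.W_zero]])
  \<comment> \<open>the sum runs over the support of \<open>x\<close>, which contains that of its image\<close>
  define H where "H x = (\<Oplus>\<^bsub>N\<^esub>\<mu> \<in> {\<mu>. M.component x \<mu> \<noteq> \<zero>\<^bsub>M\<^esub>}. h \<mu> (M.component x \<mu>))" for x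
  have H_closed: "H x \<in> carrier N" if "x \<in> carrier M" for x
    unfolding H_def by (rule N.sum_W_closed[OF hW[OF M.component_W[OF that]]])
  have H_component: "N.component (H x) \<mu> = h \<mu> (M.component x \<mu>)" if "x \<in> carrier M" for x \<mu>
  proof -
    have "N.component (H x) = (\<lambda>\<mu>. h \<mu> (M.component x \<mu>))"
      unfolding H_def
      by (rule N.component_finsum[OF hW[OF M.component_W[OF that]] M.component_finite[OF that]]) (auto simp: h0)
    then show ?thesis by simp
  qed
  have eqI: "u = v" if "u \<in> carrier N" "v \<in> carrier N" "\<And>\<mu>. N.component u \<mu> = N.component v \<mu>" for u v
    using N.component_inject[OF that(1,2)] that(3) by blast
  have H_add: "H (x \<oplus>\<^bsub>M\<^esub> y) = H x \<oplus>\<^bsub>N\<^esub> H y" if "x \<in> carrier M" "y \<in> carrier M" for x y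
    by (rule eqI) (simp_all add: that H_closed H_component N.component_add M.component_add h_add M.component_W)
  have H_S: "H (M.S c x) = N.S c (H x)" if "x \<in> carrier M" for c x
    by (rule eqI) (simp_all add: that H_closed H_component N.component_S M.component_S h_S M.component_W M.closeds N.closeds)
  have H_T: "H (M.T i x) = N.T i (H x)" if x: "x \<in> carrier M" for i x
  proof (rule eqI)
    fix \<mu>
    have "N.component (H (M.T i x)) (shift i 1 (shift i (-1) \<mu>)) = N.component (N.T i (H x)) (shift i 1 (shift i (-1) \<mu>))"
      by (simp only: H_component M.closeds M.component_T N.component_T x H_closed h_T M.component_W)
    then show "N.component (H (M.T i x)) \<mu> = N.component (N.T i (H x)) \<mu>" by simp
  qed (simp_all add: x H_closed M.closeds N.closeds)
  have H_D: "H (M.D i x) = N.D i (H x)" if x: "x \<in> carrier M" for i x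
  proof (rule eqI)
    fix \<mu>
    have "N.component (H (M.D i x)) (shift i (-1) (shift i 1 \<mu>)) = N.component (N.D i (H x)) (shift i (-1) (shift i 1 \<mu>))"
      by (simp only: H_component M.closeds M.component_D N.component_D x H_closed h_D M.component_W)
    then show "N.component (H (M.D i x)) \<mu> = N.component (N.D i (H x)) \<mu>" by simp
  qed (simp_all add: x H_closed M.closeds N.closeds)
  have H_op: "H (A \<odot>\<^bsub>M\<^esub> x) = A \<odot>\<^bsub>N\<^esub> H x" if "A \<in> weyl_ops" "x \<in> carrier M" for A x
    using that
  proof (induction arbitrary: x rule: weyl_ops.induct)
    case (add A B)
    then show ?case by (simp add: M.op_plus N.op_plus H_add H_closed M.op_closed)
  next
    case (comp A B)
    then show ?case
      by (simp only: M.op_comp[OF comp.hyps(1,2) comp.prems] comp.IH M.op_closed[OF comp.hyps(2) comp.prems]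
          N.op_comp[OF comp.hyps(1,2) H_closed[OF comp.prems]])
  qed (simp_all add: H_S H_T H_D)
  have "H \<in> homs"
    unfolding hom_iff using H_closed H_add H_op by simp
  moreover have "H x = h \<mu> x" if x: "x \<in> M.W \<mu>" for \<mu> x
  proof (rule eqI)
    show "N.component (H x) \<kappa> = N.component (h \<mu> x) \<kappa>" for \<kappa>
      using M.component_single[OF x] N.component_single[OF hW[OF x]] by (simp add: H_component[OF M.W_carrier[OF x]] h0)
  qed (use x in \<open>simp_all add: H_closed M.W_carrier N.W_carrier[OF hW]\<close>)
  ultimately show ?thesis by (rule that)
qed

end

section \<open>Reference weights\<close>

text \<open>
  The reference weight of the chamber of \<open>\<mu>\<close>. In an integral direction the sign tells on which side of the wall
  between \<open>-1\<close> and \<open>0\<close> the weight lies, and the reference coordinate is the one next to the wall; in the other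
  directions there is no wall and the coordinate of \<open>\<nu>\<close> serves for the whole coset.
\<close>

definition ref_weight :: "('n \<Rightarrow> complex) \<Rightarrow> ('n \<Rightarrow> complex) \<Rightarrow> 'n \<Rightarrow> complex" where
  "ref_weight \<nu> \<mu> i = (if \<nu> i \<in> \<int> then (if 0 \<le> Re (\<mu> i) then 0 else -1) else \<nu> i)"

text \<open>
  For \<open>\<mu>\<close> in the coset the difference below is an integer; its positive and negative parts are the exponents
  of monomials in the \<open>t_op i\<close> that take the reference weight and \<open>\<mu>\<close>, respectively, to a common weight.
\<close>

definition offset :: "('n \<Rightarrow> complex) \<Rightarrow> ('n \<Rightarrow> complex) \<Rightarrow> 'n \<Rightarrow> int" where
  "offset \<nu> \<mu> i = \<lfloor>Re (\<mu> i - ref_weight \<nu> \<mu> i)\<rfloor>"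

definition pos_offset :: "('n \<Rightarrow> complex) \<Rightarrow> ('n \<Rightarrow> complex) \<Rightarrow> 'n \<Rightarrow> nat" where
  "pos_offset \<nu> \<mu> i = nat (offset \<nu> \<mu> i)"

definition neg_offset :: "('n \<Rightarrow> complex) \<Rightarrow> ('n \<Rightarrow> complex) \<Rightarrow> 'n \<Rightarrow> nat" where
  "neg_offset \<nu> \<mu> i = nat (- offset \<nu> \<mu> i)"

lemma coset_shift: "\<mu> \<in> weight_coset \<nu> \<Longrightarrow> c \<in> \<int> \<Longrightarrow> shift i c \<mu> \<in> weight_coset \<nu>"
  unfolding weight_coset_def shift_def
  by (auto simp: add_diff_eq[symmetric] add.commute[of _ c] intro!: Ints_add simp flip: add_diff_eq)

lemma coset_Ints: assumes "\<mu> \<in> weight_coset \<nu>" shows "\<mu> i \<in> \<int> \<longleftrightarrow> \<nu> i \<in> \<int>"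
proof -
  have d: "\<mu> i - \<nu> i \<in> \<int>" using assms by (simp add: weight_coset_def)
  then show ?thesis
    using Ints_add[OF d, of "\<nu> i"] Ints_diff[of "\<mu> i" "\<mu> i - \<nu> i"] by auto
qed

lemma ref_weight_diff: assumes "\<mu> \<in> weight_coset \<nu>" shows "\<mu> i = ref_weight \<nu> \<mu> i + of_int (offset \<nu> \<mu> i)"
proof -
  have "\<mu> i - ref_weight \<nu> \<mu> i \<in> \<int>"
    using assms coset_Ints[OF assms, of i] by (auto simp: ref_weight_def weight_coset_def)
  then obtain m where "\<mu> i - ref_weight \<nu> \<mu> i = of_int m" by (rule Ints_cases)
  then have "\<mu> i - ref_weight \<nu> \<mu> i = of_int (offset \<nu> \<mu> i)" by (simp add: offset_def)
  then show ?thesis by (simp add: algebra_simps)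
qed

lemma ref_weight_nonneg: assumes "\<mu> \<in> weight_coset \<nu>" "\<nu> i \<in> \<int>"
  shows "0 \<le> Re (\<mu> i) \<Longrightarrow> ref_weight \<nu> \<mu> i = 0 \<and> 0 \<le> offset \<nu> \<mu> i"
    and "\<not> 0 \<le> Re (\<mu> i) \<Longrightarrow> ref_weight \<nu> \<mu> i = -1 \<and> offset \<nu> \<mu> i \<le> 0"
proof -
  show "0 \<le> Re (\<mu> i) \<Longrightarrow> ref_weight \<nu> \<mu> i = 0 \<and> 0 \<le> offset \<nu> \<mu> i"
    using assms(2) by (simp add: ref_weight_def offset_def)
  assume neg: "\<not> 0 \<le> Re (\<mu> i)"
  then have r: "ref_weight \<nu> \<mu> i = -1" using assms(2) by (simp add: ref_weight_def)
  then have "Re (\<mu> i) = -1 + of_int (offset \<nu> \<mu> i)"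
    using arg_cong[OF ref_weight_diff[OF assms(1), of i], of Re] by simp
  then have "real_of_int (offset \<nu> \<mu> i) < 1" using neg by simp
  then show "ref_weight \<nu> \<mu> i = -1 \<and> offset \<nu> \<mu> i \<le> 0" using r by linarith
qed

lemma plus_exp_ref: assumes "\<mu> \<in> weight_coset \<nu>"
  shows "(\<lambda>i. ref_weight \<nu> \<mu> i + of_nat (pos_offset \<nu> \<mu> i)) = (\<lambda>i. \<mu> i + of_nat (neg_offset \<nu> \<mu> i))"
proof
  fix i
  have "of_nat (pos_offset \<nu> \<mu> i) = of_int (offset \<nu> \<mu> i) + (of_nat (neg_offset \<nu> \<mu> i) :: complex)"
    by (cases "0 \<le> offset \<nu> \<mu> i") (simp_all add: pos_offset_def neg_offset_def)
  then show "ref_weight \<nu> \<mu> i + of_nat (pos_offset \<nu> \<mu> i) = \<mu> i + of_nat (neg_offset \<nu> \<mu> i)"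
    using ref_weight_diff[OF assms, of i] by simp
qed

lemma nonint_safe: "z \<notin> \<int> \<Longrightarrow> z + of_nat l \<noteq> (-1 :: complex)"
  by (metis Ints_1 Ints_diff Ints_minus Ints_of_nat add_diff_cancel_right')

lemma safe_pos_offset: assumes "\<mu> \<in> weight_coset \<nu>" "l < pos_offset \<nu> \<mu> i" shows "ref_weight \<nu> \<mu> i + of_nat l \<noteq> -1"
proof (cases "\<nu> i \<in> \<int>")
  case True
  have "0 \<le> Re (\<mu> i)"
    using ref_weight_nonneg(2)[OF assms(1) True] assms(2) by (cases "0 \<le> Re (\<mu> i)") (auto simp: pos_offset_def)
  then have "ref_weight \<nu> \<mu> i = 0" using ref_weight_nonneg(1)[OF assms(1) True] by simp
  then show ?thesis by (auto dest: arg_cong[of _ _ Re])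
next
  case False
  then show ?thesis using nonint_safe by (simp add: ref_weight_def)
qed

lemma safe_neg_offset: assumes "\<mu> \<in> weight_coset \<nu>" "l < neg_offset \<nu> \<mu> i" shows "\<mu> i + of_nat l \<noteq> -1"
proof (cases "\<nu> i \<in> \<int>")
  case True
  have "\<not> 0 \<le> Re (\<mu> i)"
    using ref_weight_nonneg(1)[OF assms(1) True] assms(2) by (cases "0 \<le> Re (\<mu> i)") (auto simp: neg_offset_def)
  then have "ref_weight \<nu> \<mu> i = -1" using ref_weight_nonneg(2)[OF assms(1) True] by simp
  then have "Re (\<mu> i + of_nat l) = -1 + of_int (offset \<nu> \<mu> i) + of_nat l"
    using arg_cong[OF ref_weight_diff[OF assms(1), of i], of Re] by simp
  also have "\<dots> < -1" using assms(2) by (simp add: neg_offset_def)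
  finally show ?thesis by force
next
  case False
  then show ?thesis using nonint_safe coset_Ints[OF assms(1)] by blast
qed

lemma ref_weight_coset: "ref_weight \<nu> \<mu> \<in> weight_coset \<nu>"
  by (auto simp: weight_coset_def ref_weight_def)

text \<open>
  A unit step stays in the chamber unless it starts at coordinate \<open>-1\<close>; there it leads from one
  reference coordinate to the other.
\<close>

lemma ref_weight_shift:
  assumes "\<mu> \<in> weight_coset \<nu>"
  shows "\<mu> i \<noteq> -1 \<Longrightarrow> ref_weight \<nu> (shift i 1 \<mu>) = ref_weight \<nu> \<mu>"
    and "\<mu> i = -1 \<Longrightarrow> ref_weight \<nu> (shift i 1 \<mu>) = shift i 1 (ref_weight \<nu> \<mu>)"
proof -
  have int: "\<nu> i \<in> \<int>" if "\<mu> i = -1" using coset_Ints[OF assms, of i] that by simp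
  show "\<mu> i = -1 \<Longrightarrow> ref_weight \<nu> (shift i 1 \<mu>) = shift i 1 (ref_weight \<nu> \<mu>)"
    using int by (auto simp: fun_eq_iff ref_weight_def shift_def)
  assume nm: "\<mu> i \<noteq> -1"
  have "(0 \<le> Re (\<mu> i + 1)) = (0 \<le> Re (\<mu> i))" if "\<nu> i \<in> \<int>"
  proof -
    have "\<mu> i \<in> \<int>" using coset_Ints[OF assms, of i] that by simp
    then obtain m where m: "\<mu> i = of_int m" by (rule Ints_cases)
    then have "m \<noteq> -1" using nm by auto
    then show ?thesis using m by simp linarith
  qed
  then show "ref_weight \<nu> (shift i 1 \<mu>) = ref_weight \<nu> \<mu>"
    by (auto simp: fun_eq_iff ref_weight_def shift_def)
qed

lemma offset_shift:
  assumes "\<mu> \<in> weight_coset \<nu>"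
  shows "\<mu> i \<noteq> -1 \<Longrightarrow> offset \<nu> (shift i 1 \<mu>) = (offset \<nu> \<mu>)(i := offset \<nu> \<mu> i + 1)"
    and "\<mu> i = -1 \<Longrightarrow> offset \<nu> (shift i 1 \<mu>) = offset \<nu> \<mu>"
    and "\<mu> i = -1 \<Longrightarrow> offset \<nu> \<mu> i = 0"
proof -
  have int: "\<nu> i \<in> \<int>" if "\<mu> i = -1" using coset_Ints[OF assms, of i] that by simp
  show "\<mu> i \<noteq> -1 \<Longrightarrow> offset \<nu> (shift i 1 \<mu>) = (offset \<nu> \<mu>)(i := offset \<nu> \<mu> i + 1)"
  proof
    fix j assume nm: "\<mu> i \<noteq> -1"
    have "\<mu> i + 1 - ref_weight \<nu> \<mu> i = \<mu> i - ref_weight \<nu> \<mu> i + 1" by simp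
    then have "\<lfloor>Re (\<mu> i + 1 - ref_weight \<nu> \<mu> i)\<rfloor> = \<lfloor>Re (\<mu> i - ref_weight \<nu> \<mu> i)\<rfloor> + 1"
      by (simp only: plus_complex.simps one_complex.simps one_add_floor)
    then show "offset \<nu> (shift i 1 \<mu>) j = ((offset \<nu> \<mu>)(i := offset \<nu> \<mu> i + 1)) j"
      by (simp add: offset_def ref_weight_shift(1)[OF assms nm])
  qed
  show "offset \<nu> (shift i 1 \<mu>) = offset \<nu> \<mu>" if "\<mu> i = -1"
    by (rule ext) (simp add: offset_def ref_weight_shift(2)[OF assms that], simp add: shift_def)
  show "offset \<nu> \<mu> i = 0" if "\<mu> i = -1"
    using int[OF that] that by (simp add: offset_def ref_weight_def)
qed

context weyl_module
begin

text \<open>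
  The isomorphism from the weight space at the reference weight to the one at \<open>\<mu>\<close>: multiply up to a common
  weight and divide by the monomial that leads there from \<open>\<mu>\<close>. Only monomials in the \<open>t_op i\<close> are involved, and
  they commute, so no path between the two weights has to be chosen.
\<close>

definition theta :: "('n \<Rightarrow> complex) \<Rightarrow> ('n \<Rightarrow> complex) \<Rightarrow> 'a \<Rightarrow> 'a" where
  "theta \<nu> \<mu> x = inv_into (W \<mu>) (\<lambda>y. K (neg_offset \<nu> \<mu>) y) (K (pos_offset \<nu> \<mu>) x)"

lemma K_pos_offset_bij: "\<mu> \<in> weight_coset \<nu> \<Longrightarrow>
    bij_betw (\<lambda>x. K (pos_offset \<nu> \<mu>) x) (W (ref_weight \<nu> \<mu>)) (W (plus_exp \<mu> (neg_offset \<nu> \<mu>)))"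
  using K_bij[of "pos_offset \<nu> \<mu>" "ref_weight \<nu> \<mu>"] safe_pos_offset[of \<mu> \<nu>] plus_exp_ref[of \<mu> \<nu>]
  by (simp add: plus_exp_def[abs_def])

lemma K_neg_offset_bij: "\<mu> \<in> weight_coset \<nu> \<Longrightarrow>
    bij_betw (\<lambda>x. K (neg_offset \<nu> \<mu>) x) (W \<mu>) (W (plus_exp \<mu> (neg_offset \<nu> \<mu>)))"
  using K_bij[of "neg_offset \<nu> \<mu>" \<mu>] safe_neg_offset[of \<mu> \<nu>] by blast

lemma theta_bij: "\<mu> \<in> weight_coset \<nu> \<Longrightarrow> bij_betw (theta \<nu> \<mu>) (W (ref_weight \<nu> \<mu>)) (W \<mu>)"
  unfolding theta_def[abs_def]
  using bij_betw_trans[OF K_pos_offset_bij bij_betw_inv_into[OF K_neg_offset_bij]] by (simp add: o_def)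

lemma theta_W: "\<mu> \<in> weight_coset \<nu> \<Longrightarrow> x \<in> W (ref_weight \<nu> \<mu>) \<Longrightarrow> theta \<nu> \<mu> x \<in> W \<mu>"
  using theta_bij bij_betwE by blast

lemma theta_K:
  assumes "\<mu> \<in> weight_coset \<nu>" "x \<in> W (ref_weight \<nu> \<mu>)"
  shows "K (neg_offset \<nu> \<mu>) (theta \<nu> \<mu> x) = K (pos_offset \<nu> \<mu>) x"
  unfolding theta_def
  by (rule bij_betw_inv_into_right[OF K_neg_offset_bij[OF assms(1)]])
    (rule bij_betw_apply[OF K_pos_offset_bij[OF assms(1)] assms(2)])

lemma theta_unique:
  assumes "\<mu> \<in> weight_coset \<nu>" "x \<in> W (ref_weight \<nu> \<mu>)" "y \<in> W \<mu>" "K (neg_offset \<nu> \<mu>) y = K (pos_offset \<nu> \<mu>) x"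
  shows "theta \<nu> \<mu> x = y"
  by (rule inj_onD[OF bij_betw_imp_inj_on[OF K_neg_offset_bij[OF assms(1)]]])
    (simp_all add: theta_K[OF assms(1,2)] theta_W[OF assms(1,2)] assms(3,4))

lemma theta_add:
  assumes "\<mu> \<in> weight_coset \<nu>" "x \<in> W (ref_weight \<nu> \<mu>)" "y \<in> W (ref_weight \<nu> \<mu>)"
  shows "theta \<nu> \<mu> (x \<oplus> y) = theta \<nu> \<mu> x \<oplus> theta \<nu> \<mu> y"
  by (rule theta_unique)
    (use assms theta_W[OF assms(1,2)] theta_W[OF assms(1,3)]
     in \<open>simp_all add: W_add K_add W_carrier theta_K\<close>)

lemma theta_S:
  assumes "\<mu> \<in> weight_coset \<nu>" "x \<in> W (ref_weight \<nu> \<mu>)"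
  shows "theta \<nu> \<mu> (S c x) = S c (theta \<nu> \<mu> x)"
  by (rule theta_unique)
    (use assms theta_W[OF assms(1,2)] in \<open>simp_all add: W_S K_S W_carrier theta_K\<close>)

lemma theta_ref_weight: "x \<in> W (ref_weight \<nu> \<mu>) \<Longrightarrow> ref_weight \<nu> \<mu> = \<mu> \<Longrightarrow> \<mu> \<in> weight_coset \<nu> \<Longrightarrow> theta \<nu> \<mu> x = x"
proof (rule theta_unique)
  assume a: "x \<in> W (ref_weight \<nu> \<mu>)" "ref_weight \<nu> \<mu> = \<mu>"
  then have "offset \<nu> \<mu> = (\<lambda>_. 0)" by (simp add: offset_def fun_eq_iff)
  then have "neg_offset \<nu> \<mu> = pos_offset \<nu> \<mu>" by (simp add: neg_offset_def pos_offset_def fun_eq_iff)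
  then show "K (neg_offset \<nu> \<mu>) x = K (pos_offset \<nu> \<mu>) x" by simp
qed simp_all

text \<open>
  Within a chamber a step by \<open>t_op i\<close> either lengthens the monomial from the reference weight or
  shortens the one that \<open>theta\<close> divides by.
\<close>

lemma theta_T:
  assumes c: "\<mu> \<in> weight_coset \<nu>" and x: "x \<in> W (ref_weight \<nu> \<mu>)" and nm: "\<mu> i \<noteq> -1"
  shows "theta \<nu> (shift i 1 \<mu>) x = T i (theta \<nu> \<mu> x)"
proof (rule theta_unique)
  note y = theta_W[OF c x]
  show "shift i 1 \<mu> \<in> weight_coset \<nu>" by (rule coset_shift[OF c]) simp
  show "x \<in> W (ref_weight \<nu> (shift i 1 \<mu>))" using x ref_weight_shift(1)[OF c nm] by simp
  show "T i (theta \<nu> \<mu> x) \<in> W (shift i 1 \<mu>)" by (rule W_T[OF y])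
  show "K (neg_offset \<nu> (shift i 1 \<mu>)) (T i (theta \<nu> \<mu> x)) = K (pos_offset \<nu> (shift i 1 \<mu>)) x"
  proof (cases "0 \<le> offset \<nu> \<mu> i")
    case True
    then have "neg_offset \<nu> (shift i 1 \<mu>) = neg_offset \<nu> \<mu>" "pos_offset \<nu> (shift i 1 \<mu>) = inc i (pos_offset \<nu> \<mu>)"
      by (auto simp: neg_offset_def pos_offset_def offset_shift(1)[OF c nm] fun_eq_iff inc_def)
    then show ?thesis
      using theta_K[OF c x] W_carrier[OF x] W_carrier[OF y] by (simp add: K_T K_inc)
  next
    case False
    then have "neg_offset \<nu> \<mu> = inc i (neg_offset \<nu> (shift i 1 \<mu>))" "pos_offset \<nu> (shift i 1 \<mu>) = pos_offset \<nu> \<mu>"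
      by (auto simp: neg_offset_def pos_offset_def offset_shift(1)[OF c nm] fun_eq_iff inc_def)
    then show ?thesis
      using theta_K[OF c x] W_carrier[OF x] W_carrier[OF y] by (simp add: K_T K_inc)
  qed
qed

text \<open>
  At the wall both weights have offset zero in direction \<open>i\<close>, so the two monomials stay the same. They commute with
  \<open>t_op i\<close> and, as they do not involve the variable \<open>i\<close>, also with \<open>d_op i\<close>.
\<close>

lemma theta_T_cross:
  assumes c: "\<mu> \<in> weight_coset \<nu>" and x: "x \<in> W (ref_weight \<nu> \<mu>)" and m: "\<mu> i = -1"
  shows "theta \<nu> (shift i 1 \<mu>) (T i x) = T i (theta \<nu> \<mu> x)"
proof (rule theta_unique)
  note y = theta_W[OF c x]
  show "shift i 1 \<mu> \<in> weight_coset \<nu>" by (rule coset_shift[OF c]) simp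
  show "T i x \<in> W (ref_weight \<nu> (shift i 1 \<mu>))" using W_T[OF x, of i] ref_weight_shift(2)[OF c m] by simp
  show "T i (theta \<nu> \<mu> x) \<in> W (shift i 1 \<mu>)" by (rule W_T[OF y])
  have "neg_offset \<nu> (shift i 1 \<mu>) = neg_offset \<nu> \<mu>" "pos_offset \<nu> (shift i 1 \<mu>) = pos_offset \<nu> \<mu>"
    by (simp_all add: neg_offset_def pos_offset_def offset_shift(2)[OF c m] fun_eq_iff)
  then show "K (neg_offset \<nu> (shift i 1 \<mu>)) (T i (theta \<nu> \<mu> x)) = K (pos_offset \<nu> (shift i 1 \<mu>)) (T i x)"
    using theta_K[OF c x] W_carrier[OF x] W_carrier[OF y] by (simp add: K_T)
qed

lemma theta_D_cross:
  assumes c: "\<mu> \<in> weight_coset \<nu>" and m: "\<mu> i = -1" and x: "x \<in> W (ref_weight \<nu> (shift i 1 \<mu>))"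
  shows "theta \<nu> \<mu> (D i x) = D i (theta \<nu> (shift i 1 \<mu>) x)"
proof (rule theta_unique[OF c])
  have c': "shift i 1 \<mu> \<in> weight_coset \<nu>" by (rule coset_shift[OF c]) simp
  note y = theta_W[OF c' x]
  show "D i x \<in> W (ref_weight \<nu> \<mu>)" using W_D[OF x, of i] ref_weight_shift(2)[OF c m] by simp
  show "D i (theta \<nu> (shift i 1 \<mu>) x) \<in> W \<mu>" using W_D[OF y, of i] by simp
  have "neg_offset \<nu> (shift i 1 \<mu>) = neg_offset \<nu> \<mu>" "pos_offset \<nu> (shift i 1 \<mu>) = pos_offset \<nu> \<mu>" "neg_offset \<nu> \<mu> i = 0" "pos_offset \<nu> \<mu> i = 0"
    by (simp_all add: neg_offset_def pos_offset_def offset_shift(2,3)[OF c m] fun_eq_iff)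
  then show "K (neg_offset \<nu> \<mu>) (D i (theta \<nu> (shift i 1 \<mu>) x)) = K (pos_offset \<nu> \<mu>) (D i x)"
    using theta_K[OF c' x] W_carrier[OF x] W_carrier[OF y] by (simp add: K_D)
qed

end

context wt_pair
begin

lemma hom_theta:
  assumes H: "H \<in> homs"
    and c: "\<mu> \<in> weight_coset \<nu>" and x: "x \<in> M.W (ref_weight \<nu> \<mu>)"
  shows "H (M.theta \<nu> \<mu> x) = N.theta \<nu> \<mu> (H x)"
proof (rule N.theta_unique[OF c, symmetric])
  note y = M.theta_W[OF c x]
  show "H x \<in> N.W (ref_weight \<nu> \<mu>)" "H (M.theta \<nu> \<mu> x) \<in> N.W \<mu>"
    using hom_W[OF H] x y by auto
  show "N.K (neg_offset \<nu> \<mu>) (H (M.theta \<nu> \<mu> x)) = N.K (pos_offset \<nu> \<mu>) (H x)"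
    using arg_cong[OF M.theta_K[OF c x], of H] M.W_carrier[OF x] M.W_carrier[OF y]
    by (simp add: hom_op[OF H] M.ops)
qed

text \<open>
  Homomorphisms commute with \<open>theta\<close>, which reaches every weight space from the one at its reference weight.
\<close>

lemma hom_eq_from_references:
  assumes H: "H \<in> homs"
      "H' \<in> homs"
    and supp: "weight_supp M \<subseteq> weight_coset \<nu>"
    and eq: "\<And>\<mu> x. \<mu> \<in> weight_coset \<nu> \<Longrightarrow> x \<in> M.W (ref_weight \<nu> \<mu>) \<Longrightarrow> H x = H' x"
    and "x \<in> carrier M"
  shows "H x = H' x"
proof (rule hom_eqI[OF H _ assms(5)])
  fix \<mu> x assume x: "x \<in> M.W \<mu>"
  show "H x = H' x"
  proof (cases "\<mu> \<in> weight_coset \<nu>")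
    case True
    then obtain y where y: "y \<in> M.W (ref_weight \<nu> \<mu>)" "x = M.theta \<nu> \<mu> y"
      using bij_betw_imp_surj_on[OF M.theta_bij] x by blast
    then show ?thesis using eq[OF True y(1)] hom_theta[OF H(1) True y(1)] hom_theta[OF H(2) True y(1)] by simp
  next
    case False
    then have "x = \<zero>\<^bsub>M\<^esub>" using M.W_zero_outside supp x by blast
    then show ?thesis using hom_op[OF H(1) weyl_ops.scalar[of 0], of x] hom_op[OF H(2) weyl_ops.scalar[of 0], of x]
        hom_closed[OF H(1), of x] hom_closed[OF H(2), of x]
      by (simp add: M.S_zero N.S_0)
  qed
qed

text \<open>
  A family of maps at the reference weights that commutes with the generators across the walls
  is conjugated by \<open>theta\<close> to all weight spaces. It commutes with \<open>t_op i\<close> by the two lemmas on \<open>theta\<close>; within a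
  chamber it then commutes with \<open>d_op i\<close> too, since there \<open>d_op i\<close> is a scalar times the inverse of \<open>t_op i\<close>.
\<close>

lemma extend_from_references:
  fixes h :: "('n \<Rightarrow> complex) \<Rightarrow> 'a \<Rightarrow> 'b"
  assumes supp: "weight_supp M \<subseteq> weight_coset \<nu>"
    and hW: "\<And>\<mu> x. \<mu> \<in> weight_coset \<nu> \<Longrightarrow> ref_weight \<nu> \<mu> = \<mu> \<Longrightarrow> x \<in> M.W \<mu> \<Longrightarrow> h \<mu> x \<in> N.W \<mu>"
    and h_add: "\<And>\<mu> x y. \<mu> \<in> weight_coset \<nu> \<Longrightarrow> ref_weight \<nu> \<mu> = \<mu> \<Longrightarrow> x \<in> M.W \<mu> \<Longrightarrow> y \<in> M.W \<mu>
      \<Longrightarrow> h \<mu> (x \<oplus>\<^bsub>M\<^esub> y) = h \<mu> x \<oplus>\<^bsub>N\<^esub> h \<mu> y"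
    and h_S: "\<And>\<mu> x c. \<mu> \<in> weight_coset \<nu> \<Longrightarrow> ref_weight \<nu> \<mu> = \<mu> \<Longrightarrow> x \<in> M.W \<mu>
      \<Longrightarrow> h \<mu> (M.S c x) = N.S c (h \<mu> x)"
    and h_T: "\<And>\<mu> x i. \<mu> \<in> weight_coset \<nu> \<Longrightarrow> ref_weight \<nu> \<mu> = \<mu> \<Longrightarrow> \<mu> i = -1 \<Longrightarrow> x \<in> M.W \<mu>
      \<Longrightarrow> h (shift i 1 \<mu>) (M.T i x) = N.T i (h \<mu> x)"
    and h_D: "\<And>\<mu> x i. \<mu> \<in> weight_coset \<nu> \<Longrightarrow> ref_weight \<nu> \<mu> = \<mu> \<Longrightarrow> \<mu> i = -1 \<Longrightarrow> x \<in> M.W (shift i 1 \<mu>)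
      \<Longrightarrow> h \<mu> (M.D i x) = N.D i (h (shift i 1 \<mu>) x)"
  obtains H where "H \<in> homs"
    and "\<And>\<mu> x. \<mu> \<in> weight_coset \<nu> \<Longrightarrow> ref_weight \<nu> \<mu> = \<mu> \<Longrightarrow> x \<in> M.W \<mu> \<Longrightarrow> H x = h \<mu> x"
proof -
  have idem: "ref_weight \<nu> (ref_weight \<nu> \<mu>) = ref_weight \<nu> \<mu>" for \<mu>
    by (auto simp: ref_weight_def fun_eq_iff)
  note r = ref_weight_coset[of \<nu>] idem
  define g where "g \<mu> y = (if \<mu> \<in> weight_coset \<nu>
    then N.theta \<nu> \<mu> (h (ref_weight \<nu> \<mu>) (inv_into (M.W (ref_weight \<nu> \<mu>)) (M.theta \<nu> \<mu>) y)) else \<zero>\<^bsub>N\<^esub>)" for \<mu> y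
  have g: "g \<mu> (M.theta \<nu> \<mu> x) = N.theta \<nu> \<mu> (h (ref_weight \<nu> \<mu>) x)"
    if "\<mu> \<in> weight_coset \<nu>" "x \<in> M.W (ref_weight \<nu> \<mu>)" for \<mu> x
    using that bij_betw_inv_into_left[OF M.theta_bij[OF that(1)] that(2)] by (simp add: g_def)
  have theta_ex: "\<exists>x \<in> M.W (ref_weight \<nu> \<mu>). y = M.theta \<nu> \<mu> x" if "\<mu> \<in> weight_coset \<nu>" "y \<in> M.W \<mu>" for \<mu> y
    using bij_betw_imp_surj_on[OF M.theta_bij[OF that(1)]] that(2) by blast
  have outside: "x = \<zero>\<^bsub>M\<^esub>" if "\<mu> \<notin> weight_coset \<nu>" "x \<in> M.W \<mu>" for \<mu> x
    using M.W_zero_outside that supp by blast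
  have gW: "g \<mu> y \<in> N.W \<mu>" if y: "y \<in> M.W \<mu>" for \<mu> y
  proof (cases "\<mu> \<in> weight_coset \<nu>")
    case True
    from theta_ex[OF this y] show ?thesis
      by (auto simp: g[OF True] intro!: N.theta_W[OF True] hW r)
  qed (simp add: g_def N.W_zero)
  have g_add: "g \<mu> (x \<oplus>\<^bsub>M\<^esub> y) = g \<mu> x \<oplus>\<^bsub>N\<^esub> g \<mu> y" if x: "x \<in> M.W \<mu>" and y: "y \<in> M.W \<mu>" for \<mu> x y
  proof (cases "\<mu> \<in> weight_coset \<nu>")
    case True
    from theta_ex[OF this x] theta_ex[OF this y] obtain u v where
      u: "u \<in> M.W (ref_weight \<nu> \<mu>)" "x = M.theta \<nu> \<mu> u" and v: "v \<in> M.W (ref_weight \<nu> \<mu>)" "y = M.theta \<nu> \<mu> v" by blast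
    have "g \<mu> (x \<oplus>\<^bsub>M\<^esub> y) = g \<mu> (M.theta \<nu> \<mu> (u \<oplus>\<^bsub>M\<^esub> v))"
      using u v by (simp add: M.theta_add[OF True])
    also have "\<dots> = N.theta \<nu> \<mu> (h (ref_weight \<nu> \<mu>) u \<oplus>\<^bsub>N\<^esub> h (ref_weight \<nu> \<mu>) v)"
      using u(1) v(1) by (simp add: g[OF True] M.W_add h_add r)
    also have "\<dots> = g \<mu> x \<oplus>\<^bsub>N\<^esub> g \<mu> y"
      using u v hW[OF r u(1)] hW[OF r v(1)] by (simp add: N.theta_add[OF True] g[OF True])
    finally show ?thesis .
  qed (simp add: g_def)
  have g_S: "g \<mu> (M.S c x) = N.S c (g \<mu> x)" if x: "x \<in> M.W \<mu>" for \<mu> x c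
  proof (cases "\<mu> \<in> weight_coset \<nu>")
    case True
    from theta_ex[OF this x] obtain u where
      u: "u \<in> M.W (ref_weight \<nu> \<mu>)" "x = M.theta \<nu> \<mu> u" by blast
    have "g \<mu> (M.S c x) = g \<mu> (M.theta \<nu> \<mu> (M.S c u))"
      using u by (simp add: M.theta_S[OF True])
    also have "\<dots> = N.theta \<nu> \<mu> (N.S c (h (ref_weight \<nu> \<mu>) u))"
      using u(1) by (simp add: g[OF True] M.W_S h_S r)
    also have "\<dots> = N.S c (g \<mu> x)"
      using u hW[OF r u(1)] by (simp add: N.theta_S[OF True] g[OF True])
    finally show ?thesis .
  qed (simp add: g_def N.S_zero)
  have coset_iff: "shift i 1 \<mu> \<in> weight_coset \<nu> \<longleftrightarrow> \<mu> \<in> weight_coset \<nu>" for i \<mu>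
    using coset_shift[of \<mu> \<nu> 1 i] coset_shift[of "shift i 1 \<mu>" \<nu> "-1" i] by auto
  have g_T: "g (shift i 1 \<mu>) (M.T i x) = N.T i (g \<mu> x)" if x: "x \<in> M.W \<mu>" for \<mu> x i
  proof (cases "\<mu> \<in> weight_coset \<nu>")
    case True
    then have c': "shift i 1 \<mu> \<in> weight_coset \<nu>" using coset_iff by simp
    from theta_ex[OF True x] obtain u where
      u: "u \<in> M.W (ref_weight \<nu> \<mu>)" "x = M.theta \<nu> \<mu> u" by blast
    note hu = hW[OF r u(1)]
    show ?thesis
    proof (cases "\<mu> i = -1")
      case m: True
      have ref: "ref_weight \<nu> \<mu> i = -1" using offset_shift(3)[OF True m] ref_weight_diff[OF True, of i] m by simp
      have "M.T i x = M.theta \<nu> (shift i 1 \<mu>) (M.T i u)"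
        using M.theta_T_cross[OF True u(1) m] u(2) by simp
      then have "g (shift i 1 \<mu>) (M.T i x) = N.theta \<nu> (shift i 1 \<mu>) (h (ref_weight \<nu> (shift i 1 \<mu>)) (M.T i u))"
        using g[OF c'] M.W_T[OF u(1), of i] ref_weight_shift(2)[OF True m] by simp
      also have "\<dots> = N.theta \<nu> (shift i 1 \<mu>) (N.T i (h (ref_weight \<nu> \<mu>) u))"
        using h_T[OF r ref u(1)] ref_weight_shift(2)[OF True m] by simp
      also have "\<dots> = N.T i (g \<mu> x)"
        using N.theta_T_cross[OF True hu m] g[OF True u(1)] u(2) by simp
      finally show ?thesis .
    next
      case m: False
      have "M.T i x = M.theta \<nu> (shift i 1 \<mu>) u"
        using M.theta_T[OF True u(1) m] u(2) by simp
      then have "g (shift i 1 \<mu>) (M.T i x) = N.theta \<nu> (shift i 1 \<mu>) (h (ref_weight \<nu> \<mu>) u)"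
        using g[OF c', of u] u(1) ref_weight_shift(1)[OF True m] by simp
      also have "\<dots> = N.T i (g \<mu> x)"
        using N.theta_T[OF True hu m] g[OF True u(1)] u(2) by simp
      finally show ?thesis .
    qed
  qed (simp add: g_def coset_iff N.T_zero)
  have g_D': "g \<mu> (M.D i x) = N.D i (g (shift i 1 \<mu>) x)" if x: "x \<in> M.W (shift i 1 \<mu>)" for \<mu> x i
  proof (cases "\<mu> i = -1")
    case m: False
    then obtain y where y: "y \<in> M.W \<mu>" "x = M.T i y"
      using bij_betw_imp_surj_on[OF M.T_bij[of \<mu> i]] x by blast
    have "g \<mu> (M.D i x) = N.S (\<mu> i + 1) (g \<mu> y)"
      using y by (simp add: M.DT g_S)
    also have "\<dots> = N.D i (g (shift i 1 \<mu>) x)"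
      using y N.DT[OF gW[OF y(1)], of i] by (simp add: g_T)
    finally show ?thesis .
  next
    case m: True
    show ?thesis
    proof (cases "\<mu> \<in> weight_coset \<nu>")
      case True
      then have c': "shift i 1 \<mu> \<in> weight_coset \<nu>" using coset_iff by simp
      from theta_ex[OF c' x] obtain u where
        u: "u \<in> M.W (ref_weight \<nu> (shift i 1 \<mu>))" "x = M.theta \<nu> (shift i 1 \<mu>) u" by blast
      note hu = hW[OF r u(1)]
      note rs = ref_weight_shift(2)[OF True m]
      have ref: "ref_weight \<nu> \<mu> i = -1" using offset_shift(3)[OF True m] ref_weight_diff[OF True, of i] m by simp
      have Du: "M.D i u \<in> M.W (ref_weight \<nu> \<mu>)" using M.W_D[OF u(1), of i] rs by simp
      have "g \<mu> (M.D i x) = g \<mu> (M.theta \<nu> \<mu> (M.D i u))"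
        using M.theta_D_cross[OF True m u(1)] u(2) by simp
      also have "\<dots> = N.theta \<nu> \<mu> (N.D i (h (ref_weight \<nu> (shift i 1 \<mu>)) u))"
        using g[OF True Du] h_D[OF r ref, of u] u(1) rs by simp
      also have "\<dots> = N.D i (g (shift i 1 \<mu>) x)"
        using N.theta_D_cross[OF True m hu] g[OF c' u(1)] u(2) by simp
      finally show ?thesis .
    qed (simp add: g_def coset_iff N.D_zero)
  qed
  have g_D: "g (shift i (-1) \<mu>) (M.D i x) = N.D i (g \<mu> x)" if "x \<in> M.W \<mu>" for \<mu> x i
    using g_D'[of x i "shift i (-1) \<mu>"] that by simp
  obtain H where H: "H \<in> homs"
    "\<And>\<mu> x. x \<in> M.W \<mu> \<Longrightarrow> H x = g \<mu> x"
    using extend_graded[of g, OF gW g_add g_S g_T g_D] by metis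
  moreover have "g \<mu> x = h \<mu> x" if "\<mu> \<in> weight_coset \<nu>" "ref_weight \<nu> \<mu> = \<mu>" "x \<in> M.W \<mu>" for \<mu> x
    using g[OF that(1), of x] M.theta_ref_weight[of x \<nu> \<mu>] N.theta_ref_weight[of "h \<mu> x" \<nu> \<mu>] hW[OF that] that by simp
  ultimately show ?thesis using that by metis
qed

end

section \<open>The two categories\<close>

lemma weight_obj_wt_module: "M \<in> Obj (weight_cat X) \<Longrightarrow> wt_module M"
  by (simp add: weight_cat_def fin_weight_modules_def wt_module_def weyl_module_def
      wt_module_axioms_def weight_module_def)

lemma weight_cat_category:
  fixes X :: "('n::finite \<Rightarrow> complex) set"
  shows "category (weight_cat X :: (('n poly_op, 'a) module, 'a \<Rightarrow> 'a) cat)"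
proof
  fix a b c d :: "('n poly_op, 'a) module" and f g h
  assume a: "a \<in> Obj (weight_cat X)"
  interpret a: wt_module a by (rule weight_obj_wt_module[OF a])
  note cl = a.M.a_closed a.op_closed
  note defs = weight_cat_def LinearCombinations.module_hom_def extensional_def compose_def weyl_algebra_def
  show "Idn (weight_cat X) a \<in> Hom (weight_cat X) a a"
    by (auto simp: defs cl)
  show "Comp (weight_cat X) a a b f (Idn (weight_cat X) a) = f"
    "Comp (weight_cat X) a b b (Idn (weight_cat X) b) f = f"
    if "f \<in> Hom (weight_cat X) a b"
    using that by (auto simp: defs fun_eq_iff)
  assume f: "f \<in> Hom (weight_cat X) a b" and g: "g \<in> Hom (weight_cat X) b c"
  show "Comp (weight_cat X) a b c g f \<in> Hom (weight_cat X) a c"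
    using f g by (auto simp: defs cl Pi_iff)
  show "Comp (weight_cat X) a b d (Comp (weight_cat X) b c d h g) f
      = Comp (weight_cat X) a c d h (Comp (weight_cat X) a b c g f)"
    using f by (auto simp: defs fun_eq_iff Pi_iff)
qed

lemma cube_obj_cube_rep: "V \<in> Obj (cube_rep_cat k) \<Longrightarrow> cube_rep k V"
  by (simp add: cube_rep_cat_def cube_rep_def)

lemma (in cube_rep) sp_closed:
  assumes "v \<in> cverts k"
  shows "x \<in> carrier (sp v) \<Longrightarrow> y \<in> carrier (sp v) \<Longrightarrow> x \<oplus>\<^bsub>sp v\<^esub> y \<in> carrier (sp v)"
    and "x \<in> carrier (sp v) \<Longrightarrow> c \<odot>\<^bsub>sp v\<^esub> x \<in> carrier (sp v)"
proof -
  interpret vectorspace "class_ring :: complex ring" "sp v" by (rule vs[OF assms])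
  show "x \<in> carrier (sp v) \<Longrightarrow> y \<in> carrier (sp v) \<Longrightarrow> x \<oplus>\<^bsub>sp v\<^esub> y \<in> carrier (sp v)"
    "x \<in> carrier (sp v) \<Longrightarrow> c \<odot>\<^bsub>sp v\<^esub> x \<in> carrier (sp v)"
    by simp_all
qed

lemma cube_arc_ball: "(\<forall>e \<in> arcs (cube_quiver k). P e) \<longleftrightarrow> (\<forall>u \<in> cverts k. \<forall>i < k. P (u, flip u i))"
  unfolding Ball_def[of "arcs _"] cube_arc_iff by blast

lemma quiver_rep_hom_iff: "h \<in> quiver_rep_hom (cube_quiver k) V W \<longleftrightarrow>
    h \<in> extensional (cverts k) \<and>
    (\<forall>v \<in> cverts k. h v \<in> extensional (carrier (rspace V v)) \<and>
      h v \<in> LinearCombinations.module_hom class_ring (rspace V v) (rspace W v)) \<and>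
    (\<forall>u \<in> cverts k. \<forall>i < k. \<forall>x \<in> carrier (rspace V u).
      h (flip u i) (rmap V (u, flip u i) x) = rmap W (u, flip u i) (h u x))"
  unfolding quiver_rep_hom_def mem_Collect_eq PiE_iff[of h] cube_arc_ball cube_simps by auto

lemma vector_hom_iff: "f \<in> LinearCombinations.module_hom (class_ring :: complex ring) U V \<longleftrightarrow>
    (\<forall>x \<in> carrier U. f x \<in> carrier V) \<and>
    (\<forall>x \<in> carrier U. \<forall>y \<in> carrier U. f (x \<oplus>\<^bsub>U\<^esub> y) = f x \<oplus>\<^bsub>V\<^esub> f y) \<and>
    (\<forall>c. \<forall>x \<in> carrier U. f (c \<odot>\<^bsub>U\<^esub> x) = c \<odot>\<^bsub>V\<^esub> f x)"
  by (auto simp: LinearCombinations.module_hom_def)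

lemma cube_rep_cat_category: "category (cube_rep_cat k)"
proof
  fix a b c d :: "(nat \<Rightarrow> int, (nat \<Rightarrow> int) \<times> (nat \<Rightarrow> int), 'b) quiver_rep" and f g h
  let ?C = "cube_rep_cat k :: ((nat \<Rightarrow> int, (nat \<Rightarrow> int) \<times> (nat \<Rightarrow> int), 'b) quiver_rep, _) cat"
  assume a: "a \<in> Obj ?C"
  interpret a: cube_rep k a by (rule cube_obj_cube_rep[OF a])
  have Hom: "Hom ?C = quiver_rep_hom (cube_quiver k)"
    and Idn: "Idn ?C a = (\<lambda>v \<in> cverts k. \<lambda>x \<in> carrier (rspace a v). x)" for a
    by (simp_all add: cube_rep_cat_def)
  have Comp: "Comp ?C a b c g f = (\<lambda>v \<in> cverts k. compose (carrier (rspace a v)) (g v) (f v))" for a b c g f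
    by (simp add: cube_rep_cat_def)
  show "Idn ?C a \<in> Hom ?C a a"
    unfolding Hom Idn quiver_rep_hom_iff vector_hom_iff
    by (simp add: a.sp_closed a.mp_closed flip_cverts)
  show "Comp ?C a a b f (Idn ?C a) = f" "Comp ?C a b b (Idn ?C b) f = f"
    if "f \<in> Hom ?C a b"
  proof -
    have f: "f \<in> extensional (cverts k)"
      "\<And>v. v \<in> cverts k \<Longrightarrow> f v \<in> extensional (carrier (rspace a v))"
      "\<And>v x. v \<in> cverts k \<Longrightarrow> x \<in> carrier (rspace a v) \<Longrightarrow> f v x \<in> carrier (rspace b v)"
      using that unfolding Hom quiver_rep_hom_iff vector_hom_iff by blast+
    show "Comp ?C a a b f (Idn ?C a) = f"
      unfolding Comp Idn
    proof (rule extensionalityI[OF _ f(1)])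
      fix v assume v: "v \<in> cverts k"
      show "(\<lambda>v \<in> cverts k. compose (carrier (rspace a v)) (f v)
          ((\<lambda>v \<in> cverts k. \<lambda>x \<in> carrier (rspace a v). x) v)) v = f v"
        using v by (intro extensionalityI[OF _ f(2)[OF v]]) (simp_all add: compose_def)
    qed simp
    show "Comp ?C a b b (Idn ?C b) f = f"
      unfolding Comp Idn
    proof (rule extensionalityI[OF _ f(1)])
      fix v assume v: "v \<in> cverts k"
      show "(\<lambda>v \<in> cverts k. compose (carrier (rspace a v))
          ((\<lambda>v \<in> cverts k. \<lambda>x \<in> carrier (rspace b v). x) v) (f v)) v = f v"
        using v f(3)[OF v] by (intro extensionalityI[OF _ f(2)[OF v]]) (simp_all add: compose_def)
    qed simp
  qed
  assume f: "f \<in> Hom ?C a b" and g: "g \<in> Hom ?C b c"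
  show "Comp ?C a b c g f \<in> Hom ?C a c"
    using f g unfolding Hom Comp quiver_rep_hom_iff vector_hom_iff
    by (simp add: a.sp_closed a.mp_closed flip_cverts compose_def)
  show "Comp ?C a b d (Comp ?C b c d h g) f = Comp ?C a c d h (Comp ?C a b c g f)"
    using f unfolding Hom Comp quiver_rep_hom_iff vector_hom_iff
    by (simp add: fun_eq_iff compose_def)
qed

section \<open>From weight modules to cube representations\<close>

text \<open>
  The bijection \<open>\<beta>\<close> numbers the integral directions by the coordinates of the cube. The maps \<open>emb\<close>
  place the weight spaces, which are subsets of \<open>'a\<close>, inside the type \<open>'b\<close> of quiver representations.
\<close>

locale weight_cube =
  fixes \<nu> :: "'n::finite \<Rightarrow> complex" and k :: nat and \<beta> :: "nat \<Rightarrow> 'n"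
    and emb :: "('n poly_op, 'a) module \<Rightarrow> ('n \<Rightarrow> complex) \<Rightarrow> 'a \<Rightarrow> 'b"
  assumes \<beta>: "bij_betw \<beta> {..<k} {i. \<nu> i \<in> \<int>}"
    and emb: "M \<in> Obj (weight_cat (weight_coset \<nu>)) \<Longrightarrow> inj_on (emb M \<mu>) (weight_space M \<mu>)"
begin

abbreviation "C \<equiv> weight_cat (weight_coset \<nu>) :: (('n poly_op, 'a) module, 'a \<Rightarrow> 'a) cat"
abbreviation "Q \<equiv> cube_rep_cat k ::
  ((nat \<Rightarrow> int, (nat \<Rightarrow> int) \<times> (nat \<Rightarrow> int), 'b) quiver_rep, (nat \<Rightarrow> int) \<Rightarrow> 'b \<Rightarrow> 'b) cat"

text \<open>
  Vertices of the cube and reference weights: the coordinates \<open>1\<close> and \<open>-1\<close> of a vertex stand for \<open>0\<close> and \<open>-1\<close>.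
\<close>

definition weight_of :: "(nat \<Rightarrow> int) \<Rightarrow> 'n \<Rightarrow> complex" where
  "weight_of v i = (if \<nu> i \<in> \<int> then (if v (inv_into {..<k} \<beta> i) = 1 then 0 else -1) else \<nu> i)"

definition vertex_of :: "('n \<Rightarrow> complex) \<Rightarrow> nat \<Rightarrow> int" where
  "vertex_of \<mu> = (\<lambda>j \<in> {..<k}. if 0 \<le> Re (\<mu> (\<beta> j)) then 1 else -1)"

lemma \<beta>_int: "j < k \<Longrightarrow> \<nu> (\<beta> j) \<in> \<int>"
  using bij_betw_apply[OF \<beta>, of j] by simp

lemma \<beta>_inv: "j < k \<Longrightarrow> inv_into {..<k} \<beta> (\<beta> j) = j"
  using \<beta> by (simp add: bij_betw_inv_into_left)

lemma inv_\<beta>: "\<nu> i \<in> \<int> \<Longrightarrow> inv_into {..<k} \<beta> i < k \<and> \<beta> (inv_into {..<k} \<beta> i) = i"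
  using bij_betw_inv_into_right[OF \<beta>, of i] bij_betw_apply[OF bij_betw_inv_into[OF \<beta>], of i] by simp

lemma weight_of_\<beta>: "j < k \<Longrightarrow> weight_of v (\<beta> j) = (if v j = 1 then 0 else -1)"
  by (simp add: weight_of_def \<beta>_int \<beta>_inv)

lemma weight_of_coset: "weight_of v \<in> weight_coset \<nu>"
  by (auto simp: weight_of_def weight_coset_def)

lemma vertex_of_cverts: "vertex_of \<mu> \<in> cverts k"
  by (auto simp: vertex_of_def)

lemma weight_of_vertex_of: "weight_of (vertex_of \<mu>) = ref_weight \<nu> \<mu>"
  using inv_\<beta> by (auto simp: weight_of_def vertex_of_def ref_weight_def fun_eq_iff)

lemma ref_weight_weight_of: "ref_weight \<nu> (weight_of v) = weight_of v"
  by (auto simp: ref_weight_def weight_of_def fun_eq_iff)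

lemma vertex_of_weight_of: assumes "v \<in> cverts k" shows "vertex_of (weight_of v) = v"
proof
  fix j
  show "vertex_of (weight_of v) j = v j"
    using cvert_nz[OF assms, of j] PiE_arb[OF assms, of j] by (cases "j < k") (auto simp: vertex_of_def weight_of_\<beta>)
qed

lemma weight_of_flip: assumes "v \<in> cverts k" "j < k"
  shows "v j = -1 \<Longrightarrow> weight_of (flip v j) = shift (\<beta> j) 1 (weight_of v)"
    and "v j = 1 \<Longrightarrow> weight_of (flip v j) = shift (\<beta> j) (-1) (weight_of v)"
proof -
  have o: "weight_of (flip v j) i = weight_of v i" if "i \<noteq> \<beta> j" for i
    using that inv_\<beta>[of i] by (auto simp: weight_of_def flip_def)
  show "v j = -1 \<Longrightarrow> weight_of (flip v j) = shift (\<beta> j) 1 (weight_of v)"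
    "v j = 1 \<Longrightarrow> weight_of (flip v j) = shift (\<beta> j) (-1) (weight_of v)"
    using o assms(2) by (auto simp: fun_eq_iff shift_def weight_of_\<beta>)
qed

text \<open>
  The generator that crosses the wall along an arc of the cube.
\<close>

definition arc_op :: "(nat \<Rightarrow> int) \<Rightarrow> (nat \<Rightarrow> int) \<Rightarrow> 'n poly_op" where
  "arc_op u v = (let j = THE j. j < k \<and> u j \<noteq> v j in if u j = -1 then t_op (\<beta> j) else d_op (\<beta> j))"

lemma arc_op: assumes "u \<in> cverts k" "j < k"
  shows "arc_op u (flip u j) = (if u j = -1 then t_op (\<beta> j) else d_op (\<beta> j))"
proof -
  have "(THE i. i < k \<and> u i \<noteq> flip u j i) = j"
  proof (rule the_equality)
    show "j < k \<and> u j \<noteq> flip u j j" using assms(2) cvert_nz[OF assms] by (elim disjE) simp_all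
    show "i = j" if "i < k \<and> u i \<noteq> flip u j i" for i
      by (rule ccontr) (use that flip_simps(2)[of j i u] in simp)
  qed
  then show ?thesis by (simp add: arc_op_def Let_def)
qed

definition prj where "prj M \<mu> = inv_into (weight_space M \<mu>) (emb M \<mu>)"

definition Fsp where "Fsp M v = transport (emb M (weight_of v)) (prj M (weight_of v)) (weight_vs M (weight_of v))"

definition Fmp where "Fmp M e y = emb M (weight_of (snd e)) (arc_op (fst e) (snd e) \<odot>\<^bsub>M\<^esub> prj M (weight_of (fst e)) y)"

definition Fob :: "('n poly_op, 'a) module \<Rightarrow> (nat \<Rightarrow> int, (nat \<Rightarrow> int) \<times> (nat \<Rightarrow> int), 'b) quiver_rep" where
  "Fob M = \<lparr>rspace = Fsp M, rmap = Fmp M\<rparr>"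

definition Fhom where
  "Fhom M N h = (\<lambda>v \<in> cverts k. \<lambda>y \<in> carrier (Fsp M v). emb N (weight_of v) (h (prj M (weight_of v) y)))"

lemma prj_emb: "M \<in> Obj C \<Longrightarrow> x \<in> weight_space M \<mu> \<Longrightarrow> prj M \<mu> (emb M \<mu> x) = x"
  unfolding prj_def by (rule inv_into_f_f[OF emb])

lemma Fsp_simps: "carrier (Fsp M v) = emb M (weight_of v) ` weight_space M (weight_of v)"
    "x \<oplus>\<^bsub>Fsp M v\<^esub> y = emb M (weight_of v) (prj M (weight_of v) x \<oplus>\<^bsub>M\<^esub> prj M (weight_of v) y)"
    "c \<odot>\<^bsub>Fsp M v\<^esub> x = emb M (weight_of v) (scalar_op c \<odot>\<^bsub>M\<^esub> prj M (weight_of v) x)"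
    "\<zero>\<^bsub>Fsp M v\<^esub> = emb M (weight_of v) \<zero>\<^bsub>M\<^esub>"
  by (simp_all add: Fsp_def transport_def weight_vs_def)

lemma Fob_simps: "rspace (Fob M) = Fsp M" "rmap (Fob M) = Fmp M"
  by (simp_all add: Fob_def)

context
  fixes M assumes M: "M \<in> Obj C"
begin

interpretation M: wt_module M by (rule weight_obj_wt_module[OF M])

lemma arc_op_W:
  assumes "u \<in> cverts k" "j < k" "x \<in> M.W (weight_of u)"
  shows "arc_op u (flip u j) \<odot>\<^bsub>M\<^esub> x \<in> M.W (weight_of (flip u j))"
  using M.W_T[OF assms(3), of "\<beta> j"] M.W_D[OF assms(3), of "\<beta> j"] cvert_nz[OF assms(1,2)] weight_of_flip[OF assms(1,2)]
  by (auto simp: arc_op[OF assms(1,2)])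

lemma arc_op_weyl: "u \<in> cverts k \<Longrightarrow> j < k \<Longrightarrow> arc_op u (flip u j) \<in> weyl_ops"
  by (simp add: arc_op weyl_ops.t weyl_ops.d)

lemma Fmp_emb: "u \<in> cverts k \<Longrightarrow> j < k \<Longrightarrow> x \<in> M.W (weight_of u) \<Longrightarrow>
    Fmp M (u, flip u j) (emb M (weight_of u) x) = emb M (weight_of (flip u j)) (arc_op u (flip u j) \<odot>\<^bsub>M\<^esub> x)"
  by (simp add: Fmp_def prj_emb[OF M])

lemma Fsp_transporting: "transporting (emb M (weight_of v)) (prj M (weight_of v)) (weight_vs M (weight_of v))"
  by unfold_locales (simp add: weight_vs_def prj_emb[OF M])

lemma Fsp_vectorspace: "vectorspace class_ring (Fsp M v)"
  unfolding Fsp_def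
  by (rule transporting.transport_vectorspace[OF Fsp_transporting M.weight_vs_vectorspace])

lemma Fsp_fin_dim: "vectorspace.fin_dim class_ring (Fsp M v)"
  unfolding Fsp_def
  by (rule transporting.transport_fin_dim[OF Fsp_transporting M.weight_vs_vectorspace])
    (use M in \<open>simp add: weight_cat_def fin_weight_modules_def\<close>)

lemma Fob_cube_rep: "cube_rep k (Fob M)"
proof
  show "fin_quiver_rep (cube_quiver k) (Fob M)"
    unfolding fin_quiver_rep_def
  proof (intro conjI ballI)
    fix e assume "e \<in> arcs (cube_quiver k)"
    then obtain u i where e: "e = (u, flip u i)" and u: "u \<in> cverts k" "i < k"
      by (auto simp: cube_arc_iff)
    interpret U: vectorspace "class_ring :: complex ring" "Fsp M u" by (rule Fsp_vectorspace)
    interpret V: vectorspace "class_ring :: complex ring" "Fsp M (flip u i)" by (rule Fsp_vectorspace)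
    have "linear_map class_ring (Fsp M u) (Fsp M (flip u i)) (Fmp M e)"
    proof
      show "Fmp M e \<in> LinearCombinations.module_hom class_ring (Fsp M u) (Fsp M (flip u i))"
        unfolding vector_hom_iff e Fsp_simps ball_simps
        using arc_op_W[OF u] arc_op_weyl[OF u]
        by (simp add: Fmp_emb[OF u] prj_emb[OF M] M.W_add M.W_S M.op_add M.W_carrier
            M.op_eq[OF _ weyl_ops.scalar weyl_ops.scalar] op_scalar)
    qed
    then show "linear_map class_ring (rspace (Fob M) (tail (cube_quiver k) e))
        (rspace (Fob M) (head (cube_quiver k) e)) (rmap (Fob M) e)"
      by (simp add: Fob_simps e)
  qed (simp_all add: Fob_simps Fsp_vectorspace Fsp_fin_dim)
qed

lemma Fob_Obj: "Fob M \<in> Obj Q"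
proof -
  interpret V: cube_rep k "Fob M" by (rule Fob_cube_rep)
  have "V.square_relations"
    unfolding V.square_relations_def Fob_simps Fsp_simps ball_simps
  proof (intro ballI allI impI conjI)
    fix u x i assume u: "u \<in> cverts k" and x: "x \<in> M.W (weight_of u)" and i: "i < k"
    note fu = flip_cverts[OF u i] and ax = arc_op_W[OF u i x]
    have wi: "weight_of u (\<beta> i) = (if u i = 1 then 0 else -1)" by (rule weight_of_\<beta>[OF i])
    have "arc_op (flip u i) u \<odot>\<^bsub>M\<^esub> (arc_op u (flip u i) \<odot>\<^bsub>M\<^esub> x) = \<zero>\<^bsub>M\<^esub>"
      using cvert_nz[OF u i] arc_op[OF u i] arc_op[OF fu i] M.TD[OF x, of "\<beta> i"] M.DT[OF x, of "\<beta> i"] wi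
      by (auto simp: M.S_0 M.W_carrier[OF x])
    then show "Fmp M (flip u i, flip (flip u i) i) (Fmp M (u, flip u i) (emb M (weight_of u) x)) = emb M (weight_of u) \<zero>\<^bsub>M\<^esub>"
      using Fmp_emb[OF u i x] Fmp_emb[OF fu i ax] by simp
    fix j assume j: "j < k" "i \<noteq> j"
    note fj = flip_cverts[OF u j(1)] and ay = arc_op_W[OF u j(1) x]
    have bij: "\<beta> i \<noteq> \<beta> j" using j i \<beta>_inv by metis
    have "arc_op (flip u i) (flip (flip u i) j) \<odot>\<^bsub>M\<^esub> (arc_op u (flip u i) \<odot>\<^bsub>M\<^esub> x)
        = arc_op (flip u j) (flip (flip u j) i) \<odot>\<^bsub>M\<^esub> (arc_op u (flip u j) \<odot>\<^bsub>M\<^esub> x)"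
      by (rule M.op_eq) (use bij j in \<open>auto simp: arc_op[OF u i] arc_op[OF u j(1)] arc_op[OF fu j(1)] arc_op[OF fj i]
          weyl_ops.t weyl_ops.d M.W_carrier[OF x] t_t_op d_d_op d_t_op\<close>)
    then show "Fmp M (flip u i, flip (flip u i) j) (Fmp M (u, flip u i) (emb M (weight_of u) x))
        = Fmp M (flip u j, flip (flip u j) i) (Fmp M (u, flip u j) (emb M (weight_of u) x))"
      using Fmp_emb[OF u i x] Fmp_emb[OF fu j(1) ax] Fmp_emb[OF u j(1) x] Fmp_emb[OF fj i ay]
      by (simp add: flip_commute[of u i j])
  qed
  then show ?thesis
    using V.cube_relations_iff V.fin_rep by (simp add: cube_rep_cat_def)
qed

end

lemma Chom_iff: "h \<in> Hom C M N \<longleftrightarrow>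
    h \<in> LinearCombinations.module_hom weyl_algebra M N \<and> h \<in> extensional (carrier M)"
  by (simp add: weight_cat_def)

lemma Qhom_iff: "Hom Q = quiver_rep_hom (cube_quiver k)"
  by (simp add: cube_rep_cat_def)

lemma Fhom_emb: "M \<in> Obj C \<Longrightarrow> v \<in> cverts k \<Longrightarrow> x \<in> weight_space M (weight_of v) \<Longrightarrow>
    Fhom M N h v (emb M (weight_of v) x) = emb N (weight_of v) (h x)"
  by (simp add: Fhom_def Fsp_simps prj_emb)

lemma obj_pair: "M \<in> Obj C \<Longrightarrow> N \<in> Obj C \<Longrightarrow> wt_pair M N"
  by (simp add: wt_pair_def weight_obj_wt_module)

lemma Fhom_Hom:
  assumes M: "M \<in> Obj C" and N: "N \<in> Obj C" and h: "h \<in> Hom C M N"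
  shows "Fhom M N h \<in> Hom Q (Fob M) (Fob N)"
proof -
  interpret wt_pair M N by (rule obj_pair[OF M N])
  from h have h: "h \<in> LinearCombinations.module_hom weyl_algebra M N" by (simp add: Chom_iff)
  note hW = hom_W[OF h]
  show ?thesis
    unfolding Qhom_iff quiver_rep_hom_iff vector_hom_iff Fob_simps Fsp_simps ball_simps
  proof (intro conjI ballI allI impI)
    show "Fhom M N h \<in> extensional (cverts k)" by (simp add: Fhom_def)
    fix v assume v: "v \<in> cverts k"
    show "Fhom M N h v \<in> extensional (emb M (weight_of v) ` M.W (weight_of v))"
      using v by (simp add: Fhom_def Fsp_simps)
    fix x assume x: "x \<in> M.W (weight_of v)"
    note E = Fhom_emb[OF M v]
    show "Fhom M N h v (emb M (weight_of v) x) \<in> emb N (weight_of v) ` N.W (weight_of v)"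
      using hW[OF x] by (simp add: E[OF x])
    show "Fhom M N h v (emb M (weight_of v) (prj M (weight_of v) (emb M (weight_of v) x) \<oplus>\<^bsub>M\<^esub> prj M (weight_of v) (emb M (weight_of v) y)))
        = emb N (weight_of v) (prj N (weight_of v) (Fhom M N h v (emb M (weight_of v) x)) \<oplus>\<^bsub>N\<^esub>
          prj N (weight_of v) (Fhom M N h v (emb M (weight_of v) y)))" if y: "y \<in> M.W (weight_of v)" for y
      using x y M.W_add[OF x y] hW
      by (simp add: E prj_emb[OF M] prj_emb[OF N] hom_add[OF h] M.W_carrier)
    show "Fhom M N h v (emb M (weight_of v) (M.S c (prj M (weight_of v) (emb M (weight_of v) x))))
        = emb N (weight_of v) (N.S c (prj N (weight_of v) (Fhom M N h v (emb M (weight_of v) x))))" for c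
      using x M.W_S[OF x] hW
      by (simp add: E prj_emb[OF M] prj_emb[OF N] hom_op[OF h weyl_ops.scalar] M.W_carrier)
    fix i assume i: "i < k"
    show "Fhom M N h (flip v i) (Fmp M (v, flip v i) (emb M (weight_of v) x))
        = Fmp N (v, flip v i) (Fhom M N h v (emb M (weight_of v) x))"
      using Fmp_emb[OF M v i x] Fmp_emb[OF N v i hW[OF x]] arc_op_W[OF M v i x] flip_cverts[OF v i]
      by (simp add: E[OF x] Fhom_emb[OF M] hom_op[OF h arc_op_weyl[OF M v i]] M.W_carrier[OF x])
  qed
qed

lemma Fhom_faithful:
  assumes M: "M \<in> Obj C" and N: "N \<in> Obj C" and h: "h \<in> Hom C M N" and h': "h' \<in> Hom C M N"
    and eq: "Fhom M N h = Fhom M N h'"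
  shows "h = h'"
proof -
  interpret wt_pair M N by (rule obj_pair[OF M N])
  from h h' have H: "h \<in> LinearCombinations.module_hom weyl_algebra M N"
    "h' \<in> LinearCombinations.module_hom weyl_algebra M N"
    and ext: "h \<in> extensional (carrier M)" "h' \<in> extensional (carrier M)" by (simp_all add: Chom_iff)
  have supp: "weight_supp M \<subseteq> weight_coset \<nu>" using M by (simp add: weight_cat_def)
  show ?thesis
  proof (rule extensionalityI[OF ext hom_eq_from_references[OF H supp]])
    fix \<mu> x assume "x \<in> M.W (ref_weight \<nu> \<mu>)"
    then have x: "x \<in> M.W (weight_of (vertex_of \<mu>))" by (simp add: weight_of_vertex_of)
    have "emb N (weight_of (vertex_of \<mu>)) (h x) = emb N (weight_of (vertex_of \<mu>)) (h' x)"
      using Fhom_emb[OF M vertex_of_cverts x] eq by metis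
    then show "h x = h' x"
      using hom_W[OF H(1) x] hom_W[OF H(2) x] inj_onD[OF emb[OF N]] by blast
  qed
qed

text \<open>
  A morphism of representations is pulled back along \<open>emb\<close> to maps \<open>g v\<close> between the weight spaces at the
  reference weights. Compatibility with the arcs is compatibility with the generators across the walls, so these maps extend.
\<close>

lemma Fhom_full:
  assumes M: "M \<in> Obj C" and N: "N \<in> Obj C" and G: "G \<in> Hom Q (Fob M) (Fob N)"
  shows "\<exists>h \<in> Hom C M N. Fhom M N h = G"
proof -
  interpret wt_pair M N by (rule obj_pair[OF M N])
  have supp: "weight_supp M \<subseteq> weight_coset \<nu>" using M by (simp add: weight_cat_def)
  note G' = G[unfolded Qhom_iff quiver_rep_hom_iff vector_hom_iff Fob_simps Fsp_simps ball_simps]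
  \<comment> \<open>\<open>G v\<close> as a map between weight spaces\<close>
  define g where "g v x = prj N (weight_of v) (G v (emb M (weight_of v) x))" for v x
  have gG: "g v x \<in> N.W (weight_of v) \<and> G v (emb M (weight_of v) x) = emb N (weight_of v) (g v x)"
    if v: "v \<in> cverts k" and x: "x \<in> M.W (weight_of v)" for v x
  proof -
    have "G v (emb M (weight_of v) x) \<in> emb N (weight_of v) ` N.W (weight_of v)" using G' v x by blast
    then obtain y where "y \<in> N.W (weight_of v)" "G v (emb M (weight_of v) x) = emb N (weight_of v) y" by blast
    then show ?thesis by (simp add: g_def prj_emb[OF N])
  qed
  have g_inj: "y = z" if "emb N (weight_of v) y = emb N (weight_of v) z" "y \<in> N.W (weight_of v)" "z \<in> N.W (weight_of v)" for v y z
    using inj_onD[OF emb[OF N] that] .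
  have g_add: "g v (x \<oplus>\<^bsub>M\<^esub> y) = g v x \<oplus>\<^bsub>N\<^esub> g v y"
    if v: "v \<in> cverts k" and x: "x \<in> M.W (weight_of v)" and y: "y \<in> M.W (weight_of v)" for v x y
  proof (rule g_inj[of v])
    have "G v (emb M (weight_of v) (prj M (weight_of v) (emb M (weight_of v) x) \<oplus>\<^bsub>M\<^esub> prj M (weight_of v) (emb M (weight_of v) y)))
        = emb N (weight_of v) (prj N (weight_of v) (G v (emb M (weight_of v) x)) \<oplus>\<^bsub>N\<^esub> prj N (weight_of v) (G v (emb M (weight_of v) y)))"
      using G' v x y by blast
    then show "emb N (weight_of v) (g v (x \<oplus>\<^bsub>M\<^esub> y)) = emb N (weight_of v) (g v x \<oplus>\<^bsub>N\<^esub> g v y)"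
      using gG[OF v M.W_add[OF x y]] gG[OF v x] gG[OF v y] x y by (simp add: prj_emb[OF M] prj_emb[OF N])
  qed (use gG[OF v M.W_add[OF x y]] gG[OF v x] gG[OF v y] in \<open>simp_all add: N.W_add\<close>)
  have g_S: "g v (M.S c x) = N.S c (g v x)"
    if v: "v \<in> cverts k" and x: "x \<in> M.W (weight_of v)" for v x c
  proof (rule g_inj[of v])
    have "G v (emb M (weight_of v) (M.S c (prj M (weight_of v) (emb M (weight_of v) x))))
        = emb N (weight_of v) (N.S c (prj N (weight_of v) (G v (emb M (weight_of v) x))))"
      using G' v x by blast
    then show "emb N (weight_of v) (g v (M.S c x)) = emb N (weight_of v) (N.S c (g v x))"
      using gG[OF v M.W_S[OF x, of c]] gG[OF v x] x by (simp add: prj_emb[OF M] prj_emb[OF N])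
  qed (use gG[OF v M.W_S[OF x, of c]] gG[OF v x] in \<open>simp_all add: N.W_S\<close>)
  have g_arc: "g (flip v i) (arc_op v (flip v i) \<odot>\<^bsub>M\<^esub> x) = arc_op v (flip v i) \<odot>\<^bsub>N\<^esub> g v x"
    if v: "v \<in> cverts k" and i: "i < k" and x: "x \<in> M.W (weight_of v)" for v i x
  proof (rule g_inj[of "flip v i"])
    note fv = flip_cverts[OF v i] and ax = arc_op_W[OF M v i x]
    note gx = gG[OF v x] and gax = gG[OF fv ax]
    have "G (flip v i) (Fmp M (v, flip v i) (emb M (weight_of v) x)) = Fmp N (v, flip v i) (G v (emb M (weight_of v) x))"
      using G' v i x by blast
    then show "emb N (weight_of (flip v i)) (g (flip v i) (arc_op v (flip v i) \<odot>\<^bsub>M\<^esub> x))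
        = emb N (weight_of (flip v i)) (arc_op v (flip v i) \<odot>\<^bsub>N\<^esub> g v x)"
      using gx gax by (simp add: Fmp_emb[OF M v i x] Fmp_emb[OF N v i])
    show "g (flip v i) (arc_op v (flip v i) \<odot>\<^bsub>M\<^esub> x) \<in> N.W (weight_of (flip v i))"
      "arc_op v (flip v i) \<odot>\<^bsub>N\<^esub> g v x \<in> N.W (weight_of (flip v i))"
      using gax gx arc_op_W[OF N v i] by blast+
  qed
  have ref: "weight_of (vertex_of \<mu>) = \<mu>" if "ref_weight \<nu> \<mu> = \<mu>" for \<mu> using that by (simp add: weight_of_vertex_of)
  have crossing: "\<exists>j < k. \<beta> j = i \<and> vertex_of \<mu> j = -1 \<and> weight_of (flip (vertex_of \<mu>) j) = shift i 1 \<mu>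
      \<and> vertex_of (shift i 1 \<mu>) = flip (vertex_of \<mu>) j"
    if c: "\<mu> \<in> weight_coset \<nu>" and r: "ref_weight \<nu> \<mu> = \<mu>" and m: "\<mu> i = -1" for \<mu> i
  proof -
    have "\<nu> i \<in> \<int>" using coset_Ints[OF c, of i] m by simp
    then obtain j where j: "j < k" "\<beta> j = i" using inv_\<beta> by blast
    have v: "vertex_of \<mu> j = -1" using j m by (simp add: vertex_of_def)
    have w: "weight_of (flip (vertex_of \<mu>) j) = shift i 1 \<mu>"
      using weight_of_flip(1)[OF vertex_of_cverts j(1) v] j(2) ref[OF r] by simp
    have "vertex_of (shift i 1 \<mu>) = flip (vertex_of \<mu>) j"
      unfolding w[symmetric] by (rule vertex_of_weight_of[OF flip_cverts[OF vertex_of_cverts j(1)]])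
    with j v w show ?thesis by blast
  qed
  obtain H :: "'a \<Rightarrow> 'a" where H: "H \<in> LinearCombinations.module_hom weyl_algebra M N"
    and Hg: "\<And>\<mu> x. \<mu> \<in> weight_coset \<nu> \<Longrightarrow> ref_weight \<nu> \<mu> = \<mu> \<Longrightarrow> x \<in> M.W \<mu> \<Longrightarrow> H x = g (vertex_of \<mu>) x"
  proof (rule extend_from_references[OF supp, of "\<lambda>\<mu>. g (vertex_of \<mu>)"])
    fix \<mu> x y c i assume c: "\<mu> \<in> weight_coset \<nu>" and r: "ref_weight \<nu> \<mu> = \<mu>"
    note vx = vertex_of_cverts[of \<mu>]
    show "g (vertex_of \<mu>) x \<in> N.W \<mu>" if "x \<in> M.W \<mu>"
      using gG[OF vx, of x] that by (simp add: ref[OF r])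
    show "g (vertex_of \<mu>) (x \<oplus>\<^bsub>M\<^esub> y) = g (vertex_of \<mu>) x \<oplus>\<^bsub>N\<^esub> g (vertex_of \<mu>) y" if "x \<in> M.W \<mu>" "y \<in> M.W \<mu>"
      using g_add[OF vx, of x y] that by (simp add: ref[OF r])
    show "g (vertex_of \<mu>) (M.S c x) = N.S c (g (vertex_of \<mu>) x)" if "x \<in> M.W \<mu>"
      using g_S[OF vx, of x c] that by (simp add: ref[OF r])
    assume m: "\<mu> i = -1"
    from crossing[OF c r m] obtain j where j: "j < k" "\<beta> j = i" "vertex_of \<mu> j = -1"
      "weight_of (flip (vertex_of \<mu>) j) = shift i 1 \<mu>" "vertex_of (shift i 1 \<mu>) = flip (vertex_of \<mu>) j" by blast
    note fv = flip_cverts[OF vx j(1)]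
    have a1: "arc_op (vertex_of \<mu>) (flip (vertex_of \<mu>) j) = t_op i" using arc_op[OF vx j(1)] j by simp
    have a2: "arc_op (flip (vertex_of \<mu>) j) (vertex_of \<mu>) = d_op i" using arc_op[OF fv j(1)] j by simp
    show "g (vertex_of (shift i 1 \<mu>)) (M.T i x) = N.T i (g (vertex_of \<mu>) x)" if "x \<in> M.W \<mu>"
      using g_arc[OF vx j(1), of x] that by (simp add: ref[OF r] j(5) a1)
    show "g (vertex_of \<mu>) (M.D i x) = N.D i (g (vertex_of (shift i 1 \<mu>)) x)" if "x \<in> M.W (shift i 1 \<mu>)"
      using g_arc[OF fv j(1), of x] that by (simp add: j(4,5) a2)
  next
    fix H :: "'a \<Rightarrow> 'a"
    assume "H \<in> LinearCombinations.module_hom weyl_algebra M N"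
      "\<And>\<mu> x. \<mu> \<in> weight_coset \<nu> \<Longrightarrow> ref_weight \<nu> \<mu> = \<mu> \<Longrightarrow> x \<in> M.W \<mu> \<Longrightarrow> H x = g (vertex_of \<mu>) x"
    then show thesis by (rule that)
  qed
  let ?h = "restrict H (carrier M)"
  have h: "?h \<in> Hom C M N"
    using H unfolding Chom_iff hom_iff by (simp add: M.op_closed)
  moreover have "Fhom M N ?h = G"
  proof (rule extensionalityI)
    fix v assume v: "v \<in> cverts k"
    show "Fhom M N ?h v = G v"
    proof (rule extensionalityI)
      fix y assume "y \<in> emb M (weight_of v) ` M.W (weight_of v)"
      then obtain x where x: "x \<in> M.W (weight_of v)" "y = emb M (weight_of v) x" by blast
      show "Fhom M N ?h v y = G v y"
        using Hg[OF weight_of_coset ref_weight_weight_of x(1)] gG[OF v x(1)] Fhom_emb[OF M v x(1)] M.W_carrier[OF x(1)]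
        by (simp add: x(2) vertex_of_weight_of[OF v])
    qed (use v G' in \<open>simp_all add: Fhom_def Fsp_simps\<close>)
  qed (use G' in \<open>simp_all add: Fhom_def\<close>)
  ultimately show ?thesis by blast
qed

definition F where "F = \<lparr>fobj = Fob, fmap = Fhom\<rparr>"

lemma F_functor: "is_functor C Q F"
  unfolding is_functor_def F_def cfunctor.simps
proof (intro conjI ballI)
  fix M assume M: "M \<in> Obj C"
  interpret M: wt_module M by (rule weight_obj_wt_module[OF M])
  show "Fob M \<in> Obj Q" by (rule Fob_Obj[OF M])
  show "Fhom M M (Idn C M) = Idn Q (Fob M)"
  proof (rule extensionalityI)
    fix v assume v: "v \<in> cverts k"
    show "Fhom M M (Idn C M) v = Idn Q (Fob M) v"
    proof (rule extensionalityI)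
      fix y assume "y \<in> emb M (weight_of v) ` M.W (weight_of v)"
      then obtain x where x: "x \<in> M.W (weight_of v)" "y = emb M (weight_of v) x" by blast
      then show "Fhom M M (Idn C M) v y = Idn Q (Fob M) v y"
        using v M.W_carrier[OF x(1)]
        by (simp add: Fhom_emb[OF M v x(1)] weight_cat_def cube_rep_cat_def Fob_simps Fsp_simps)
    qed (use v in \<open>simp_all add: Fhom_def cube_rep_cat_def Fob_simps Fsp_simps\<close>)
  qed (simp_all add: Fhom_def cube_rep_cat_def)
next
  fix L M N f g
  assume L: "L \<in> Obj C" and M: "M \<in> Obj C" and N: "N \<in> Obj C"
    and f: "f \<in> Hom C L M" and g: "g \<in> Hom C M N"
  interpret LM: wt_pair L M by (rule obj_pair[OF L M])
  have fh: "f \<in> LinearCombinations.module_hom weyl_algebra L M" using f by (simp add: Chom_iff)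
  show "Fhom L N (Comp C L M N g f) = Comp Q (Fob L) (Fob M) (Fob N) (Fhom M N g) (Fhom L M f)"
  proof (rule extensionalityI)
    fix v assume v: "v \<in> cverts k"
    show "Fhom L N (Comp C L M N g f) v = Comp Q (Fob L) (Fob M) (Fob N) (Fhom M N g) (Fhom L M f) v"
    proof (rule extensionalityI)
      fix y assume "y \<in> emb L (weight_of v) ` LM.M.W (weight_of v)"
      then obtain x where x: "x \<in> LM.M.W (weight_of v)" "y = emb L (weight_of v) x" by blast
      then show "Fhom L N (Comp C L M N g f) v y
          = Comp Q (Fob L) (Fob M) (Fob N) (Fhom M N g) (Fhom L M f) v y"
        using v LM.M.W_carrier[OF x(1)] LM.hom_W[OF fh x(1)]
        by (simp add: Fhom_emb[OF L v x(1)] Fhom_emb[OF M v] weight_cat_def cube_rep_cat_def Fob_simps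
            Fsp_simps compose_def)
    qed (use v in \<open>simp_all add: Fhom_def cube_rep_cat_def Fob_simps Fsp_simps\<close>)
  qed (simp_all add: Fhom_def cube_rep_cat_def)
qed (simp_all add: Fhom_Hom)

end

section \<open>The module of sections of a cube representation\<close>

lemma lepoll_card_of: "A \<lesssim> B \<longleftrightarrow> (card_of A, card_of B) \<in> ordLeq"
  unfolding lepoll_def by (rule card_of_ordLeq)

lemma Q_isoI:
  fixes U V :: "(nat \<Rightarrow> int, (nat \<Rightarrow> int) \<times> (nat \<Rightarrow> int), 'b) quiver_rep"
  assumes U: "cube_rep k U" and H: "H \<in> Hom (cube_rep_cat k) U V"
    and bij: "\<And>v. v \<in> cverts k \<Longrightarrow> bij_betw (H v) (carrier (rspace U v)) (carrier (rspace V v))"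
  shows "is_iso (cube_rep_cat k) U V H"
proof -
  interpret U: cube_rep k U by fact
  have Hom: "Hom (cube_rep_cat k) = quiver_rep_hom (cube_quiver k)"
    by (simp add: cube_rep_cat_def)
  note H' = H[unfolded Hom quiver_rep_hom_iff vector_hom_iff]
  define G where "G = (\<lambda>v \<in> cverts k. \<lambda>y \<in> carrier (rspace V v). inv_into (carrier (rspace U v)) (H v) y)"
  have HG: "\<exists>x \<in> carrier (rspace U v). y = H v x \<and> G v y = x"
    if v: "v \<in> cverts k" and y: "y \<in> carrier (rspace V v)" for v y
  proof -
    from bij_betw_imp_surj_on[OF bij[OF v]] y obtain x where x: "x \<in> carrier (rspace U v)" "y = H v x" by blast
    then show ?thesis using v y bij_betw_inv_into_left[OF bij[OF v] x(1)] by (auto simp: G_def)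
  qed
  have GH: "G v (H v x) = x" if v: "v \<in> cverts k" and x: "x \<in> carrier (rspace U v)" for v x
    using v bij_betw_inv_into_left[OF bij[OF v] x] bij_betw_apply[OF bij[OF v] x] by (simp add: G_def)
  have "G \<in> Hom (cube_rep_cat k) V U"
    unfolding Hom quiver_rep_hom_iff vector_hom_iff
  proof (intro conjI ballI allI impI)
    show "G \<in> extensional (cverts k)" by (simp add: G_def)
    fix v assume v: "v \<in> cverts k"
    show "G v \<in> extensional (carrier (rspace V v))" using v by (simp add: G_def)
    fix y assume y: "y \<in> carrier (rspace V v)"
    from HG[OF v y] obtain x where x: "x \<in> carrier (rspace U v)" "y = H v x" "G v y = x" by blast
    show "G v y \<in> carrier (rspace U v)" using x by simp
    show "G v (y \<oplus>\<^bsub>rspace V v\<^esub> z) = G v y \<oplus>\<^bsub>rspace U v\<^esub> G v z" if z: "z \<in> carrier (rspace V v)" for z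
    proof -
      from HG[OF v z] obtain w where w: "w \<in> carrier (rspace U v)" "z = H v w" "G v z = w" by blast
      have "y \<oplus>\<^bsub>rspace V v\<^esub> z = H v (x \<oplus>\<^bsub>rspace U v\<^esub> w)" using H' v x w by simp
      then show ?thesis using GH[OF v U.sp_closed(1)[OF v x(1) w(1)]] x w by simp
    qed
    show "G v (c \<odot>\<^bsub>rspace V v\<^esub> y) = c \<odot>\<^bsub>rspace U v\<^esub> G v y" for c
    proof -
      have "c \<odot>\<^bsub>rspace V v\<^esub> y = H v (c \<odot>\<^bsub>rspace U v\<^esub> x)" using H' v x by simp
      then show ?thesis using GH[OF v U.sp_closed(2)[OF v x(1)]] x by simp
    qed
    fix i assume i: "i < k"
    have "rmap V (v, flip v i) y = H (flip v i) (rmap U (v, flip v i) x)" using H' v i x by simp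
    then show "G (flip v i) (rmap V (v, flip v i) y) = rmap U (v, flip v i) (G v y)"
      using GH[OF flip_cverts[OF v i] U.mp_closed[OF v i x(1)]] x by simp
  qed
  moreover have "Comp (cube_rep_cat k) U V U G H = Idn (cube_rep_cat k) U"
    by (simp add: cube_rep_cat_def compose_def GH cong: restrict_cong)
  moreover have "Comp (cube_rep_cat k) V U V H G = Idn (cube_rep_cat k) V"
  proof -
    have "H v (G v y) = y" if "v \<in> cverts k" "y \<in> carrier (rspace V v)" for v y
      using HG[OF that] by auto
    then show ?thesis by (simp add: cube_rep_cat_def compose_def cong: restrict_cong)
  qed
  ultimately show ?thesis using H unfolding is_iso_def by blast
qed

lemma shift_commute: "i \<noteq> j \<Longrightarrow> shift i a (shift j b \<mu>) = shift j b (shift i a \<mu>)"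
  by (auto simp: shift_def fun_eq_iff)

text \<open>
  The space over a weight \<open>\<mu>\<close> is the space of \<open>V\<close> at the vertex of its chamber. It is defined for
  every \<open>\<mu>\<close>, but sections are supported in the coset.
\<close>

locale cube_sections = weight_cube \<nu> k \<beta> emb + cube_rep k V
  for \<nu> :: "'n::finite \<Rightarrow> complex" and k :: nat and \<beta> :: "nat \<Rightarrow> 'n"
    and emb :: "('n poly_op, 'a) module \<Rightarrow> ('n \<Rightarrow> complex) \<Rightarrow> 'a \<Rightarrow> 'b"
    and V :: "(nat \<Rightarrow> int, (nat \<Rightarrow> int) \<times> (nat \<Rightarrow> int), 'b) quiver_rep" +
  assumes squares: "square_relations"
begin

definition axis :: "'n \<Rightarrow> nat" where "axis i = inv_into {..<k} \<beta> i"

abbreviation B :: "('n \<Rightarrow> complex) \<Rightarrow> (complex, 'b) module" where "B \<mu> \<equiv> sp (vertex_of \<mu>)"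

abbreviation fib :: "('n \<Rightarrow> complex) \<Rightarrow> 'b set" where "fib \<mu> \<equiv> carrier (B \<mu>)"

abbreviation Z :: "('n \<Rightarrow> complex) \<Rightarrow> 'b" where "Z \<mu> \<equiv> zero (B \<mu>)"

abbreviation coset :: "('n \<Rightarrow> complex) set" where "coset \<equiv> weight_coset \<nu>"

lemma B_vs: "vectorspace class_ring (B \<mu>)"
  by (rule vs[OF vertex_of_cverts])

lemma B_rules:
  shows B_ab: "abelian_group (B \<mu>)"
    and B_zero: "Z \<mu> \<in> fib \<mu>"
    and B_add: "x \<in> fib \<mu> \<Longrightarrow> y \<in> fib \<mu> \<Longrightarrow> x \<oplus>\<^bsub>B \<mu>\<^esub> y \<in> fib \<mu>"
    and B_smult: "x \<in> fib \<mu> \<Longrightarrow> c \<odot>\<^bsub>B \<mu>\<^esub> x \<in> fib \<mu>"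
    and B_smult_zero: "c \<odot>\<^bsub>B \<mu>\<^esub> Z \<mu> = Z \<mu>"
    and B_zero_smult: "x \<in> fib \<mu> \<Longrightarrow> 0 \<odot>\<^bsub>B \<mu>\<^esub> x = Z \<mu>"
    and B_add_zero: "x \<in> fib \<mu> \<Longrightarrow> Z \<mu> \<oplus>\<^bsub>B \<mu>\<^esub> x = x"
    and B_neg: "x \<in> fib \<mu> \<Longrightarrow> (-1) \<odot>\<^bsub>B \<mu>\<^esub> x \<oplus>\<^bsub>B \<mu>\<^esub> x = Z \<mu>"
    and B_assoc: "x \<in> fib \<mu> \<Longrightarrow> y \<in> fib \<mu> \<Longrightarrow> z \<in> fib \<mu>
      \<Longrightarrow> x \<oplus>\<^bsub>B \<mu>\<^esub> y \<oplus>\<^bsub>B \<mu>\<^esub> z = x \<oplus>\<^bsub>B \<mu>\<^esub> (y \<oplus>\<^bsub>B \<mu>\<^esub> z)"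
    and B_comm: "x \<in> fib \<mu> \<Longrightarrow> y \<in> fib \<mu> \<Longrightarrow> x \<oplus>\<^bsub>B \<mu>\<^esub> y = y \<oplus>\<^bsub>B \<mu>\<^esub> x"
    and B_smult_add: "x \<in> fib \<mu> \<Longrightarrow> y \<in> fib \<mu>
      \<Longrightarrow> c \<odot>\<^bsub>B \<mu>\<^esub> (x \<oplus>\<^bsub>B \<mu>\<^esub> y) = c \<odot>\<^bsub>B \<mu>\<^esub> x \<oplus>\<^bsub>B \<mu>\<^esub> c \<odot>\<^bsub>B \<mu>\<^esub> y"
    and B_add_smult: "x \<in> fib \<mu> \<Longrightarrow> (c + d) \<odot>\<^bsub>B \<mu>\<^esub> x = c \<odot>\<^bsub>B \<mu>\<^esub> x \<oplus>\<^bsub>B \<mu>\<^esub> d \<odot>\<^bsub>B \<mu>\<^esub> x"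
    and B_smult_smult: "x \<in> fib \<mu> \<Longrightarrow> c \<odot>\<^bsub>B \<mu>\<^esub> (d \<odot>\<^bsub>B \<mu>\<^esub> x) = (c * d) \<odot>\<^bsub>B \<mu>\<^esub> x"
    and B_one: "x \<in> fib \<mu> \<Longrightarrow> 1 \<odot>\<^bsub>B \<mu>\<^esub> x = x"
proof -
  interpret vectorspace "class_ring :: complex ring" "B \<mu>" by (rule B_vs)
  show "abelian_group (B \<mu>)" by (rule abelian_group_axioms)
  show "Z \<mu> \<in> fib \<mu>"
    "x \<in> fib \<mu> \<Longrightarrow> y \<in> fib \<mu> \<Longrightarrow> x \<oplus>\<^bsub>B \<mu>\<^esub> y \<in> fib \<mu>"
    "x \<in> fib \<mu> \<Longrightarrow> c \<odot>\<^bsub>B \<mu>\<^esub> x \<in> fib \<mu>"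
    "x \<in> fib \<mu> \<Longrightarrow> Z \<mu> \<oplus>\<^bsub>B \<mu>\<^esub> x = x"
    by simp_all
  show "c \<odot>\<^bsub>B \<mu>\<^esub> Z \<mu> = Z \<mu>" by (rule smult_r_null) simp
  show lz: "x \<in> fib \<mu> \<Longrightarrow> 0 \<odot>\<^bsub>B \<mu>\<^esub> x = Z \<mu>" using smult_l_null[of x] by simp
  show "x \<in> fib \<mu> \<Longrightarrow> y \<in> fib \<mu> \<Longrightarrow> z \<in> fib \<mu>
      \<Longrightarrow> x \<oplus>\<^bsub>B \<mu>\<^esub> y \<oplus>\<^bsub>B \<mu>\<^esub> z = x \<oplus>\<^bsub>B \<mu>\<^esub> (y \<oplus>\<^bsub>B \<mu>\<^esub> z)" by (rule M.a_assoc)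
  show "x \<in> fib \<mu> \<Longrightarrow> y \<in> fib \<mu> \<Longrightarrow> x \<oplus>\<^bsub>B \<mu>\<^esub> y = y \<oplus>\<^bsub>B \<mu>\<^esub> x" by (rule M.a_comm)
  show "x \<in> fib \<mu> \<Longrightarrow> y \<in> fib \<mu>
      \<Longrightarrow> c \<odot>\<^bsub>B \<mu>\<^esub> (x \<oplus>\<^bsub>B \<mu>\<^esub> y) = c \<odot>\<^bsub>B \<mu>\<^esub> x \<oplus>\<^bsub>B \<mu>\<^esub> c \<odot>\<^bsub>B \<mu>\<^esub> y"
    by (rule smult_r_distr) simp_all
  show ld: "x \<in> fib \<mu> \<Longrightarrow> (c + d) \<odot>\<^bsub>B \<mu>\<^esub> x = c \<odot>\<^bsub>B \<mu>\<^esub> x \<oplus>\<^bsub>B \<mu>\<^esub> d \<odot>\<^bsub>B \<mu>\<^esub> x" for c d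
    using smult_l_distr[of c d x] by simp
  show "x \<in> fib \<mu> \<Longrightarrow> c \<odot>\<^bsub>B \<mu>\<^esub> (d \<odot>\<^bsub>B \<mu>\<^esub> x) = (c * d) \<odot>\<^bsub>B \<mu>\<^esub> x"
    using smult_assoc1[of c d x] by simp
  show one: "x \<in> fib \<mu> \<Longrightarrow> 1 \<odot>\<^bsub>B \<mu>\<^esub> x = x" using smult_one[of x] by simp
  show "x \<in> fib \<mu> \<Longrightarrow> (-1) \<odot>\<^bsub>B \<mu>\<^esub> x \<oplus>\<^bsub>B \<mu>\<^esub> x = Z \<mu>"
    using ld[of "-1" 1] lz one by simp
qed

text \<open>
  Distinct scalars act differently on a nonzero vector; this separates the weights.
\<close>

lemma B_cancel: "x \<in> fib \<mu> \<Longrightarrow> c \<odot>\<^bsub>B \<mu>\<^esub> x = d \<odot>\<^bsub>B \<mu>\<^esub> x \<Longrightarrow> c \<noteq> d \<Longrightarrow> x = Z \<mu>"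
proof -
  assume x: "x \<in> fib \<mu>" and eq: "c \<odot>\<^bsub>B \<mu>\<^esub> x = d \<odot>\<^bsub>B \<mu>\<^esub> x" and "c \<noteq> d"
  have "(c - d) \<odot>\<^bsub>B \<mu>\<^esub> x = (-d) \<odot>\<^bsub>B \<mu>\<^esub> x \<oplus>\<^bsub>B \<mu>\<^esub> d \<odot>\<^bsub>B \<mu>\<^esub> x"
    using B_add_smult[OF x, of "-d" c] eq by simp
  also have "\<dots> = Z \<mu>" using B_add_smult[OF x, of "-d" d] B_zero_smult[OF x] by simp
  finally have "inverse (c - d) \<odot>\<^bsub>B \<mu>\<^esub> ((c - d) \<odot>\<^bsub>B \<mu>\<^esub> x) = Z \<mu>" by (simp add: B_smult_zero)
  then show ?thesis using B_smult_smult[OF x] B_one[OF x] \<open>c \<noteq> d\<close> by simp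
qed

lemma vertex_of_alt: "vertex_of \<mu> = (\<lambda>j \<in> {..<k}. if ref_weight \<nu> \<mu> (\<beta> j) = 0 then 1 else -1)"
  by (auto simp: vertex_of_def ref_weight_def \<beta>_int fun_eq_iff)

lemma vertex_of_up: assumes "\<mu> \<in> coset"
  shows "\<mu> i \<noteq> -1 \<Longrightarrow> vertex_of (shift i 1 \<mu>) = vertex_of \<mu>"
    and "\<mu> i = -1 \<Longrightarrow> axis i < k \<and> vertex_of (shift i 1 \<mu>) = flip (vertex_of \<mu>) (axis i)"
proof -
  show "\<mu> i \<noteq> -1 \<Longrightarrow> vertex_of (shift i 1 \<mu>) = vertex_of \<mu>"
    using ref_weight_shift(1)[OF assms, of i] by (simp add: vertex_of_alt)
  assume m: "\<mu> i = -1"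
  have "\<nu> i \<in> \<int>" using coset_Ints[OF assms, of i] m by simp
  then have b: "axis i < k" "\<beta> (axis i) = i" using inv_\<beta>[of i] by (simp_all add: axis_def)
  have "vertex_of (shift i 1 \<mu>) j = flip (vertex_of \<mu>) (axis i) j" for j
  proof (cases "j = axis i")
    case True
    then show ?thesis using b m by (simp add: vertex_of_def)
  next
    case False
    then have "j < k \<Longrightarrow> i \<noteq> \<beta> j" using b \<beta>_inv by metis
    then show ?thesis using False by (simp add: vertex_of_def)
  qed
  then show "axis i < k \<and> vertex_of (shift i 1 \<mu>) = flip (vertex_of \<mu>) (axis i)" using b(1) by (simp add: fun_eq_iff)
qed

lemma shift_coset_iff: assumes "c \<in> \<int>" shows "shift i c \<mu> \<in> coset \<longleftrightarrow> \<mu> \<in> coset"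
proof
  assume "shift i c \<mu> \<in> coset"
  from coset_shift[OF this, of "- c" i] assms show "\<mu> \<in> coset" by simp
qed (rule coset_shift[OF _ assms])

lemma shift_coset [simp]: "shift i 1 \<mu> \<in> coset \<longleftrightarrow> \<mu> \<in> coset" "shift i (-1) \<mu> \<in> coset \<longleftrightarrow> \<mu> \<in> coset"
  by (simp_all add: shift_coset_iff)

lemma vertex_of_dn: assumes "\<mu> \<in> coset"
  shows "\<mu> i \<noteq> 0 \<Longrightarrow> vertex_of (shift i (-1) \<mu>) = vertex_of \<mu>"
    and "\<mu> i = 0 \<Longrightarrow> axis i < k \<and> vertex_of (shift i (-1) \<mu>) = flip (vertex_of \<mu>) (axis i)"
  using vertex_of_up[of "shift i (-1) \<mu>" i] assms by (simp_all add: eq_commute[of _ "vertex_of \<mu>"])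

text \<open>
  The prospective action of \<open>t_op i\<close> and \<open>d_op i\<close> out of weight \<open>\<kappa>\<close>. Trivialising by \<open>t_op i\<close> within a
  chamber leaves the factor \<open>\<kappa> i\<close> for \<open>d_op i\<close>; at the wall the arrows of \<open>V\<close> take over.
\<close>

definition up where "up i \<kappa> x = (if \<kappa> i = -1 then mp (vertex_of \<kappa>) (axis i) x else x)"

definition dn where "dn i \<kappa> x = (if \<kappa> i = 0 then mp (vertex_of \<kappa>) (axis i) x else \<kappa> i \<odot>\<^bsub>B \<kappa>\<^esub> x)"

lemma up_dn_linear: assumes c: "\<kappa> \<in> coset"
  shows up_closed: "x \<in> fib \<kappa> \<Longrightarrow> up i \<kappa> x \<in> fib (shift i 1 \<kappa>)"
    and dn_closed: "x \<in> fib \<kappa> \<Longrightarrow> dn i \<kappa> x \<in> fib (shift i (-1) \<kappa>)"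
    and up_add: "x \<in> fib \<kappa> \<Longrightarrow> y \<in> fib \<kappa> \<Longrightarrow>
      up i \<kappa> (x \<oplus>\<^bsub>B \<kappa>\<^esub> y) = up i \<kappa> x \<oplus>\<^bsub>B (shift i 1 \<kappa>)\<^esub> up i \<kappa> y"
    and dn_add: "x \<in> fib \<kappa> \<Longrightarrow> y \<in> fib \<kappa> \<Longrightarrow>
      dn i \<kappa> (x \<oplus>\<^bsub>B \<kappa>\<^esub> y) = dn i \<kappa> x \<oplus>\<^bsub>B (shift i (-1) \<kappa>)\<^esub> dn i \<kappa> y"
    and up_smult: "x \<in> fib \<kappa> \<Longrightarrow> up i \<kappa> (c \<odot>\<^bsub>B \<kappa>\<^esub> x) = c \<odot>\<^bsub>B (shift i 1 \<kappa>)\<^esub> up i \<kappa> x"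
    and dn_smult: "x \<in> fib \<kappa> \<Longrightarrow> dn i \<kappa> (c \<odot>\<^bsub>B \<kappa>\<^esub> x) = c \<odot>\<^bsub>B (shift i (-1) \<kappa>)\<^esub> dn i \<kappa> x"
    and up_zero: "up i \<kappa> (Z \<kappa>) = Z (shift i 1 \<kappa>)"
    and dn_zero: "dn i \<kappa> (Z \<kappa>) = Z (shift i (-1) \<kappa>)"
  using vertex_of_up[OF c, of i] vertex_of_dn[OF c, of i]
  by (simp_all add: up_def dn_def mp_closed mp_add mp_smult mp_zero vertex_of_cverts B_smult B_smult_add
      B_smult_smult B_smult_zero mult.commute)

lemma square_zero: "u \<in> cverts k \<Longrightarrow> x \<in> carrier (sp u) \<Longrightarrow> i < k \<Longrightarrow>
    mp (flip u i) i (mp u i x) = \<zero>\<^bsub>sp u\<^esub>"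
  and square_comm: "u \<in> cverts k \<Longrightarrow> x \<in> carrier (sp u) \<Longrightarrow> i < k \<Longrightarrow> j < k \<Longrightarrow> i \<noteq> j \<Longrightarrow>
    mp (flip u i) j (mp u i x) = mp (flip u j) i (mp u j x)"
  using squares unfolding square_relations_def by blast+

lemma axis_inj: assumes "\<nu> i \<in> \<int>" "\<nu> j \<in> \<int>" "i \<noteq> j" shows "axis i \<noteq> axis j"
  using inv_\<beta>[OF assms(1)] inv_\<beta>[OF assms(2)] assms(3) by (auto simp: axis_def)

lemma up_dn_comm: assumes c: "\<kappa> \<in> coset" and x: "x \<in> fib \<kappa>" and ij: "i \<noteq> j"
  shows up_up: "up i (shift j 1 \<kappa>) (up j \<kappa> x) = up j (shift i 1 \<kappa>) (up i \<kappa> x)"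
    and dn_dn: "dn i (shift j (-1) \<kappa>) (dn j \<kappa> x) = dn j (shift i (-1) \<kappa>) (dn i \<kappa> x)"
    and dn_up: "dn i (shift j 1 \<kappa>) (up j \<kappa> x) = up j (shift i (-1) \<kappa>) (dn i \<kappa> x)"
proof -
  note v = vertex_of_up[OF c, of i] vertex_of_up[OF c, of j] vertex_of_dn[OF c, of i] vertex_of_dn[OF c, of j]
  have int: "\<nu> l \<in> \<int>" if "\<kappa> l = 0 \<or> \<kappa> l = -1" for l using coset_Ints[OF c, of l] that by auto
  have n: "axis i \<noteq> axis j" if "\<kappa> i = 0 \<or> \<kappa> i = -1" "\<kappa> j = 0 \<or> \<kappa> j = -1"
    using axis_inj[OF int int] that ij by blast
  show "up i (shift j 1 \<kappa>) (up j \<kappa> x) = up j (shift i 1 \<kappa>) (up i \<kappa> x)"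
    using ij v n square_comm[OF vertex_of_cverts x, of "axis j" "axis i"]
    by (cases "\<kappa> i = -1"; cases "\<kappa> j = -1") (simp_all add: up_def)
  show "dn i (shift j (-1) \<kappa>) (dn j \<kappa> x) = dn j (shift i (-1) \<kappa>) (dn i \<kappa> x)"
    using ij v n square_comm[OF vertex_of_cverts x, of "axis j" "axis i"] x
    by (cases "\<kappa> i = 0"; cases "\<kappa> j = 0")
      (simp_all add: dn_def mp_smult[OF vertex_of_cverts] B_smult_smult mult.commute)
  show "dn i (shift j 1 \<kappa>) (up j \<kappa> x) = up j (shift i (-1) \<kappa>) (dn i \<kappa> x)"
    using ij v n square_comm[OF vertex_of_cverts x, of "axis j" "axis i"] x
    by (cases "\<kappa> i = 0"; cases "\<kappa> j = -1")
      (simp_all add: dn_def up_def mp_smult[OF vertex_of_cverts])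
qed

text \<open>
  At the wall the scalar \<open>\<kappa> i + 1\<close> is zero, in accordance with the relation that a step and its reversal
  compose to zero.
\<close>

lemma dn_up_same: assumes c: "\<kappa> \<in> coset" and x: "x \<in> fib \<kappa>"
  shows "dn i (shift i 1 \<kappa>) (up i \<kappa> x) = (\<kappa> i + 1) \<odot>\<^bsub>B \<kappa>\<^esub> x"
proof (cases "\<kappa> i = -1")
  case True
  then show ?thesis
    using vertex_of_up(2)[OF c True] square_zero[OF vertex_of_cverts x, of "axis i"] x
    by (simp add: dn_def up_def B_zero_smult)
next
  case False
  then have "\<kappa> i + 1 \<noteq> 0" by (simp add: eq_neg_iff_add_eq_0)
  then show ?thesis using vertex_of_up(1)[OF c False] False by (simp add: dn_def up_def)
qed

lemma up_dn_same: assumes c: "\<kappa> \<in> coset" and x: "x \<in> fib \<kappa>"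
  shows "up i (shift i (-1) \<kappa>) (dn i \<kappa> x) = \<kappa> i \<odot>\<^bsub>B \<kappa>\<^esub> x"
proof (cases "\<kappa> i = 0")
  case True
  then show ?thesis
    using vertex_of_dn(2)[OF c True] square_zero[OF vertex_of_cverts x, of "axis i"] x
    by (simp add: dn_def up_def B_zero_smult)
next
  case False
  then show ?thesis using vertex_of_dn(1)[OF c False] by (simp add: dn_def up_def)
qed

definition Sect :: "(('n \<Rightarrow> complex) \<Rightarrow> 'b) set" where
  "Sect = {f. (\<forall>\<mu>. f \<mu> \<in> fib \<mu>) \<and> finite {\<mu>. f \<mu> \<noteq> Z \<mu>} \<and> {\<mu>. f \<mu> \<noteq> Z \<mu>} \<subseteq> coset}"

lemma Sect_D: "f \<in> Sect \<Longrightarrow> f \<mu> \<in> fib \<mu>"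
    "f \<in> Sect \<Longrightarrow> finite {\<mu>. f \<mu> \<noteq> Z \<mu>}"
    "f \<in> Sect \<Longrightarrow> \<mu> \<notin> coset \<Longrightarrow> f \<mu> = Z \<mu>"
  by (auto simp: Sect_def)

lemma Sect_I:
  assumes "\<And>\<mu>. f \<mu> \<in> fib \<mu>" "finite A" "\<And>\<mu>. f \<mu> \<noteq> Z \<mu> \<Longrightarrow> \<mu> \<in> A \<and> \<mu> \<in> coset"
  shows "f \<in> Sect"
  unfolding Sect_def using assms finite_subset[of "{\<mu>. f \<mu> \<noteq> Z \<mu>}" A] by blast

definition sect_add where "sect_add f g \<mu> = f \<mu> \<oplus>\<^bsub>B \<mu>\<^esub> g \<mu>"
definition sect_S where "sect_S c f \<mu> = c \<odot>\<^bsub>B \<mu>\<^esub> f \<mu>"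
definition sect_T where
  "sect_T i f \<mu> = (if \<mu> \<in> coset then up i (shift i (-1) \<mu>) (f (shift i (-1) \<mu>)) else Z \<mu>)"
definition sect_D where
  "sect_D i f \<mu> = (if \<mu> \<in> coset then dn i (shift i 1 \<mu>) (f (shift i 1 \<mu>)) else Z \<mu>)"
definition sect_zero where "sect_zero \<mu> = Z \<mu>"
definition delta where "delta \<mu> x = (\<lambda>\<kappa>. if \<kappa> = \<mu> then x else Z \<kappa>)"

lemma Sect_closed:
  shows sect_add_Sect: "f \<in> Sect \<Longrightarrow> g \<in> Sect \<Longrightarrow> sect_add f g \<in> Sect"
    and sect_S_Sect: "f \<in> Sect \<Longrightarrow> sect_S c f \<in> Sect"
    and sect_T_Sect: "f \<in> Sect \<Longrightarrow> sect_T i f \<in> Sect"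
    and sect_D_Sect: "f \<in> Sect \<Longrightarrow> sect_D i f \<in> Sect"
    and sect_zero_Sect: "sect_zero \<in> Sect"
    and delta_Sect: "\<mu> \<in> coset \<Longrightarrow> x \<in> fib \<mu> \<Longrightarrow> delta \<mu> x \<in> Sect"
proof -
  show "sect_add f g \<in> Sect" if f: "f \<in> Sect" and g: "g \<in> Sect"
  proof (rule Sect_I)
    show "finite ({\<mu>. f \<mu> \<noteq> Z \<mu>} \<union> {\<mu>. g \<mu> \<noteq> Z \<mu>})" using Sect_D(2) f g by simp
    show "\<mu> \<in> {\<mu>. f \<mu> \<noteq> Z \<mu>} \<union> {\<mu>. g \<mu> \<noteq> Z \<mu>} \<and> \<mu> \<in> coset" if "sect_add f g \<mu> \<noteq> Z \<mu>" for \<mu>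
      using that Sect_D(3)[OF f, of \<mu>] Sect_D(3)[OF g, of \<mu>] B_add_zero[OF B_zero, of \<mu>]
      by (cases "\<mu> \<in> coset") (auto simp: sect_add_def)
  qed (simp add: sect_add_def B_add Sect_D(1) f g)
  show "sect_S c f \<in> Sect" if f: "f \<in> Sect"
  proof (rule Sect_I[OF _ Sect_D(2)[OF f]])
    show "\<mu> \<in> {\<mu>. f \<mu> \<noteq> Z \<mu>} \<and> \<mu> \<in> coset" if "sect_S c f \<mu> \<noteq> Z \<mu>" for \<mu>
      using that Sect_D(3)[OF f, of \<mu>] B_smult_zero[of \<mu> c] by (cases "\<mu> \<in> coset") (auto simp: sect_S_def)
  qed (simp add: sect_S_def B_smult Sect_D(1) f)
  show "sect_T i f \<in> Sect" if f: "f \<in> Sect"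
  proof (rule Sect_I)
    show "finite (shift i 1 ` {\<mu>. f \<mu> \<noteq> Z \<mu>})" using Sect_D(2)[OF f] by (rule finite_imageI)
    show "\<mu> \<in> shift i 1 ` {\<mu>. f \<mu> \<noteq> Z \<mu>} \<and> \<mu> \<in> coset" if "sect_T i f \<mu> \<noteq> Z \<mu>" for \<mu>
      using that up_zero[of "shift i (-1) \<mu>" i]
      by (auto simp: sect_T_def intro!: image_eqI[of _ _ "shift i (-1) \<mu>"] split: if_splits)
    show "sect_T i f \<mu> \<in> fib \<mu>" for \<mu>
      using up_closed[of "shift i (-1) \<mu>" "f (shift i (-1) \<mu>)" i] Sect_D(1)[OF f]
      by (simp add: sect_T_def B_zero)
  qed
  show "sect_D i f \<in> Sect" if f: "f \<in> Sect"
  proof (rule Sect_I)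
    show "finite (shift i (-1) ` {\<mu>. f \<mu> \<noteq> Z \<mu>})" using Sect_D(2)[OF f] by (rule finite_imageI)
    show "\<mu> \<in> shift i (-1) ` {\<mu>. f \<mu> \<noteq> Z \<mu>} \<and> \<mu> \<in> coset" if "sect_D i f \<mu> \<noteq> Z \<mu>" for \<mu>
      using that dn_zero[of "shift i 1 \<mu>" i]
      by (auto simp: sect_D_def intro!: image_eqI[of _ _ "shift i 1 \<mu>"] split: if_splits)
    show "sect_D i f \<mu> \<in> fib \<mu>" for \<mu>
      using dn_closed[of "shift i 1 \<mu>" "f (shift i 1 \<mu>)" i] Sect_D(1)[OF f]
      by (simp add: sect_D_def B_zero)
  qed
  show "sect_zero \<in> Sect"
    by (rule Sect_I[of _ "{}"]) (simp_all add: sect_zero_def B_zero)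
  show "delta \<mu> x \<in> Sect" if "\<mu> \<in> coset" "x \<in> fib \<mu>"
    by (rule Sect_I[of _ "{\<mu>}"]) (use that in \<open>simp_all add: delta_def B_zero split: if_splits\<close>)
qed

text \<open>
  The sections have finite support, and there are only finitely many distinct fibres, each of at most the cardinality
  of the continuum.
\<close>

lemma Sect_lepoll: "Sect \<lesssim> (UNIV :: complex set)"
proof -
  let ?U = "\<Union>v \<in> cverts k. carrier (sp v)"
  have "(card_of (carrier (sp v)), card_of (UNIV :: complex set)) \<in> ordLeq" if "v \<in> cverts k" for v
    using fin_dim_lepoll[OF vs[OF that] fd[OF that]] by (simp only: lepoll_card_of)
  moreover have "(card_of (cverts k), card_of (UNIV :: complex set)) \<in> ordLeq"
  proof -
    have "finite (cverts k)" by (intro finite_PiE) auto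
    then show ?thesis
      using finite_lepoll_infinite[OF infinite_complex] by (simp only: lepoll_card_of)
  qed
  ultimately have "(card_of ?U, card_of (UNIV :: complex set)) \<in> ordLeq"
    by (intro card_of_UNION_ordLeq_infinite[OF infinite_complex]) auto
  then have U: "?U \<lesssim> (UNIV :: complex set)"
    by (simp only: lepoll_card_of)
  have "Sect \<subseteq> {f. finite {\<mu>. f \<mu> \<noteq> sect_zero \<mu>} \<and> (\<forall>\<mu>. f \<mu> \<noteq> sect_zero \<mu> \<longrightarrow> \<mu> \<in> UNIV \<and> f \<mu> \<in> ?U)}"
    using vertex_of_cverts by (auto simp: Sect_def sect_zero_def)
  then have "Sect \<lesssim> {f. finite {\<mu>. f \<mu> \<noteq> sect_zero \<mu>} \<and> (\<forall>\<mu>. f \<mu> \<noteq> sect_zero \<mu> \<longrightarrow> \<mu> \<in> UNIV \<and> f \<mu> \<in> ?U)}"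
    by (rule subset_imp_lepoll)
  also have "\<dots> \<lesssim> (UNIV :: complex set)"
    by (rule finite_support_lepoll[OF infinite_complex finite_functions_lepoll U])
  finally show ?thesis .
qed

end

text \<open>
  The sections are carried over to the type \<open>'a\<close> by an injection \<open>mk\<close>, with inverse \<open>co\<close>. All equations between elements
  of the copy are checked on the coordinates \<open>co x \<mu>\<close>.
\<close>

locale sections_model = cube_sections \<nu> k \<beta> emb V
  for \<nu> :: "'n::finite \<Rightarrow> complex" and k :: nat and \<beta> :: "nat \<Rightarrow> 'n"
    and emb :: "('n poly_op, 'a) module \<Rightarrow> ('n \<Rightarrow> complex) \<Rightarrow> 'a \<Rightarrow> 'b"
    and V :: "(nat \<Rightarrow> int, (nat \<Rightarrow> int) \<times> (nat \<Rightarrow> int), 'b) quiver_rep" +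
  fixes mk :: "(('n \<Rightarrow> complex) \<Rightarrow> 'b) \<Rightarrow> 'a"
  assumes mk_inj: "inj_on mk Sect"
begin

definition co :: "'a \<Rightarrow> ('n \<Rightarrow> complex) \<Rightarrow> 'b" where "co = inv_into Sect mk"

definition sect_group :: "'a ring" where
  "sect_group = \<lparr>carrier = mk ` Sect, monoid.mult = undefined, one = undefined, zero = mk sect_zero,
    add = (\<lambda>x y. mk (sect_add (co x) (co y)))\<rparr>"

lemma co_mk: "f \<in> Sect \<Longrightarrow> co (mk f) = f"
  unfolding co_def by (rule inv_into_f_f[OF mk_inj])

lemma sect_group_simps: "carrier sect_group = mk ` Sect" "\<zero>\<^bsub>sect_group\<^esub> = mk sect_zero" "x \<oplus>\<^bsub>sect_group\<^esub> y = mk (sect_add (co x) (co y))"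
  by (simp_all add: sect_group_def)

lemma co_Sect: "x \<in> carrier sect_group \<Longrightarrow> co x \<in> Sect"
  using co_mk by (auto simp: sect_group_simps)

lemma mk_closed: "f \<in> Sect \<Longrightarrow> mk f \<in> carrier sect_group"
  by (simp add: sect_group_simps)

lemma sect_group_eqI: "x \<in> carrier sect_group \<Longrightarrow> y \<in> carrier sect_group \<Longrightarrow> (\<And>\<mu>. co x \<mu> = co y \<mu>) \<Longrightarrow> x = y"
proof -
  assume x: "x \<in> carrier sect_group" and y: "y \<in> carrier sect_group" and eq: "\<And>\<mu>. co x \<mu> = co y \<mu>"
  from x y obtain f g where fg: "f \<in> Sect" "x = mk f" "g \<in> Sect" "y = mk g" by (auto simp: sect_group_simps)
  then have "f = g" using eq by (simp add: co_mk fun_eq_iff)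
  then show "x = y" using fg by simp
qed

lemma co_B: "x \<in> carrier sect_group \<Longrightarrow> co x \<mu> \<in> fib \<mu>"
  by (rule Sect_D(1)[OF co_Sect])

abbreviation SS :: "complex \<Rightarrow> 'a \<Rightarrow> 'a" where "SS c x \<equiv> mk (sect_S c (co x))"
abbreviation ST :: "'n \<Rightarrow> 'a \<Rightarrow> 'a" where "ST i x \<equiv> mk (sect_T i (co x))"
abbreviation SD :: "'n \<Rightarrow> 'a \<Rightarrow> 'a" where "SD i x \<equiv> mk (sect_D i (co x))"

lemma co_ops:
  shows "\<zero>\<^bsub>sect_group\<^esub> \<in> carrier sect_group" "co \<zero>\<^bsub>sect_group\<^esub> = sect_zero"
    and "x \<in> carrier sect_group \<Longrightarrow> y \<in> carrier sect_group \<Longrightarrow> x \<oplus>\<^bsub>sect_group\<^esub> y \<in> carrier sect_group"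
    and "x \<in> carrier sect_group \<Longrightarrow> y \<in> carrier sect_group \<Longrightarrow> co (x \<oplus>\<^bsub>sect_group\<^esub> y) = sect_add (co x) (co y)"
    and "x \<in> carrier sect_group \<Longrightarrow> SS c x \<in> carrier sect_group"
    and "x \<in> carrier sect_group \<Longrightarrow> ST i x \<in> carrier sect_group"
    and "x \<in> carrier sect_group \<Longrightarrow> SD i x \<in> carrier sect_group"
    and "x \<in> carrier sect_group \<Longrightarrow> co (SS c x) = sect_S c (co x)"
    and "x \<in> carrier sect_group \<Longrightarrow> co (ST i x) = sect_T i (co x)"
    and "x \<in> carrier sect_group \<Longrightarrow> co (SD i x) = sect_D i (co x)"
  by (simp_all add: sect_group_simps(2,3) mk_closed co_mk sect_zero_Sect sect_add_Sect sect_S_Sect sect_T_Sect sect_D_Sect co_Sect)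

lemma sect_group_abelian_group: "abelian_group sect_group"
proof (rule abelian_groupI)
  fix x y z assume x: "x \<in> carrier sect_group"
  show "\<exists>y \<in> carrier sect_group. y \<oplus>\<^bsub>sect_group\<^esub> x = \<zero>\<^bsub>sect_group\<^esub>"
    by (intro bexI[of _ "mk (sect_S (-1) (co x))"] sect_group_eqI)
      (simp_all add: co_ops x sect_add_def sect_S_def sect_zero_def B_neg co_B)
  show "\<zero>\<^bsub>sect_group\<^esub> \<oplus>\<^bsub>sect_group\<^esub> x = x"
    by (rule sect_group_eqI) (simp_all add: co_ops x sect_add_def sect_zero_def B_add_zero co_B)
  assume y: "y \<in> carrier sect_group"
  show "x \<oplus>\<^bsub>sect_group\<^esub> y = y \<oplus>\<^bsub>sect_group\<^esub> x"
    by (rule sect_group_eqI) (simp_all add: co_ops x y sect_add_def B_comm co_B)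
  assume z: "z \<in> carrier sect_group"
  show "x \<oplus>\<^bsub>sect_group\<^esub> y \<oplus>\<^bsub>sect_group\<^esub> z = x \<oplus>\<^bsub>sect_group\<^esub> (y \<oplus>\<^bsub>sect_group\<^esub> z)"
    by (rule sect_group_eqI) (simp_all add: co_ops x y z sect_add_def B_assoc co_B)
qed (simp_all add: co_ops)

lemmas sect_rules = co_mk mk_closed sect_zero_Sect sect_add_Sect sect_S_Sect sect_T_Sect sect_D_Sect co_Sect sect_group_simps(2,3)

lemma sect_group_weyl_action: "weyl_action sect_group SS ST SD"
proof -
  interpret A: abelian_group sect_group by (rule sect_group_abelian_group)
  have shift_ij: "shift i a (shift j b \<mu>) = shift j b (shift i a \<mu>)" for i j :: 'n and a b \<mu>
    by (cases "i = j") (simp_all add: shift_commute add.commute)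
  show ?thesis
  proof
    fix x y :: 'a and a b c :: complex and i j :: 'n assume x: "x \<in> carrier sect_group"
    note xB = co_B[OF x]
    show "SS c x \<in> carrier sect_group" "ST i x \<in> carrier sect_group" "SD i x \<in> carrier sect_group"
      by (simp_all add: sect_rules x)
    show "mk (sect_S (a + b) (co x)) = mk (sect_S a (co x)) \<oplus>\<^bsub>sect_group\<^esub> mk (sect_S b (co x))"
      by (rule sect_group_eqI) (simp_all add: sect_rules x sect_add_def sect_S_def B_add_smult xB)
    show "mk (sect_S a (co (mk (sect_S b (co x))))) = mk (sect_S (a * b) (co x))"
      by (rule sect_group_eqI) (simp_all add: sect_rules x sect_S_def B_smult_smult xB)
    show "mk (sect_S 1 (co x)) = x"
      by (rule sect_group_eqI) (simp_all add: sect_rules x sect_S_def B_one xB)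
    show "ST i (SS c x) = SS c (ST i x)"
    proof (rule sect_group_eqI)
      fix \<mu> show "co (ST i (SS c x)) \<mu> = co (SS c (ST i x)) \<mu>"
        using up_smult[of "shift i (-1) \<mu>" "co x (shift i (-1) \<mu>)" i c] xB
        by (simp add: sect_rules x sect_T_def sect_S_def B_smult_zero)
    qed (simp_all add: sect_rules x)
    show "SD i (SS c x) = SS c (SD i x)"
    proof (rule sect_group_eqI)
      fix \<mu> show "co (SD i (SS c x)) \<mu> = co (SS c (SD i x)) \<mu>"
        using dn_smult[of "shift i 1 \<mu>" "co x (shift i 1 \<mu>)" i c] xB
        by (simp add: sect_rules x sect_D_def sect_S_def B_smult_zero)
    qed (simp_all add: sect_rules x)
    show "mk (sect_T i (co (mk (sect_T j (co x))))) = ST j (ST i x)"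
    proof (cases "i = j")
      case False
      show ?thesis
      proof (rule sect_group_eqI)
        fix \<mu> show "co (mk (sect_T i (co (mk (sect_T j (co x)))))) \<mu> = co (ST j (ST i x)) \<mu>"
          using up_up[of "shift i (-1) (shift j (-1) \<mu>)" "co x (shift i (-1) (shift j (-1) \<mu>))" i j] False xB
          by (simp add: sect_rules x sect_T_def shift_ij[of j _ i])
      qed (simp_all add: sect_rules x)
    qed simp
    show "mk (sect_D i (co (mk (sect_D j (co x))))) = SD j (SD i x)"
    proof (cases "i = j")
      case False
      show ?thesis
      proof (rule sect_group_eqI)
        fix \<mu> show "co (mk (sect_D i (co (mk (sect_D j (co x)))))) \<mu> = co (SD j (SD i x)) \<mu>"
          using dn_dn[of "shift i 1 (shift j 1 \<mu>)" "co x (shift i 1 (shift j 1 \<mu>))" i j] False xB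
          by (simp add: sect_rules x sect_D_def shift_ij[of j _ i])
      qed (simp_all add: sect_rules x)
    qed simp
    show "mk (sect_D i (co (mk (sect_T j (co x))))) = ST j (SD i x)" if ij: "i \<noteq> j"
    proof (rule sect_group_eqI)
      fix \<mu> show "co (mk (sect_D i (co (mk (sect_T j (co x)))))) \<mu> = co (ST j (SD i x)) \<mu>"
        using dn_up[of "shift i 1 (shift j (-1) \<mu>)" "co x (shift i 1 (shift j (-1) \<mu>))" i j] ij xB
        by (simp add: sect_rules x sect_D_def sect_T_def shift_ij[of j _ i])
    qed (simp_all add: sect_rules x)
    show "SD i (ST i x) = ST i (SD i x) \<oplus>\<^bsub>sect_group\<^esub> x"
    proof (rule sect_group_eqI)
      fix \<mu> show "co (SD i (ST i x)) \<mu>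
          = co (ST i (SD i x) \<oplus>\<^bsub>sect_group\<^esub> x) \<mu>"
        using dn_up_same[of \<mu> "co x \<mu>" i] up_dn_same[of \<mu> "co x \<mu>" i] xB[of \<mu>] Sect_D(3)[OF co_Sect[OF x], of \<mu>]
        by (simp add: sect_rules x sect_D_def sect_T_def sect_add_def B_add_smult B_one B_add_zero[OF B_zero])
    qed (simp_all add: sect_rules x)
    assume y: "y \<in> carrier sect_group"
    note yB = co_B[OF y]
    show "mk (sect_S c (co (x \<oplus>\<^bsub>sect_group\<^esub> y))) = SS c x \<oplus>\<^bsub>sect_group\<^esub> SS c y"
      by (rule sect_group_eqI) (simp_all add: sect_rules x y sect_add_def sect_S_def B_smult_add xB yB)
    show "mk (sect_T i (co (x \<oplus>\<^bsub>sect_group\<^esub> y))) = ST i x \<oplus>\<^bsub>sect_group\<^esub> ST i y"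
    proof (rule sect_group_eqI)
      fix \<mu> show "co (mk (sect_T i (co (x \<oplus>\<^bsub>sect_group\<^esub> y)))) \<mu> = co (ST i x \<oplus>\<^bsub>sect_group\<^esub> ST i y) \<mu>"
        using up_add[of "shift i (-1) \<mu>" "co x (shift i (-1) \<mu>)" "co y (shift i (-1) \<mu>)" i] xB yB
        by (simp add: sect_rules x y sect_T_def sect_add_def B_add_zero B_zero)
    qed (simp_all add: sect_rules x y)
    show "mk (sect_D i (co (x \<oplus>\<^bsub>sect_group\<^esub> y))) = SD i x \<oplus>\<^bsub>sect_group\<^esub> SD i y"
    proof (rule sect_group_eqI)
      fix \<mu> show "co (mk (sect_D i (co (x \<oplus>\<^bsub>sect_group\<^esub> y)))) \<mu> = co (SD i x \<oplus>\<^bsub>sect_group\<^esub> SD i y) \<mu>"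
        using dn_add[of "shift i 1 \<mu>" "co x (shift i 1 \<mu>)" "co y (shift i 1 \<mu>)" i] xB yB
        by (simp add: sect_rules x y sect_D_def sect_add_def B_add_zero B_zero)
    qed (simp_all add: sect_rules x y)
  qed
qed

interpretation A: weyl_action sect_group SS ST SD
  by (rule sect_group_weyl_action)

definition sect_module :: "('n poly_op, 'a) module" where
  "sect_module = weyl_action.wmod sect_group SS ST SD"

lemma sect_module_simps: "carrier sect_module = carrier sect_group" "\<zero>\<^bsub>sect_module\<^esub> = \<zero>\<^bsub>sect_group\<^esub>" "x \<oplus>\<^bsub>sect_module\<^esub> y = x \<oplus>\<^bsub>sect_group\<^esub> y"
  by (simp_all add: sect_module_def A.wmod_def)

lemma sect_module_ops:
  assumes "x \<in> carrier sect_group"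
  shows "scalar_op c \<odot>\<^bsub>sect_module\<^esub> x = SS c x" "t_op i \<odot>\<^bsub>sect_module\<^esub> x = ST i x"
    "d_op i \<odot>\<^bsub>sect_module\<^esub> x = SD i x"
  using A.act[OF A.rep_scalar assms, of c] A.act[OF A.rep_t assms, of i] A.act[OF A.rep_d assms, of i]
  by (simp_all add: sect_module_def A.wmod_def)

interpretation X: weyl_module sect_module
  unfolding weyl_module_def sect_module_def by (rule A.left_module_wmod)

lemma delta_co: "x \<in> carrier sect_group \<Longrightarrow> delta \<mu> (co x \<mu>) \<in> Sect"
proof (cases "\<mu> \<in> coset")
  case True
  assume "x \<in> carrier sect_group"
  then show ?thesis by (rule delta_Sect[OF True co_B])
next
  case False
  assume "x \<in> carrier sect_group"
  then have "delta \<mu> (co x \<mu>) = sect_zero" using Sect_D(3)[OF co_Sect False] by (auto simp: delta_def sect_zero_def)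
  then show ?thesis by (simp add: sect_zero_Sect)
qed

text \<open>
  The operator \<open>t_op i\<close> after \<open>d_op i\<close> multiplies the value at \<open>\<kappa>\<close> by \<open>\<kappa> i\<close>, so a section of
  weight \<open>\<mu>\<close> is zero at every other weight.
\<close>

lemma sect_module_weight_space: "x \<in> X.W \<mu> \<longleftrightarrow> x \<in> carrier sect_group \<and> (\<forall>\<kappa>. \<kappa> \<noteq> \<mu> \<longrightarrow> co x \<kappa> = Z \<kappa>)"
proof (cases "x \<in> carrier sect_group")
  case True
  note x = True
  have td: "co (X.T i (X.D i x)) \<kappa> = \<kappa> i \<odot>\<^bsub>B \<kappa>\<^esub> co x \<kappa>" for i \<kappa>
    using up_dn_same[of \<kappa> "co x \<kappa>" i] co_B[OF x] Sect_D(3)[OF co_Sect[OF x], of \<kappa>]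
    by (simp add: sect_module_ops sect_rules x sect_T_def sect_D_def B_smult_zero)
  have s: "co (X.S c x) \<kappa> = c \<odot>\<^bsub>B \<kappa>\<^esub> co x \<kappa>" for c \<kappa>
    by (simp add: sect_module_ops sect_rules x sect_S_def)
  have "X.T i (X.D i x) = X.S (\<mu> i) x \<longleftrightarrow> (\<forall>\<kappa>. \<kappa> i \<odot>\<^bsub>B \<kappa>\<^esub> co x \<kappa> = \<mu> i \<odot>\<^bsub>B \<kappa>\<^esub> co x \<kappa>)" for i
  proof
    assume "X.T i (X.D i x) = X.S (\<mu> i) x"
    then show "\<forall>\<kappa>. \<kappa> i \<odot>\<^bsub>B \<kappa>\<^esub> co x \<kappa> = \<mu> i \<odot>\<^bsub>B \<kappa>\<^esub> co x \<kappa>" using td s by metis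
  next
    assume eq: "\<forall>\<kappa>. \<kappa> i \<odot>\<^bsub>B \<kappa>\<^esub> co x \<kappa> = \<mu> i \<odot>\<^bsub>B \<kappa>\<^esub> co x \<kappa>"
    show "X.T i (X.D i x) = X.S (\<mu> i) x"
    proof (rule sect_group_eqI)
      show "co (X.T i (X.D i x)) \<kappa> = co (X.S (\<mu> i) x) \<kappa>" for \<kappa> using eq td s by simp
    qed (simp_all add: sect_module_ops sect_rules x)
  qed
  then have "x \<in> X.W \<mu> \<longleftrightarrow> (\<forall>i \<kappa>. \<kappa> i \<odot>\<^bsub>B \<kappa>\<^esub> co x \<kappa> = \<mu> i \<odot>\<^bsub>B \<kappa>\<^esub> co x \<kappa>)"
    using x by (simp add: X.W_iff sect_module_simps)
  also have "\<dots> \<longleftrightarrow> (\<forall>\<kappa>. \<kappa> \<noteq> \<mu> \<longrightarrow> co x \<kappa> = Z \<kappa>)"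
  proof
    assume a: "\<forall>i \<kappa>. \<kappa> i \<odot>\<^bsub>B \<kappa>\<^esub> co x \<kappa> = \<mu> i \<odot>\<^bsub>B \<kappa>\<^esub> co x \<kappa>"
    show "\<forall>\<kappa>. \<kappa> \<noteq> \<mu> \<longrightarrow> co x \<kappa> = Z \<kappa>"
    proof (intro allI impI)
      fix \<kappa> assume "\<kappa> \<noteq> \<mu>"
      then obtain i where "\<kappa> i \<noteq> \<mu> i" by auto
      then show "co x \<kappa> = Z \<kappa>" using B_cancel[OF co_B[OF x]] a by blast
    qed
  next
    assume a: "\<forall>\<kappa>. \<kappa> \<noteq> \<mu> \<longrightarrow> co x \<kappa> = Z \<kappa>"
    show "\<forall>i \<kappa>. \<kappa> i \<odot>\<^bsub>B \<kappa>\<^esub> co x \<kappa> = \<mu> i \<odot>\<^bsub>B \<kappa>\<^esub> co x \<kappa>"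
    proof (intro allI)
      fix i \<kappa> show "\<kappa> i \<odot>\<^bsub>B \<kappa>\<^esub> co x \<kappa> = \<mu> i \<odot>\<^bsub>B \<kappa>\<^esub> co x \<kappa>"
        using a by (cases "\<kappa> = \<mu>") (simp_all add: B_smult_zero)
    qed
  qed
  finally show ?thesis using x by simp
next
  case False
  then show ?thesis by (simp add: X.W_iff sect_module_simps)
qed

lemma co_finsum:
  assumes f: "\<And>\<mu>. f \<mu> \<in> X.W \<mu>" and A: "finite {\<mu>. f \<mu> \<noteq> \<zero>\<^bsub>sect_module\<^esub>}"
  shows "co (\<Oplus>\<^bsub>sect_module\<^esub>\<mu> \<in> {\<mu>. f \<mu> \<noteq> \<zero>\<^bsub>sect_module\<^esub>}. f \<mu>) \<kappa> = co (f \<kappa>) \<kappa>"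
proof -
  let ?A = "{\<mu>. f \<mu> \<noteq> \<zero>\<^bsub>sect_module\<^esub>}"
  interpret B: abelian_group "B \<kappa>" by (rule B_ab)
  have fc: "f \<mu> \<in> carrier sect_group" for \<mu> using f sect_module_weight_space by blast
  have "co (\<Oplus>\<^bsub>sect_module\<^esub>\<mu> \<in> ?A. f \<mu>) \<kappa> = (\<Oplus>\<^bsub>B \<kappa>\<^esub>\<mu> \<in> ?A. co (f \<mu>) \<kappa>)"
    by (rule finsum_additive[OF X.M.abelian_group_axioms B_ab A, of f "\<lambda>x. co x \<kappa>"])
      (simp_all add: sect_module_simps(1) fc co_B co_ops sect_module_simps(3) sect_add_def)
  also have "\<dots> = (\<Oplus>\<^bsub>B \<kappa>\<^esub>\<mu> \<in> {\<kappa>}. co (f \<mu>) \<kappa>)"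
  proof (rule B.add.finprod_mono_neutral_cong)
    show "co (f \<mu>) \<kappa> = Z \<kappa>" if "\<mu> \<in> {\<kappa>} - ?A" for \<mu>
    proof -
      have "f \<mu> = \<zero>\<^bsub>sect_group\<^esub>" using that by (auto simp: sect_module_simps)
      then show ?thesis by (simp add: co_ops sect_zero_def)
    qed
    show "co (f \<mu>) \<kappa> = Z \<kappa>" if "\<mu> \<in> ?A - {\<kappa>}" for \<mu>
      using that f[of \<mu>] unfolding sect_module_weight_space by auto
  qed (use A in \<open>simp_all add: fc co_B\<close>)
  also have "\<dots> = co (f \<kappa>) \<kappa>"
    by (subst B.finsum_insert) (simp_all add: fc co_B)
  finally show ?thesis .
qed

text \<open>
  A section is the sum of its values, each regarded as a section supported at one weight.
\<close>

lemma sect_module_weight_module: "weight_module sect_module"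
  unfolding weight_module_def
proof (intro conjI ballI)
  show "left_module weyl_algebra sect_module" by (rule X.left_module_axioms)
  fix x assume "x \<in> carrier sect_module"
  then have x: "x \<in> carrier sect_group" by (simp add: sect_module_simps)
  define f where "f \<mu> = mk (delta \<mu> (co x \<mu>))" for \<mu>
  have co_f: "co (f \<mu>) = delta \<mu> (co x \<mu>)" and f_c: "f \<mu> \<in> carrier sect_group" for \<mu>
    by (simp_all add: f_def co_mk mk_closed delta_co[OF x])
  have fW: "f \<mu> \<in> X.W \<mu>" for \<mu>
    by (simp add: sect_module_weight_space f_c co_f delta_def)
  have "{\<mu>. f \<mu> \<noteq> \<zero>\<^bsub>sect_module\<^esub>} \<subseteq> {\<mu>. co x \<mu> \<noteq> Z \<mu>}"
  proof
    fix \<mu> assume "\<mu> \<in> {\<mu>. f \<mu> \<noteq> \<zero>\<^bsub>sect_module\<^esub>}"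
    moreover have "f \<mu> = \<zero>\<^bsub>sect_group\<^esub>" if "co x \<mu> = Z \<mu>"
      by (rule sect_group_eqI[OF f_c]) (simp_all add: co_ops co_f delta_def sect_zero_def that)
    ultimately show "\<mu> \<in> {\<mu>. co x \<mu> \<noteq> Z \<mu>}" by (auto simp: sect_module_simps)
  qed
  then have fin: "finite {\<mu>. f \<mu> \<noteq> \<zero>\<^bsub>sect_module\<^esub>}"
    using Sect_D(2)[OF co_Sect[OF x]] finite_subset by blast
  have sum_c: "(\<Oplus>\<^bsub>sect_module\<^esub>\<mu> \<in> A. g \<mu>) \<in> carrier sect_group" if "\<And>\<mu>. g \<mu> \<in> X.W \<mu>" for g A
    using X.M.finsum_closed[of g A] X.W_carrier[OF that] by (simp add: sect_module_simps)
  show "\<exists>!f. (\<forall>\<mu>. f \<mu> \<in> X.W \<mu>) \<and> finite {\<mu>. f \<mu> \<noteq> \<zero>\<^bsub>sect_module\<^esub>} \<and> x = (\<Oplus>\<^bsub>sect_module\<^esub>\<mu> \<in> {\<mu>. f \<mu> \<noteq> \<zero>\<^bsub>sect_module\<^esub>}. f \<mu>)"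
  proof (rule ex1I[of _ f])
    have "x = (\<Oplus>\<^bsub>sect_module\<^esub>\<mu> \<in> {\<mu>. f \<mu> \<noteq> \<zero>\<^bsub>sect_module\<^esub>}. f \<mu>)"
      by (rule sect_group_eqI[OF x sum_c[OF fW]]) (simp add: co_finsum[OF fW fin] co_f delta_def)
    then show "(\<forall>\<mu>. f \<mu> \<in> X.W \<mu>) \<and> finite {\<mu>. f \<mu> \<noteq> \<zero>\<^bsub>sect_module\<^esub>} \<and> x = (\<Oplus>\<^bsub>sect_module\<^esub>\<mu> \<in> {\<mu>. f \<mu> \<noteq> \<zero>\<^bsub>sect_module\<^esub>}. f \<mu>)"
      using fW fin by blast
  next
    fix g assume g: "(\<forall>\<mu>. g \<mu> \<in> X.W \<mu>) \<and> finite {\<mu>. g \<mu> \<noteq> \<zero>\<^bsub>sect_module\<^esub>} \<and> x = (\<Oplus>\<^bsub>sect_module\<^esub>\<mu> \<in> {\<mu>. g \<mu> \<noteq> \<zero>\<^bsub>sect_module\<^esub>}. g \<mu>)"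
    then have gW: "g \<mu> \<in> X.W \<mu>" for \<mu> by blast
    have diag: "co x \<kappa> = co (g \<kappa>) \<kappa>" for \<kappa>
      using co_finsum[of g \<kappa>] g by simp
    show "g = f"
    proof
      fix \<mu>
      show "g \<mu> = f \<mu>"
      proof (rule sect_group_eqI[OF _ f_c])
        show "g \<mu> \<in> carrier sect_group" using gW sect_module_weight_space by blast
        show "co (g \<mu>) \<kappa> = co (f \<mu>) \<kappa>" for \<kappa>
          using diag[of \<mu>] gW[of \<mu>] unfolding sect_module_weight_space by (auto simp: co_f delta_def)
      qed
    qed
  qed
qed

lemma sect_module_fin_dim: "vectorspace.fin_dim class_ring (weight_vs sect_module \<mu>)"
proof -
  \<comment> \<open>outside the coset the weight space is zero, hence also an image of the fibre\<close>
  let ?h = "\<lambda>x. if \<mu> \<in> coset then mk (delta \<mu> x) else \<zero>\<^bsub>sect_module\<^esub>"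
  have surj: "?h ` fib \<mu> = carrier (weight_vs sect_module \<mu>)"
  proof (intro equalityI subsetI)
    fix y assume "y \<in> ?h ` fib \<mu>"
    then obtain x where x: "x \<in> fib \<mu>" "y = ?h x" by blast
    have "mk (delta \<mu> x) \<in> X.W \<mu>" if "\<mu> \<in> coset"
      unfolding sect_module_weight_space co_mk[OF delta_Sect[OF that x(1)]]
      by (simp add: mk_closed delta_Sect that x(1)) (simp add: delta_def)
    then show "y \<in> carrier (weight_vs sect_module \<mu>)"
      using X.W_zero by (simp add: x(2) weight_vs_def)
  next
    fix y assume "y \<in> carrier (weight_vs sect_module \<mu>)"
    then have y: "y \<in> carrier sect_group" and off: "\<And>\<kappa>. \<kappa> \<noteq> \<mu> \<Longrightarrow> co y \<kappa> = Z \<kappa>"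
      by (simp_all add: weight_vs_def sect_module_weight_space)
    have "y = ?h (co y \<mu>)"
    proof (rule sect_group_eqI[OF y])
      show "?h (co y \<mu>) \<in> carrier sect_group" using delta_co[OF y] by (simp add: mk_closed sect_module_simps co_ops)
      show "co y \<kappa> = co (?h (co y \<mu>)) \<kappa>" for \<kappa>
        using off[of \<kappa>] Sect_D(3)[OF co_Sect[OF y], of \<kappa>] delta_co[OF y, of \<mu>]
        by (cases "\<kappa> = \<mu>") (simp_all add: co_mk delta_def sect_module_simps co_ops sect_zero_def)
    qed
    then show "y \<in> ?h ` fib \<mu>" using co_B[OF y] by blast
  qed
  interpret Bv: vectorspace "class_ring :: complex ring" "B \<mu>" by (rule B_vs)
  interpret Wv: vectorspace "class_ring :: complex ring" "weight_vs sect_module \<mu>" by (rule X.weight_vs_vectorspace)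
  have "linear_map class_ring (B \<mu>) (weight_vs sect_module \<mu>) ?h"
  proof
    have d: "delta \<mu> (x \<oplus>\<^bsub>B \<mu>\<^esub> y) = sect_add (delta \<mu> x) (delta \<mu> y)" for x y
    proof
      fix \<kappa> show "delta \<mu> (x \<oplus>\<^bsub>B \<mu>\<^esub> y) \<kappa> = sect_add (delta \<mu> x) (delta \<mu> y) \<kappa>"
        using B_add_zero[OF B_zero] by (cases "\<kappa> = \<mu>") (simp_all add: delta_def sect_add_def)
    qed
    have e: "delta \<mu> (c \<odot>\<^bsub>B \<mu>\<^esub> x) = sect_S c (delta \<mu> x)" for c x
    proof
      fix \<kappa> show "delta \<mu> (c \<odot>\<^bsub>B \<mu>\<^esub> x) \<kappa> = sect_S c (delta \<mu> x) \<kappa>"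
        by (cases "\<kappa> = \<mu>") (simp_all add: delta_def sect_S_def B_smult_zero)
    qed
    show "?h \<in> LinearCombinations.module_hom class_ring (B \<mu>) (weight_vs sect_module \<mu>)"
      unfolding vector_hom_iff
    proof (intro conjI ballI allI)
      show "?h x \<in> carrier (weight_vs sect_module \<mu>)" if "x \<in> fib \<mu>" for x using surj that by blast
      show "?h (x \<oplus>\<^bsub>B \<mu>\<^esub> y) = ?h x \<oplus>\<^bsub>weight_vs sect_module \<mu>\<^esub> ?h y" if "x \<in> fib \<mu>" "y \<in> fib \<mu>" for x y
        using that X.M.l_zero[OF X.M.zero_closed] by (simp add: weight_vs_def d sect_module_simps(3) sect_group_simps(3) co_mk delta_Sect)
      show "?h (c \<odot>\<^bsub>B \<mu>\<^esub> x) = c \<odot>\<^bsub>weight_vs sect_module \<mu>\<^esub> ?h x" if "x \<in> fib \<mu>" for c x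
        using that X.S_zero[of c] by (simp add: weight_vs_def e sect_module_ops mk_closed co_mk delta_Sect)
    qed
  qed
  from linear_map.image_fin_dim[OF this fd[OF vertex_of_cverts] surj] show ?thesis .
qed

lemma sect_module_Obj: "sect_module \<in> Obj C"
proof -
  have "x = \<zero>\<^bsub>sect_module\<^esub>" if "\<mu> \<notin> coset" "x \<in> X.W \<mu>" for \<mu> x
  proof -
    from that(2) have x: "x \<in> carrier sect_group" and off: "\<And>\<kappa>. \<kappa> \<noteq> \<mu> \<Longrightarrow> co x \<kappa> = Z \<kappa>"
      by (simp_all add: sect_module_weight_space)
    show ?thesis
      unfolding sect_module_simps
    proof (rule sect_group_eqI[OF x co_ops(1)])
      show "co x \<kappa> = co \<zero>\<^bsub>sect_group\<^esub> \<kappa>" for \<kappa>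
        using off[of \<kappa>] Sect_D(3)[OF co_Sect[OF x] that(1)] by (cases "\<kappa> = \<mu>") (simp_all add: co_ops sect_zero_def)
    qed
  qed
  then have "weight_supp sect_module \<subseteq> coset"
    using X.W_zero unfolding weight_supp_def by blast
  then show ?thesis
    by (simp add: weight_cat_def fin_weight_modules_def sect_module_weight_module sect_module_fin_dim)
qed

text \<open>
  Evaluation at the reference weight of a vertex identifies the weight space there with the space
  of \<open>V\<close> at that vertex.
\<close>

lemma Fob_sect_module_iso: "\<exists>H. is_iso Q (Fob sect_module) V H"
proof -
  define H where "H = (\<lambda>v \<in> cverts k. \<lambda>y \<in> carrier (Fsp sect_module v). co (prj sect_module (weight_of v) y) (weight_of v))"
  have H: "H v (emb sect_module (weight_of v) x) = co x (weight_of v)" if "v \<in> cverts k" "x \<in> X.W (weight_of v)" for v x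
    using that by (simp add: H_def Fsp_simps prj_emb[OF sect_module_Obj])
  have Bv: "B (weight_of v) = sp v" if "v \<in> cverts k" for v using vertex_of_weight_of[OF that] by simp
  have Wc: "x \<in> carrier sect_group" if "x \<in> X.W \<mu>" for x \<mu> using that sect_module_weight_space by blast
  have bij: "bij_betw (H v) (carrier (rspace (Fob sect_module) v)) (carrier (sp v))" if v: "v \<in> cverts k" for v
    unfolding bij_betw_def Fob_simps Fsp_simps
  proof
    show "inj_on (H v) (emb sect_module (weight_of v) ` X.W (weight_of v))"
    proof (rule inj_onI)
      fix y z assume "y \<in> emb sect_module (weight_of v) ` X.W (weight_of v)" "z \<in> emb sect_module (weight_of v) ` X.W (weight_of v)" and eq: "H v y = H v z"
      then obtain x w where x: "x \<in> X.W (weight_of v)" "y = emb sect_module (weight_of v) x"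
        and w: "w \<in> X.W (weight_of v)" "z = emb sect_module (weight_of v) w" by blast
      have "co x (weight_of v) = co w (weight_of v)" using eq H[OF v x(1)] H[OF v w(1)] x(2) w(2) by simp
      then have "co x \<kappa> = co w \<kappa>" for \<kappa>
        using x(1) w(1) unfolding sect_module_weight_space by (cases "\<kappa> = weight_of v") simp_all
      then have "x = w" using sect_group_eqI[OF Wc[OF x(1)] Wc[OF w(1)]] by blast
      then show "y = z" using x w by simp
    qed
    show "H v ` (emb sect_module (weight_of v) ` X.W (weight_of v)) = carrier (sp v)"
    proof (intro equalityI subsetI)
      fix z assume "z \<in> H v ` (emb sect_module (weight_of v) ` X.W (weight_of v))"
      then obtain x where x: "x \<in> X.W (weight_of v)" "z = H v (emb sect_module (weight_of v) x)" by blast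
      then show "z \<in> carrier (sp v)" using H[OF v x(1)] co_B[OF Wc[OF x(1)], of "weight_of v"] Bv[OF v] by simp
    next
      fix z assume "z \<in> carrier (sp v)"
      then have d: "delta (weight_of v) z \<in> Sect" using Bv[OF v] by (intro delta_Sect[OF weight_of_coset]) simp
      then have x: "mk (delta (weight_of v) z) \<in> X.W (weight_of v)"
        by (simp add: sect_module_weight_space mk_closed co_mk) (simp add: delta_def)
      have "H v (emb sect_module (weight_of v) (mk (delta (weight_of v) z))) = z"
        unfolding H[OF v x] co_mk[OF d] by (simp add: delta_def)
      then show "z \<in> H v ` (emb sect_module (weight_of v) ` X.W (weight_of v))" using x by (metis imageI)
    qed
  qed
  have "H \<in> Hom Q (Fob sect_module) V"
    unfolding Qhom_iff quiver_rep_hom_iff vector_hom_iff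
  proof (intro conjI ballI allI impI)
    show "H \<in> extensional (cverts k)" by (simp add: H_def)
    fix v assume v: "v \<in> cverts k"
    show "H v \<in> extensional (carrier (rspace (Fob sect_module) v))" using v by (simp add: H_def Fob_simps)
    fix y assume y: "y \<in> carrier (rspace (Fob sect_module) v)"
    show "H v y \<in> carrier (sp v)" using bij_betw_apply[OF bij[OF v] y] .
    from y obtain x where x: "x \<in> X.W (weight_of v)" "y = emb sect_module (weight_of v) x" by (auto simp: Fob_simps Fsp_simps)
    show "H v (y \<oplus>\<^bsub>rspace (Fob sect_module) v\<^esub> z) = H v y \<oplus>\<^bsub>sp v\<^esub> H v z" if z: "z \<in> carrier (rspace (Fob sect_module) v)" for z
    proof -
      from z obtain w where w: "w \<in> X.W (weight_of v)" "z = emb sect_module (weight_of v) w" by (auto simp: Fob_simps Fsp_simps)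
      show ?thesis
        using H[OF v x(1)] H[OF v w(1)] H[OF v X.W_add[OF x(1) w(1)]] Wc[OF x(1)] Wc[OF w(1)] Bv[OF v]
        by (simp add: x w Fob_simps Fsp_simps prj_emb[OF sect_module_Obj] sect_module_simps(3) co_ops sect_add_def)
    qed
    show "H v (c \<odot>\<^bsub>rspace (Fob sect_module) v\<^esub> y) = c \<odot>\<^bsub>sp v\<^esub> H v y" for c
      using H[OF v x(1)] H[OF v X.W_S[OF x(1), of c]] Wc[OF x(1)] Bv[OF v]
      by (simp add: x Fob_simps Fsp_simps prj_emb[OF sect_module_Obj] sect_module_ops co_ops sect_S_def)
    fix i assume i: "i < k"
    note fv = flip_cverts[OF v i] and ax = arc_op_W[OF sect_module_Obj v i x(1)]
    have "H (flip v i) (rmap (Fob sect_module) (v, flip v i) y) = co (arc_op v (flip v i) \<odot>\<^bsub>sect_module\<^esub> x) (weight_of (flip v i))"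
      using Fmp_emb[OF sect_module_Obj v i x(1)] H[OF fv ax] by (simp add: x(2) Fob_simps)
    also have "\<dots> = mp v i (co x (weight_of v))"
    proof -
      have b: "axis (\<beta> i) = i" using \<beta>_inv[OF i] by (simp add: axis_def)
      have w: "weight_of v (\<beta> i) = (if v i = 1 then 0 else -1)" by (rule weight_of_\<beta>[OF i])
      from cvert_nz[OF v i] show ?thesis
      proof
        assume m: "v i = 1"
        then show ?thesis
          using weight_of_flip(2)[OF v i m] Wc[OF x(1)] w b weight_of_coset[of v] vertex_of_weight_of[OF v]
          by (simp add: arc_op[OF v i] sect_module_ops co_ops sect_D_def dn_def)
      next
        assume m: "v i = -1"
        then show ?thesis
          using weight_of_flip(1)[OF v i m] Wc[OF x(1)] w b weight_of_coset[of v] vertex_of_weight_of[OF v]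
          by (simp add: arc_op[OF v i] sect_module_ops co_ops sect_T_def up_def)
      qed
    qed
    finally show "H (flip v i) (rmap (Fob sect_module) (v, flip v i) y) = mp v i (H v y)"
      using H[OF v x(1)] by (simp add: x(2))
  qed
  from Q_isoI[OF Fob_cube_rep[OF sect_module_Obj] this bij] show ?thesis by blast
qed

end

section \<open>The equivalence\<close>

context weight_cube
begin

lemma F_ess_surj:
  assumes U: "(UNIV :: complex set) \<lesssim> (UNIV :: 'a set)" and V: "V \<in> Obj Q"
  shows "\<exists>M \<in> Obj C. \<exists>H. is_iso Q (Fob M) V H"
proof -
  interpret V: cube_rep k V by (rule cube_obj_cube_rep[OF V])
  have "V.square_relations" using V V.cube_relations_iff by (simp add: cube_rep_cat_def)
  then interpret S: cube_sections \<nu> k \<beta> emb V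
    by unfold_locales
  obtain mk :: "_ \<Rightarrow> 'a" where "inj_on mk S.Sect"
    using lepoll_trans[OF S.Sect_lepoll U] unfolding lepoll_def by blast
  then interpret S: sections_model \<nu> k \<beta> emb V mk
    by unfold_locales
  show ?thesis using S.sect_module_Obj S.Fob_sect_module_iso by blast
qed

lemma equivalence:
  assumes "(UNIV :: complex set) \<lesssim> (UNIV :: 'a set)"
  shows "equivalent_categories C Q"
proof (rule ff_es_functor.equivalence)
  show "ff_es_functor C Q F"
  proof (intro ff_es_functor.intro ff_es_functor_axioms.intro)
    show "category C" by (rule weight_cat_category)
    show "category Q" by (rule cube_rep_cat_category)
    show "is_functor C Q F" by (rule F_functor)
  qed (use Fhom_full Fhom_faithful F_ess_surj[OF assms] in \<open>simp_all add: F_def\<close>)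
qed

end

theorem theorem2p10:
  fixes \<nu> :: "'n::finite \<Rightarrow> complex" and k :: nat
  assumes universe_a: "(UNIV :: complex set) \<lesssim> (UNIV :: 'a set)"
    and universe_b: "(UNIV :: complex set) \<lesssim> (UNIV :: 'b set)"
    and k: "k = card {i. \<nu> i \<in> \<int>}"
  shows "equivalent_categories
    (weight_cat (weight_coset \<nu>) :: (('n poly_op, 'a) module, 'a \<Rightarrow> 'a) cat)
    (cube_rep_cat k :: ((nat \<Rightarrow> int, (nat \<Rightarrow> int) \<times> (nat \<Rightarrow> int), 'b) quiver_rep,
       (nat \<Rightarrow> int) \<Rightarrow> 'b \<Rightarrow> 'b) cat)"
proof -
  obtain \<beta> where \<beta>: "bij_betw \<beta> {..<k} {i. \<nu> i \<in> \<int>}"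
    using ex_bij_betw_nat_finite[of "{i. \<nu> i \<in> \<int>}"] k by (auto simp: atLeast0LessThan)
  define emb :: "('n poly_op, 'a) module \<Rightarrow> ('n \<Rightarrow> complex) \<Rightarrow> 'a \<Rightarrow> 'b" where
    "emb M \<mu> = (SOME e. inj_on e (weight_space M \<mu>))" for M \<mu>
  have emb: "inj_on (emb M \<mu>) (weight_space M \<mu>)"
    if M: "M \<in> Obj (weight_cat (weight_coset \<nu>))" for M \<mu>
  proof -
    interpret M: wt_module M by (rule weight_obj_wt_module[OF M])
    have "carrier (weight_vs M \<mu>) \<lesssim> (UNIV :: complex set)"
      by (rule fin_dim_lepoll[OF M.weight_vs_vectorspace])
        (use M in \<open>simp add: weight_cat_def fin_weight_modules_def\<close>)
    from lepoll_trans[OF this universe_b] have "\<exists>e :: 'a \<Rightarrow> 'b. inj_on e (weight_space M \<mu>)"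
      by (simp add: weight_vs_def lepoll_def)
    then show ?thesis unfolding emb_def by (rule someI_ex)
  qed
  interpret weight_cube \<nu> k \<beta> emb
    by unfold_locales (use \<beta> emb in simp_all)
  show ?thesis by (rule equivalence[OF universe_a])
qed

end
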